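(* In the setting and notation of the context, define constants \begin{align*} q_{i,j,\phi}&=\psi_i(g_{j,\phi}z_{i,j,\phi})\,\psi_j(g_{i,\phi}^{-1}z_{i,j,\phi})\,\phi(z_{i,j,\phi}),\\ q'_{i,j,k,\phi}&=\psi_j(g_{i,\phi})^{-1}\psi_k(z'_{i,j,k,\phi})\,\phi(z'_{i,j,k,\phi}),\\ q''_{i,k,\phi}&=\psi_i(g_{i,\phi\psi_i^{p-2}})^{-1}\cdots\psi_i(g_{i,\phi\psi_i})^{-p+2}\psi_i(g_{i,\phi})^{-p+1}\psi_k(z''_{i,k,\phi})\,\phi(z''_{i,k,\phi}). \end{align*} Then we have \begin{align*} \mathsf w_{j,\phi\psi_i}\mathsf w_{i,\phi}-q_{i,j,\phi}\mathsf w_{i,\phi\psi_j}\mathsf w_{j,\phi}&=\sum_kc_{i,j,k}\,q'_{i,j,k,\phi}\mathsf w_{k,\phi},\\ \mathsf w_{i,\phi\psi_i^{p-1}}\cdots\mathsf w_{i,\phi\psi_i}\mathsf w_{i,\phi}&=\sum_kd_{i,k}\,q''_{i,k,\phi}\mathsf w_{k,\phi}. \end{align*} By changing the choices of the $g_{i,\phi}$ by elements of $Z(H)$, we may ensure that $z_{i,j,\phi}\in Z$, and then the formula for the parameters $q_{i,j,\phi}$ simplifies to $$q_{i,j,\phi}=\psi_i(g_{j,\phi})\,\psi_j(g_{i,\phi}^{-1})\,\chi(z_{i,j,\phi}).$$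
   Context: Setup. $p$ is a prime, $k$ an algebraically closed field of characteristic $p$; in groups $[g,h]=ghg^{-1}h^{-1}$, in associative algebras $[a,b]=ab-ba$. $P$ is a finite $p$-group, $L$ an abelian $p'$-subgroup of $\mathrm{Aut}(P)$, and $\alpha\in H^2(L,k^\times)$, represented by a $2$-cocycle of the same order. Associated to $\alpha$ is a central extension $1\to Z\to H\to L\to1$ of finite $p'$-groups and a faithful character $\chi\colon Z\to k^\times$ with $Z=[H,H]$ and $\alpha(x,y)=\chi(\hat x\hat y\,\widehat{xy}^{\,-1})$ for some choice of inverse images $\hat x\in H$ of $x\in L$. $H$ acts on $P$ via $H\to L$; $e=\frac1{|Z|}\sum_{z\in Z}\chi(z^{-1})z$. Characters. $\mathrm{Irr}(Z(H)|\chi)$ is the set of homomorphisms $\phi\colon Z(H)\to k^\times$ extending $\chi$, and $e_\phi=\frac1{|Z(H)|}\sum_{h\in Z(H)}\phi(h^{-1})h$. Fix $\phi_0\in \mathrm{Irr}(Z(H)|\chi)$ and for each $\phi$ a $\xi_\phi\in\mathrm{Hom}(H/Z,k^\times)$ (inflated to $H$) restricting to $\phi\phi_0^{-1}$ on $Z(H)$, with $\xi_{\phi_0}=1$. For $\psi\in\mathrm{Hom}(H/Z,k^\times)$ write $\phi\psi$ for $\phi\cdot\psi|_{Z(H)}$. The map $\rho\colon H\to\mathrm{Hom}(H,k^\times)$, $\rho(g)(h)=\chi([h,g])$, has kernel $Z(H)$ and image $\mathrm{Hom}(H/Z(H),k^\times)$. For each $\psi,\phi$ choose $g_{\psi,\phi}\in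 H$ with $\rho(g_{\psi,\phi})=\xi_{\phi\psi}\xi_\phi^{-1}\psi^{-1}$ (unique up to multiplication by $Z(H)$). Jennings Lie algebra. $F_r(P)=\{g\in P\mid g-1\in J^r(kP)\}$ and $\mathrm{Jen}_*(P)=\bigoplus_{r\ge1}k\otimes_{\mathbb F_p}F_r(P)/F_{r+1}(P)$, a $p$-restricted Lie algebra with bracket induced by commutators and $p$-map by $p$-th powers in $P$; $H$ acts on it and on its restricted universal enveloping algebra $\mathcal U\mathrm{Jen}_*(P)$. Choose a basis $w_1,\dots,w_n$ ($p^n=|P|$) of $\mathrm{Jen}_*(P)$ of homogeneous $H$-eigenvectors with $\deg w_i\le\deg w_j$ for $i\le j$, ${}^gw_i=\psi_i(g)w_i$ with $\psi_i\in\mathrm{Hom}(H/Z,k^\times)$, and write $[w_i,w_j]=\sum_kc_{i,j,k}w_k$, $w_i^{[p]}=\sum_kd_{i,k}w_k$. Put $g_{i,\phi}=g_{\psi_i,\phi}$ and $\mathsf w_{i,\phi}=g_{i,\phi}w_ie_\phi\in(\mathcal U\mathrm{Jen}_*(P)\rtimes H)e$. The relations hold in $(\mathcal U\mathrm{Jen}_*(P)\rtimes H)e$, for all $i,j$ and all $\phi\in\mathrm{Irr}(Z(H)|\chi)$. There are elements $z_{i,j,\phi},z'_{i,j,k,\phi},z''_{i,k,\phi}\in Z(H)$ defined by $g_{j,\phi\psi_i}g_{i,\phi}=g_{i,\phi\psi_j}g_{j,\phi}z_{i,j,\phi}$; if $c_{i,j,k}\ne0$, $g_{j,\phi\psi_i}g_{i,\phi}=g_{k,\phi}z'_{i,j,k,\phi}$;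 if $d_{i,k}\neq0$, $g_{i,\phi\psi_i^{p-1}}\cdots g_{i,\phi\psi_i}g_{i,\phi}=g_{k,\phi}z''_{i,k,\phi}$. The constants $q'_{i,j,k,\phi}$ (resp. $q''_{i,k,\phi}$) are defined when $c_{i,j,k}\ne0$ (resp. $d_{i,k}\ne0$); terms with $c_{i,j,k}=0$ (resp. $d_{i,k}=0$) are omitted in the sums.
   Formalization: The right-hand side of the first relation carries a minus sign, since with [w_i,w_j]=Σ c_{i,j,k} w_k the left side involves [w_j,w_i]; as printed it fails for p odd, H=L=1, P extraspecial of order p^3. *)

theory Defs
  imports
    "HOL-Algebra.Bij"
    "HOL-Algebra.Generated_Groups"
    "HOL-Algebra.Ideal_Product"
    "HOL-Algebra.QuotRing"
    "HOL-Algebra.Module"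
    "HOL-Algebra.Multiplicative_Group"
    "HOL-Algebra.Algebraic_Closure_Type"
    "HOL-Library.Poly_Mapping"
begin

text \<open>
  The ground field is a type \<open>'k\<close>; vector spaces and associative algebras over it are records of
  type \<open>('k, 'v) module\<close>. For a mere vector space the fields \<open>mult\<close> and \<open>one\<close> carry no meaning.
\<close>

section \<open>Groups and characters\<close>

definition group_center :: "('g, 'm) monoid_scheme \<Rightarrow> 'g set" where
  "group_center G = {z \<in> carrier G. \<forall>g\<in>carrier G. z \<otimes>\<^bsub>G\<^esub> g = g \<otimes>\<^bsub>G\<^esub> z}"

abbreviation field_units :: "'k::field monoid" where
  "field_units \<equiv> mult_of ring_of_type_algebra"

text \<open>Characters are extensional, so that equal characters are equal functions.\<close>

definition characters :: "('g, 'm) monoid_scheme \<Rightarrow> ('g \<Rightarrow> 'k::field) set" where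
  "characters G = hom G field_units \<inter> extensional (carrier G)"

text \<open>\<open>Hom(G/Z, k\<^sup>\<times>)\<close>, inflated to \<open>G\<close>.\<close>

definition inflated_chars :: "('g, 'm) monoid_scheme \<Rightarrow> 'g set \<Rightarrow> ('g \<Rightarrow> 'k::field) set" where
  "inflated_chars G Z = {\<psi> \<in> characters G. \<forall>z\<in>Z. \<psi> z = 1}"

definition Irr_above :: "('g, 'm) monoid_scheme \<Rightarrow> 'g set \<Rightarrow> ('g \<Rightarrow> 'k::field) \<Rightarrow> ('g \<Rightarrow> 'k) set" where
  "Irr_above G Z \<chi> =
     {\<phi> \<in> characters (G\<lparr>carrier := group_center G\<rparr>). \<forall>z\<in>Z. \<phi> z = \<chi> z}"

definition twist :: "('g, 'm) monoid_scheme \<Rightarrow> ('g \<Rightarrow> 'k::field) \<Rightarrow> ('g \<Rightarrow> 'k) \<Rightarrow> 'g \<Rightarrow> 'k" where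
  "twist G \<phi> \<psi> = (\<lambda>z\<in>group_center G. \<phi> z * \<psi> z)"

text \<open>\<open>\<rho>(g)(h) = \<chi>([h,g])\<close>.\<close>

definition rho :: "('g, 'm) monoid_scheme \<Rightarrow> ('g \<Rightarrow> 'k) \<Rightarrow> 'g \<Rightarrow> 'g \<Rightarrow> 'k" where
  "rho G \<chi> g h = \<chi> (h \<otimes>\<^bsub>G\<^esub> g \<otimes>\<^bsub>G\<^esub> inv\<^bsub>G\<^esub> h \<otimes>\<^bsub>G\<^esub> inv\<^bsub>G\<^esub> g)"

text \<open>\<open>f (m - 1) \<otimes> \<dots> \<otimes> f 1 \<otimes> f 0\<close>\<close>

primrec desc_prod :: "('g, 'm) monoid_scheme \<Rightarrow> (nat \<Rightarrow> 'g) \<Rightarrow> nat \<Rightarrow> 'g" where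
  "desc_prod G f 0 = \<one>\<^bsub>G\<^esub>"
| "desc_prod G f (Suc m) = f m \<otimes>\<^bsub>G\<^esub> desc_prod G f m"

section \<open>Second cohomology with trivial coefficients\<close>

definition cocycles2 :: "('g, 'm) monoid_scheme \<Rightarrow> ('g \<times> 'g \<Rightarrow> 'k::field) monoid" where
  "cocycles2 G = \<lparr>
     carrier = {f \<in> carrier G \<times> carrier G \<rightarrow>\<^sub>E - {0}.
       \<forall>x\<in>carrier G. \<forall>y\<in>carrier G. \<forall>z\<in>carrier G.
         f (x, y) * f (x \<otimes>\<^bsub>G\<^esub> y, z) = f (y, z) * f (x, y \<otimes>\<^bsub>G\<^esub> z)},
     monoid.mult = (\<lambda>f f'. \<lambda>u\<in>carrier G \<times> carrier G. f u * f' u),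
     one = (\<lambda>u\<in>carrier G \<times> carrier G. 1)\<rparr>"

definition coboundaries2 :: "('g, 'm) monoid_scheme \<Rightarrow> ('g \<times> 'g \<Rightarrow> 'k::field) set" where
  "coboundaries2 G =
     (\<lambda>b. \<lambda>(x, y)\<in>carrier G \<times> carrier G. b x * b y * inverse (b (x \<otimes>\<^bsub>G\<^esub> y))) ` (carrier G \<rightarrow> - {0})"

definition cohomology2 :: "('g, 'm) monoid_scheme \<Rightarrow> ('g \<times> 'g \<Rightarrow> 'k::field) set monoid" where
  "cohomology2 G = cocycles2 G Mod coboundaries2 G"

section \<open>Free modules, monoid algebras and quotients\<close>

definition free_space :: "'s set \<Rightarrow> ('k::field, 's \<Rightarrow>\<^sub>0 'k) module" where
  "free_space S = \<lparr>
     carrier = {x. Poly_Mapping.keys x \<subseteq> S},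
     monoid.mult = undefined, one = undefined,
     zero = 0, add = (+),
     module.smult = (\<lambda>c. Poly_Mapping.map ((*) c))\<rparr>"

definition monoid_algebra :: "('g, 'm) monoid_scheme \<Rightarrow> ('k::field, 'g \<Rightarrow>\<^sub>0 'k) module" where
  "monoid_algebra G = (free_space (carrier G))\<lparr>
     monoid.mult := (\<lambda>x y. \<Sum>g\<in>Poly_Mapping.keys x. \<Sum>h\<in>Poly_Mapping.keys y.
       Poly_Mapping.single (g \<otimes>\<^bsub>G\<^esub> h) (Poly_Mapping.lookup x g * Poly_Mapping.lookup y h)),
     one := Poly_Mapping.single \<one>\<^bsub>G\<^esub> 1\<rparr>"

definition words :: "'s set \<Rightarrow> 's list monoid" where
  "words S = \<lparr>carrier = lists S, monoid.mult = (@), one = []\<rparr>"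

definition pushforward :: "('s \<Rightarrow> 't) \<Rightarrow> ('s \<Rightarrow>\<^sub>0 'k::field) \<Rightarrow> ('t \<Rightarrow>\<^sub>0 'k)" where
  "pushforward f x = (\<Sum>s\<in>Poly_Mapping.keys x. Poly_Mapping.single (f s) (Poly_Mapping.lookup x s))"

definition linear_span :: "('k::field, 'v) module \<Rightarrow> 'v set \<Rightarrow> 'v set" where
  "linear_span V S = \<Inter> {N. submodule N ring_of_type_algebra V \<and> S \<subseteq> N}"

text \<open>Quotient of an algebra by a two-sided ideal, or of a vector space by a subspace.\<close>

definition quotient_module :: "('k::field, 'v) module \<Rightarrow> 'v set \<Rightarrow> ('k, 'v set) module" where
  "quotient_module A I =
     ring.extend (A Quot I) (module.fields (\<lambda>c C. I <+>\<^bsub>A\<^esub> ((\<lambda>x. c \<odot>\<^bsub>A\<^esub> x) ` C)))"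

section \<open>Jacobson radical\<close>

definition left_ideal :: "'r set \<Rightarrow> ('r, 'm) ring_scheme \<Rightarrow> bool" where
  "left_ideal I R \<longleftrightarrow> additive_subgroup I R \<and> (\<forall>x\<in>carrier R. \<forall>a\<in>I. x \<otimes>\<^bsub>R\<^esub> a \<in> I)"

definition maximal_left_ideal :: "'r set \<Rightarrow> ('r, 'm) ring_scheme \<Rightarrow> bool" where
  "maximal_left_ideal M R \<longleftrightarrow> left_ideal M R \<and> M \<noteq> carrier R \<and>
     (\<forall>I. left_ideal I R \<longrightarrow> M \<subseteq> I \<longrightarrow> I = M \<or> I = carrier R)"

definition jacobson_radical :: "('r, 'm) ring_scheme \<Rightarrow> 'r set" where
  "jacobson_radical R = {x \<in> carrier R. \<forall>M. maximal_left_ideal M R \<longrightarrow> x \<in> M}"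

definition radical_power :: "('r, 'm) ring_scheme \<Rightarrow> nat \<Rightarrow> 'r set" where
  "radical_power R r = (ideal_prod R (jacobson_radical R) ^^ r) (carrier R)"

section \<open>Restricted Lie algebras\<close>

text \<open>
  \<open>i s\<^sub>i(x, y)\<close> is the coefficient of \<open>t\<^bsup>i-1\<^esup>\<close> in \<open>ad(t x + y)\<^bsup>p-1\<^esup>(x)\<close>. The boolean
  list records from which of the \<open>p - 1\<close> factors the summand \<open>t x\<close> is taken.
\<close>

definition jacobson_s ::
  "nat \<Rightarrow> ('k::field, 'v) module \<Rightarrow> ('v \<Rightarrow> 'v \<Rightarrow> 'v) \<Rightarrow> 'v \<Rightarrow> 'v \<Rightarrow> nat \<Rightarrow> 'v" where
  "jacobson_s p V br x y i =
     inverse (of_nat i) \<odot>\<^bsub>V\<^esub>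
       (\<Oplus>\<^bsub>V\<^esub>bs\<in>{bs. length bs = p - 1 \<and> count_list bs True = i - 1}.
          foldr (\<lambda>b v. br (if b then x else y) v) bs x)"

locale restricted_lie_algebra = module "ring_of_type_algebra :: 'k::field ring" V
  for p :: nat and V :: "('k::field, 'v) module" (structure) and br :: "'v \<Rightarrow> 'v \<Rightarrow> 'v" and pm :: "'v \<Rightarrow> 'v" +
  assumes br_closed: "\<lbrakk>x \<in> carrier V; y \<in> carrier V\<rbrakk> \<Longrightarrow> br x y \<in> carrier V"
    and br_add_left: "\<lbrakk>x \<in> carrier V; y \<in> carrier V; z \<in> carrier V\<rbrakk> \<Longrightarrow>
          br (x \<oplus>\<^bsub>V\<^esub> y) z = br x z \<oplus>\<^bsub>V\<^esub> br y z"
    and br_add_right: "\<lbrakk>x \<in> carrier V; y \<in> carrier V; z \<in> carrier V\<rbrakk> \<Longrightarrow>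
          br x (y \<oplus>\<^bsub>V\<^esub> z) = br x y \<oplus>\<^bsub>V\<^esub> br x z"
    and br_smult_left: "\<lbrakk>x \<in> carrier V; y \<in> carrier V\<rbrakk> \<Longrightarrow> br (c \<odot>\<^bsub>V\<^esub> x) y = c \<odot>\<^bsub>V\<^esub> br x y"
    and br_smult_right: "\<lbrakk>x \<in> carrier V; y \<in> carrier V\<rbrakk> \<Longrightarrow> br x (c \<odot>\<^bsub>V\<^esub> y) = c \<odot>\<^bsub>V\<^esub> br x y"
    and br_alternating: "x \<in> carrier V \<Longrightarrow> br x x = \<zero>\<^bsub>V\<^esub>"
    and jacobi: "\<lbrakk>x \<in> carrier V; y \<in> carrier V; z \<in> carrier V\<rbrakk> \<Longrightarrow>
          br x (br y z) \<oplus>\<^bsub>V\<^esub> br y (br z x) \<oplus>\<^bsub>V\<^esub> br z (br x y) = \<zero>\<^bsub>V\<^esub>"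
    and pm_closed: "x \<in> carrier V \<Longrightarrow> pm x \<in> carrier V"
    and pm_smult: "x \<in> carrier V \<Longrightarrow> pm (c \<odot>\<^bsub>V\<^esub> x) = c ^ p \<odot>\<^bsub>V\<^esub> pm x"
    and ad_pm: "\<lbrakk>x \<in> carrier V; y \<in> carrier V\<rbrakk> \<Longrightarrow> br (pm x) y = (br x ^^ p) y"
    and pm_add: "\<lbrakk>x \<in> carrier V; y \<in> carrier V\<rbrakk> \<Longrightarrow>
          pm (x \<oplus>\<^bsub>V\<^esub> y) = pm x \<oplus>\<^bsub>V\<^esub> pm y \<oplus>\<^bsub>V\<^esub> (\<Oplus>\<^bsub>V\<^esub>i\<in>{1..p - 1}. jacobson_s p V br x y i)"

text \<open>
  The restricted universal enveloping algebra is the free associative algebra on the elements of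
  \<open>V\<close> modulo linearity of \<open>v \<mapsto> [v]\<close>, \<open>[x][y] - [y][x] = [br x y]\<close> and \<open>[x]\<^sup>p = [pm x]\<close>.
\<close>

definition free_algebra :: "'v set \<Rightarrow> ('k::field, 'v list \<Rightarrow>\<^sub>0 'k) module" where
  "free_algebra S = monoid_algebra (words S)"

definition letter :: "'v \<Rightarrow> ('v list \<Rightarrow>\<^sub>0 'k::field)" where
  "letter v = Poly_Mapping.single [v] 1"

definition enveloping_relations ::
  "nat \<Rightarrow> ('k::field, 'v) module \<Rightarrow> ('v \<Rightarrow> 'v \<Rightarrow> 'v) \<Rightarrow> ('v \<Rightarrow> 'v) \<Rightarrow> ('v list \<Rightarrow>\<^sub>0 'k) set" where
  "enveloping_relations p V br pm = (let T = free_algebra (carrier V) in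
     {letter (x \<oplus>\<^bsub>V\<^esub> y) - (letter x + letter y) | x y. x \<in> carrier V \<and> y \<in> carrier V} \<union>
     {letter (c \<odot>\<^bsub>V\<^esub> x) - c \<odot>\<^bsub>T\<^esub> letter x | c x. x \<in> carrier V} \<union>
     {letter x \<otimes>\<^bsub>T\<^esub> letter y - letter y \<otimes>\<^bsub>T\<^esub> letter x - letter (br x y) | x y.
        x \<in> carrier V \<and> y \<in> carrier V} \<union>
     {letter x [^]\<^bsub>T\<^esub> p - letter (pm x) | x. x \<in> carrier V})"

definition enveloping_ideal ::
  "nat \<Rightarrow> ('k::field, 'v) module \<Rightarrow> ('v \<Rightarrow> 'v \<Rightarrow> 'v) \<Rightarrow> ('v \<Rightarrow> 'v) \<Rightarrow> ('v list \<Rightarrow>\<^sub>0 'k) set" where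
  "enveloping_ideal p V br pm =
     Idl\<^bsub>free_algebra (carrier V)\<^esub> (enveloping_relations p V br pm)"

definition restricted_enveloping ::
  "nat \<Rightarrow> ('k::field, 'v) module \<Rightarrow> ('v \<Rightarrow> 'v \<Rightarrow> 'v) \<Rightarrow> ('v \<Rightarrow> 'v) \<Rightarrow> ('k, ('v list \<Rightarrow>\<^sub>0 'k) set) module" where
  "restricted_enveloping p V br pm =
     quotient_module (free_algebra (carrier V)) (enveloping_ideal p V br pm)"

definition enveloping_incl ::
  "nat \<Rightarrow> ('k::field, 'v) module \<Rightarrow> ('v \<Rightarrow> 'v \<Rightarrow> 'v) \<Rightarrow> ('v \<Rightarrow> 'v) \<Rightarrow> 'v \<Rightarrow> ('v list \<Rightarrow>\<^sub>0 'k) set" where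
  "enveloping_incl p V br pm v =
     enveloping_ideal p V br pm +>\<^bsub>(free_algebra (carrier V) :: ('k, _) module)\<^esub> letter v"

text \<open>
  The endomorphism of the enveloping algebra induced by an automorphism \<open>a\<close> of the restricted
  Lie algebra; elements are cosets, on which it acts elementwise.
\<close>

definition enveloping_map :: "('v \<Rightarrow> 'v) \<Rightarrow> ('v list \<Rightarrow>\<^sub>0 'k::field) set \<Rightarrow> ('v list \<Rightarrow>\<^sub>0 'k) set" where
  "enveloping_map a C = pushforward (map a) ` C"

section \<open>The Jennings Lie algebra\<close>

definition jennings_filtration :: "'k::field itself \<Rightarrow> 'a monoid \<Rightarrow> nat \<Rightarrow> 'a set" where
  "jennings_filtration _ P r = {g \<in> carrier P.
     Poly_Mapping.single g (1::'k) - Poly_Mapping.single \<one>\<^bsub>P\<^esub> 1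
       \<in> radical_power (monoid_algebra P) r}"

definition jennings_quotient :: "'k::field itself \<Rightarrow> 'a monoid \<Rightarrow> nat \<Rightarrow> 'a set monoid" where
  "jennings_quotient k P r =
     P\<lparr>carrier := jennings_filtration k P r\<rparr> Mod jennings_filtration k P (Suc r)"

text \<open>
  The direct sum over \<open>r \<ge> 1\<close> of the spaces \<open>k \<otimes> F\<^sub>r/F\<^sub>r\<^sub>+\<^sub>1\<close> is presented by generators
  \<open>(r, A)\<close>, standing for \<open>1 \<otimes> A\<close> in degree \<open>r\<close>, subject to additivity in \<open>A\<close>; for maps
  between groups of exponent \<open>p\<close>, additivity is the same as linearity over the prime field.
\<close>

definition jennings_gens :: "'k::field itself \<Rightarrow> 'a monoid \<Rightarrow> (nat \<times> 'a set) set" where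
  "jennings_gens k P = {(r, A). 1 \<le> r \<and> A \<in> carrier (jennings_quotient k P r)}"

definition jennings_relations :: "'a monoid \<Rightarrow> (nat \<times> 'a set \<Rightarrow>\<^sub>0 'k::field) set" where
  "jennings_relations P =
     {Poly_Mapping.single (r, A \<otimes>\<^bsub>jennings_quotient TYPE('k) P r\<^esub> B) 1
        - (Poly_Mapping.single (r, A) 1 + Poly_Mapping.single (r, B) 1) | r A B.
      (r, A) \<in> jennings_gens TYPE('k) P \<and> (r, B) \<in> jennings_gens TYPE('k) P}"

definition jennings_kernel :: "'a monoid \<Rightarrow> (nat \<times> 'a set \<Rightarrow>\<^sub>0 'k::field) set" where
  "jennings_kernel P = linear_span (free_space (jennings_gens TYPE('k) P)) (jennings_relations P)"

definition Jen :: "'a monoid \<Rightarrow> ('k::field, (nat \<times> 'a set \<Rightarrow>\<^sub>0 'k) set) module" where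
  "Jen P = quotient_module (free_space (jennings_gens TYPE('k) P)) (jennings_kernel P)"

definition jennings_homogeneous :: "'a monoid \<Rightarrow> nat \<Rightarrow> (nat \<times> 'a set \<Rightarrow>\<^sub>0 'k::field) set set" where
  "jennings_homogeneous P r =
     {jennings_kernel P +>\<^bsub>(free_space (jennings_gens TYPE('k) P) :: ('k, _) module)\<^esub> x | x.
        Poly_Mapping.keys x \<subseteq> {s \<in> jennings_gens TYPE('k) P. fst s = r}}"

text \<open>The element \<open>1 \<otimes> g F\<^sub>r\<^sub>+\<^sub>1(P)\<close> for \<open>g \<in> F\<^sub>r(P)\<close>.\<close>

definition jennings_elt :: "'a monoid \<Rightarrow> nat \<Rightarrow> 'a \<Rightarrow> (nat \<times> 'a set \<Rightarrow>\<^sub>0 'k::field) set" where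
  "jennings_elt P r g =
     jennings_kernel P +>\<^bsub>(free_space (jennings_gens TYPE('k) P) :: ('k, _) module)\<^esub>
       Poly_Mapping.single (r, jennings_filtration TYPE('k) P (Suc r) #>\<^bsub>P\<^esub> g) 1"

text \<open>
  The restricted Lie algebra structure of \<open>Jen P\<close>: its bracket is the bilinear extension of the
  group commutator, and its \<open>p\<close>-map is the one induced by \<open>p\<close>-th powers. These conditions
  determine \<open>br\<close> and \<open>pm\<close> on \<open>carrier (Jen P)\<close>, as the elements \<open>1 \<otimes> g F\<^sub>r\<^sub>+\<^sub>1(P)\<close> span.
\<close>

definition jennings_structure ::
  "nat \<Rightarrow> 'a monoid \<Rightarrow>
   ((nat \<times> 'a set \<Rightarrow>\<^sub>0 'k::field) set \<Rightarrow> (nat \<times> 'a set \<Rightarrow>\<^sub>0 'k) set \<Rightarrow> (nat \<times> 'a set \<Rightarrow>\<^sub>0 'k) set) \<Rightarrow>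
   ((nat \<times> 'a set \<Rightarrow>\<^sub>0 'k) set \<Rightarrow> (nat \<times> 'a set \<Rightarrow>\<^sub>0 'k) set) \<Rightarrow> bool" where
  "jennings_structure p P br pm \<longleftrightarrow>
     restricted_lie_algebra p (Jen P) br pm \<and>
     (\<forall>r\<ge>1. \<forall>s\<ge>1. \<forall>g\<in>jennings_filtration TYPE('k) P r. \<forall>h\<in>jennings_filtration TYPE('k) P s.
        br (jennings_elt P r g) (jennings_elt P s h) =
          jennings_elt P (r + s) (g \<otimes>\<^bsub>P\<^esub> h \<otimes>\<^bsub>P\<^esub> inv\<^bsub>P\<^esub> g \<otimes>\<^bsub>P\<^esub> inv\<^bsub>P\<^esub> h)) \<and>
     (\<forall>r\<ge>1. \<forall>g\<in>jennings_filtration TYPE('k) P r.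
        pm (jennings_elt P r g) = jennings_elt P (p * r) (g [^]\<^bsub>P\<^esub> p))"

text \<open>The action on \<open>Jen P\<close> of an automorphism \<open>f\<close> of \<open>P\<close>, elementwise on cosets.\<close>

definition jennings_map ::
  "('a \<Rightarrow> 'a) \<Rightarrow> (nat \<times> 'a set \<Rightarrow>\<^sub>0 'k::field) set \<Rightarrow> (nat \<times> 'a set \<Rightarrow>\<^sub>0 'k) set" where
  "jennings_map f C = pushforward (\<lambda>(r, A). (r, f ` A)) ` C"

section \<open>Skew group algebras\<close>

text \<open>
  The function \<open>x\<close> stands for the sum of the \<open>x h \<cdot> h\<close>, and \<open>(u h)(v h') = (u \<cdot> act h v) (h h')\<close>.
\<close>

definition skew_group_algebra ::
  "('k, 'u) module \<Rightarrow> 'h monoid \<Rightarrow> ('h \<Rightarrow> 'u \<Rightarrow> 'u) \<Rightarrow> ('k, 'h \<Rightarrow> 'u) module" where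
  "skew_group_algebra U H act = \<lparr>
     carrier = carrier H \<rightarrow>\<^sub>E carrier U,
     monoid.mult = (\<lambda>x y. \<lambda>g\<in>carrier H.
       \<Oplus>\<^bsub>U\<^esub>h\<in>carrier H. x h \<otimes>\<^bsub>U\<^esub> act h (y (inv\<^bsub>H\<^esub> h \<otimes>\<^bsub>H\<^esub> g))),
     one = (\<lambda>g\<in>carrier H. if g = \<one>\<^bsub>H\<^esub> then \<one>\<^bsub>U\<^esub> else \<zero>\<^bsub>U\<^esub>),
     zero = (\<lambda>g\<in>carrier H. \<zero>\<^bsub>U\<^esub>),
     add = (\<lambda>x y. \<lambda>g\<in>carrier H. x g \<oplus>\<^bsub>U\<^esub> y g),
     module.smult = (\<lambda>c x. \<lambda>g\<in>carrier H. c \<odot>\<^bsub>U\<^esub> x g)\<rparr>"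

definition skew_monomial :: "('k, 'u) module \<Rightarrow> 'h monoid \<Rightarrow> 'u \<Rightarrow> 'h \<Rightarrow> 'h \<Rightarrow> 'u" where
  "skew_monomial U H u h = (\<lambda>g\<in>carrier H. if g = h then u else \<zero>\<^bsub>U\<^esub>)"

definition corner_right :: "('k, 'r) module \<Rightarrow> 'r \<Rightarrow> ('k, 'r) module" where
  "corner_right A e = A\<lparr>carrier := (\<lambda>x. x \<otimes>\<^bsub>A\<^esub> e) ` carrier A, one := e\<rparr>"

section \<open>The twisted algebra\<close>

text \<open>
  \<open>(U Jen(P) \<rtimes> H) e\<close>. Throughout, \<open>\<pi>\<close> is the projection of \<open>H\<close>
  onto the group \<open>L\<close> of automorphisms of \<open>P\<close>.
\<close>

type_synonym ('a, 'k) jen = "(nat \<times> 'a set \<Rightarrow>\<^sub>0 'k) set"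

type_synonym ('a, 'k) ujen = "(('a, 'k) jen list \<Rightarrow>\<^sub>0 'k) set"

definition UJen ::
  "nat \<Rightarrow> 'a monoid \<Rightarrow> (('a, 'k::field) jen \<Rightarrow> ('a, 'k) jen \<Rightarrow> ('a, 'k) jen) \<Rightarrow>
   (('a, 'k) jen \<Rightarrow> ('a, 'k) jen) \<Rightarrow> ('k, ('a, 'k) ujen) module" where
  "UJen p P br pm = restricted_enveloping p (Jen P) br pm"

definition UJen_skew ::
  "nat \<Rightarrow> 'a monoid \<Rightarrow> (('a, 'k::field) jen \<Rightarrow> ('a, 'k) jen \<Rightarrow> ('a, 'k) jen) \<Rightarrow>
   (('a, 'k) jen \<Rightarrow> ('a, 'k) jen) \<Rightarrow> 'h monoid \<Rightarrow> ('h \<Rightarrow> 'a \<Rightarrow> 'a) \<Rightarrow>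
   ('k, 'h \<Rightarrow> ('a, 'k) ujen) module" where
  "UJen_skew p P br pm H \<pi> =
     skew_group_algebra (UJen p P br pm) H (\<lambda>h. enveloping_map (jennings_map (\<pi> h)))"

text \<open>\<open>1/|S|\<close> times the sum over \<open>h \<in> S\<close> of \<open>\<phi>(h\<^sup>-\<^sup>1) h\<close>; this is \<open>e\<close> for
  \<open>(Z, \<chi>)\<close>, and \<open>e\<^sub>\<phi>\<close> for \<open>(Z(H), \<phi>)\<close>.\<close>

definition char_idempotent ::
  "nat \<Rightarrow> 'a monoid \<Rightarrow> (('a, 'k::field) jen \<Rightarrow> ('a, 'k) jen \<Rightarrow> ('a, 'k) jen) \<Rightarrow>
   (('a, 'k) jen \<Rightarrow> ('a, 'k) jen) \<Rightarrow> 'h monoid \<Rightarrow> ('h \<Rightarrow> 'a \<Rightarrow> 'a) \<Rightarrow>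
   'h set \<Rightarrow> ('h \<Rightarrow> 'k) \<Rightarrow> 'h \<Rightarrow> ('a, 'k) ujen" where
  "char_idempotent p P br pm H \<pi> S \<phi> = (let U = UJen p P br pm; A = UJen_skew p P br pm H \<pi> in
     inverse (of_nat (card S)) \<odot>\<^bsub>A\<^esub>
       (\<Oplus>\<^bsub>A\<^esub>h\<in>S. \<phi> (inv\<^bsub>H\<^esub> h) \<odot>\<^bsub>A\<^esub> skew_monomial U H \<one>\<^bsub>U\<^esub> h))"

definition twisted_algebra ::
  "nat \<Rightarrow> 'a monoid \<Rightarrow> (('a, 'k::field) jen \<Rightarrow> ('a, 'k) jen \<Rightarrow> ('a, 'k) jen) \<Rightarrow>
   (('a, 'k) jen \<Rightarrow> ('a, 'k) jen) \<Rightarrow> 'h monoid \<Rightarrow> ('h \<Rightarrow> 'a \<Rightarrow> 'a) \<Rightarrow>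
   'h set \<Rightarrow> ('h \<Rightarrow> 'k) \<Rightarrow> ('k, 'h \<Rightarrow> ('a, 'k) ujen) module" where
  "twisted_algebra p P br pm H \<pi> Z \<chi> =
     corner_right (UJen_skew p P br pm H \<pi>) (char_idempotent p P br pm H \<pi> Z \<chi>)"

text \<open>The element \<open>g w e\<^sub>\<phi>\<close>, for \<open>g \<in> H\<close> and \<open>w \<in> Jen P\<close>.\<close>

definition w_elt ::
  "nat \<Rightarrow> 'a monoid \<Rightarrow> (('a, 'k::field) jen \<Rightarrow> ('a, 'k) jen \<Rightarrow> ('a, 'k) jen) \<Rightarrow>
   (('a, 'k) jen \<Rightarrow> ('a, 'k) jen) \<Rightarrow> 'h monoid \<Rightarrow> ('h \<Rightarrow> 'a \<Rightarrow> 'a) \<Rightarrow>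
   'h \<Rightarrow> ('a, 'k) jen \<Rightarrow> ('h \<Rightarrow> 'k) \<Rightarrow> 'h \<Rightarrow> ('a, 'k) ujen" where
  "w_elt p P br pm H \<pi> g w \<phi> = (let U = UJen p P br pm; A = UJen_skew p P br pm H \<pi> in
     skew_monomial U H \<one>\<^bsub>U\<^esub> g
       \<otimes>\<^bsub>A\<^esub> skew_monomial U H (enveloping_incl p (Jen P) br pm w) \<one>\<^bsub>H\<^esub>
       \<otimes>\<^bsub>A\<^esub> char_idempotent p P br pm H \<pi> (group_center H) \<phi>)"

section \<open>The group elements and the parameters of the relations\<close>

text \<open>The family \<open>g\<close> takes the arguments \<open>\<psi>\<close> and \<open>\<phi>\<close>, in this order; \<open>\<psi>\<close> in
  the definitions below is the family of the eigenvalue characters of the basis.\<close>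

definition g_choice ::
  "'h monoid \<Rightarrow> 'h set \<Rightarrow> ('h \<Rightarrow> 'k::field) \<Rightarrow> (('h \<Rightarrow> 'k) \<Rightarrow> 'h \<Rightarrow> 'k) \<Rightarrow>
   (('h \<Rightarrow> 'k) \<Rightarrow> ('h \<Rightarrow> 'k) \<Rightarrow> 'h) \<Rightarrow> bool" where
  "g_choice H Z \<chi> \<xi> g \<longleftrightarrow>
     (\<forall>\<psi>\<in>inflated_chars H Z. \<forall>\<phi>\<in>Irr_above H Z \<chi>. g \<psi> \<phi> \<in> carrier H \<and>
        (\<forall>h\<in>carrier H.
           rho H \<chi> (g \<psi> \<phi>) h = \<xi> (twist H \<phi> \<psi>) h * inverse (\<xi> \<phi> h) * inverse (\<psi> h)))"

text \<open>\<open>\<phi>\<psi>\<^sup>m\<close>\<close>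

definition twist_pow :: "'h monoid \<Rightarrow> ('h \<Rightarrow> 'k::field) \<Rightarrow> ('h \<Rightarrow> 'k) \<Rightarrow> nat \<Rightarrow> 'h \<Rightarrow> 'k" where
  "twist_pow H \<phi> \<psi> m = twist H \<phi> (\<lambda>h. \<psi> h ^ m)"

definition z_elt ::
  "'h monoid \<Rightarrow> (nat \<Rightarrow> 'h \<Rightarrow> 'k::field) \<Rightarrow> (('h \<Rightarrow> 'k) \<Rightarrow> ('h \<Rightarrow> 'k) \<Rightarrow> 'h) \<Rightarrow>
   nat \<Rightarrow> nat \<Rightarrow> ('h \<Rightarrow> 'k) \<Rightarrow> 'h" where
  "z_elt H \<psi> g i j \<phi> =
     inv\<^bsub>H\<^esub> (g (\<psi> i) (twist H \<phi> (\<psi> j)) \<otimes>\<^bsub>H\<^esub> g (\<psi> j) \<phi>)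
       \<otimes>\<^bsub>H\<^esub> (g (\<psi> j) (twist H \<phi> (\<psi> i)) \<otimes>\<^bsub>H\<^esub> g (\<psi> i) \<phi>)"

definition z'_elt ::
  "'h monoid \<Rightarrow> (nat \<Rightarrow> 'h \<Rightarrow> 'k::field) \<Rightarrow> (('h \<Rightarrow> 'k) \<Rightarrow> ('h \<Rightarrow> 'k) \<Rightarrow> 'h) \<Rightarrow>
   nat \<Rightarrow> nat \<Rightarrow> nat \<Rightarrow> ('h \<Rightarrow> 'k) \<Rightarrow> 'h" where
  "z'_elt H \<psi> g i j k \<phi> =
     inv\<^bsub>H\<^esub> (g (\<psi> k) \<phi>) \<otimes>\<^bsub>H\<^esub> (g (\<psi> j) (twist H \<phi> (\<psi> i)) \<otimes>\<^bsub>H\<^esub> g (\<psi> i) \<phi>)"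

definition z''_elt ::
  "nat \<Rightarrow> 'h monoid \<Rightarrow> (nat \<Rightarrow> 'h \<Rightarrow> 'k::field) \<Rightarrow> (('h \<Rightarrow> 'k) \<Rightarrow> ('h \<Rightarrow> 'k) \<Rightarrow> 'h) \<Rightarrow>
   nat \<Rightarrow> nat \<Rightarrow> ('h \<Rightarrow> 'k) \<Rightarrow> 'h" where
  "z''_elt p H \<psi> g i k \<phi> =
     inv\<^bsub>H\<^esub> (g (\<psi> k) \<phi>) \<otimes>\<^bsub>H\<^esub> desc_prod H (\<lambda>m. g (\<psi> i) (twist_pow H \<phi> (\<psi> i) m)) p"

definition q_par ::
  "'h monoid \<Rightarrow> (nat \<Rightarrow> 'h \<Rightarrow> 'k::field) \<Rightarrow> (('h \<Rightarrow> 'k) \<Rightarrow> ('h \<Rightarrow> 'k) \<Rightarrow> 'h) \<Rightarrow>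
   nat \<Rightarrow> nat \<Rightarrow> ('h \<Rightarrow> 'k) \<Rightarrow> 'k" where
  "q_par H \<psi> g i j \<phi> = (let z = z_elt H \<psi> g i j \<phi> in
     \<psi> i (g (\<psi> j) \<phi> \<otimes>\<^bsub>H\<^esub> z) * \<psi> j (inv\<^bsub>H\<^esub> (g (\<psi> i) \<phi>) \<otimes>\<^bsub>H\<^esub> z) * \<phi> z)"

text \<open>
  Moving the group elements to the left,
  \<open>w\<^bsub>j,\<phi>\<psi>\<^sub>i\<^esub> w\<^bsub>i,\<phi>\<^esub> - q\<^bsub>i,j,\<phi>\<^esub> w\<^bsub>i,\<phi>\<psi>\<^sub>j\<^esub> w\<^bsub>j,\<phi>\<^esub>\<close> is a scalar multiple of a group
  element times \<open>(w\<^sub>j w\<^sub>i - w\<^sub>i w\<^sub>j) e\<^sub>\<phi> = - [w\<^sub>i, w\<^sub>j] e\<^sub>\<phi>\<close>. With structure constants taken from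
  \<open>[w\<^sub>i, w\<^sub>j] = \<Sum> c\<^bsub>i,j,k\<^esub> w\<^sub>k\<close>, it therefore equals minus the sum of the terms
  \<open>c\<^bsub>i,j,k\<^esub> q'\<^bsub>i,j,k,\<phi>\<^esub> w\<^bsub>k,\<phi>\<^esub>\<close>.
\<close>

definition q'_par ::
  "'h monoid \<Rightarrow> (nat \<Rightarrow> 'h \<Rightarrow> 'k::field) \<Rightarrow> (('h \<Rightarrow> 'k) \<Rightarrow> ('h \<Rightarrow> 'k) \<Rightarrow> 'h) \<Rightarrow>
   nat \<Rightarrow> nat \<Rightarrow> nat \<Rightarrow> ('h \<Rightarrow> 'k) \<Rightarrow> 'k" where
  "q'_par H \<psi> g i j k \<phi> = (let z = z'_elt H \<psi> g i j k \<phi> in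
     inverse (\<psi> j (g (\<psi> i) \<phi>)) * \<psi> k z * \<phi> z)"

definition q''_par ::
  "nat \<Rightarrow> 'h monoid \<Rightarrow> (nat \<Rightarrow> 'h \<Rightarrow> 'k::field) \<Rightarrow> (('h \<Rightarrow> 'k) \<Rightarrow> ('h \<Rightarrow> 'k) \<Rightarrow> 'h) \<Rightarrow>
   nat \<Rightarrow> nat \<Rightarrow> ('h \<Rightarrow> 'k) \<Rightarrow> 'k" where
  "q''_par p H \<psi> g i k \<phi> = (let z = z''_elt p H \<psi> g i k \<phi> in
     (\<Prod>m<p - 1. inverse (\<psi> i (g (\<psi> i) (twist_pow H \<phi> (\<psi> i) m))) ^ (p - 1 - m)) * \<psi> k z * \<phi> z)"

end

theory Submission
  imports Defs
begin

text \<open>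
  In the skew group algebra, \<open>w\<^sub>i g = \<psi>\<^sub>i(g)\<^sup>-\<^sup>1 g w\<^sub>i\<close> and \<open>w\<^sub>i e\<^bsub>\<phi>\<^esub> = e\<^bsub>\<phi>\<psi>\<^sub>i\<^esub> w\<^sub>i\<close>,
  so in a product of the elements \<open>g\<^bsub>i,\<phi>\<^esub> w\<^sub>i e\<^bsub>\<phi>\<^esub>\<close> all group elements can be moved to the left and all
  idempotents to the right. What remains in the middle is \<open>[w\<^sub>i, w\<^sub>j]\<close> or \<open>w\<^sub>i\<^sup>p\<close>. As \<open>H\<close> acts on
  the Jennings Lie algebra by automorphisms, a basis vector \<open>w\<^sub>k\<close> occurs there only if
  \<open>\<psi>\<^sub>k = \<psi>\<^sub>i\<psi>\<^sub>j\<close>, respectively \<open>\<psi>\<^sub>k = \<psi>\<^sub>i\<^sup>p\<close>; in these cases the product of group elements has the same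
  image under \<open>\<rho>\<close> as \<open>g\<^bsub>k,\<phi>\<^esub>\<close>, and the central factor by which they differ acts on \<open>w\<^sub>k e\<^bsub>\<phi>\<^esub>\<close> as a scalar.
\<close>

section \<open>Formal linear combinations and algebras over a field\<close>

text \<open>\<open>Jen P\<close> and its enveloping algebra are concrete quotients, and a group
  element acts on a coset by taking the images of its members. The result is again a coset only if
  the kernel is mapped onto itself. Hence every level carries an automorphism together with its
  inverse; at the bottom lies the invariance of the Jacobson radical of the group algebra.

  The constants are collected scalars. The two products in the commutation relation contribute
  \<open>\<psi>\<^sub>j(g\<^sub>i)\<close> and \<open>\<psi>\<^sub>i(g\<^sub>j)\<close>, both
  inverted, and absorbing \<open>z\<close> into \<open>w\<^sub>i w\<^sub>j e\<close> contributes
  \<open>\<psi>\<^sub>i(z) \<psi>\<^sub>j(z) \<phi>(z)\<close>; comparing them gives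
  \<open>q\<close>. In the p-fold product, the group element with index \<open>m\<close>, counted
  from the right starting at 0, is crossed by \<open>p - 1 - m\<close> copies of
  \<open>w\<^sub>i\<close>, whence the exponents in \<open>q''\<close>.

  Eigenvalues are compared in \<open>Jen P\<close> itself, where coordinates are unique. Only the
  resulting linear combinations are carried to the enveloping algebra.

  The choice with \<open>z\<close> in \<open>Z\<close> concerns \<open>H\<close> alone. The map
  \<rho> need not split, but subgroups of a free abelian group are free, so preimages modulo
  \<open>Z\<close> can be chosen additively there.\<close>

abbreviation "keys \<equiv> Poly_Mapping.keys"
abbreviation "single \<equiv> Poly_Mapping.single"
abbreviation "lookup \<equiv> Poly_Mapping.lookup"

abbreviation (input) scale :: "'k::field \<Rightarrow> ('s \<Rightarrow>\<^sub>0 'k) \<Rightarrow> ('s \<Rightarrow>\<^sub>0 'k)" where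
  "scale c \<equiv> Poly_Mapping.map ((*) c)"

lemma lookup_scale: "lookup (scale c x) s = c * lookup x s"
  by (transfer, auto simp: when_def)

lemma keys_scale: "keys (scale c x) \<subseteq> keys x"
  by (auto simp: in_keys_iff lookup_scale)

lemma scale_single [simp]: "scale c (single s a) = single s (c * a)"
  by (rule poly_mapping_eqI) (simp add: lookup_scale lookup_single when_def)

lemma scale_sum: "scale c (\<Sum>i\<in>I. f i) = (\<Sum>i\<in>I. scale c (f i))"
  by (rule poly_mapping_eqI) (simp add: lookup_scale lookup_sum sum_distrib_left)

text \<open>Terms outside the support vanish. Sums over the supports of several elements can thus be
  taken over one common finite set, where additivity is visible.\<close>

lemma poly_mapping_sum_superset:
  assumes "finite A" "keys x \<subseteq> A" "\<And>s. F s 0 = 0"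
  shows "(\<Sum>s\<in>keys x. F s (lookup x s)) = (\<Sum>s\<in>A. F s (lookup x s))"
  by (rule sum.mono_neutral_left) (use assms in \<open>auto simp: in_keys_iff\<close>)

lemma poly_mapping_expand: "x = (\<Sum>s\<in>keys x. single s (lookup x s))"
  by (rule poly_mapping_eqI)
     (auto simp: lookup_sum lookup_single when_def in_keys_iff sum.delta' cong: if_cong)

text \<open>Reduces linear and multilinear identities to single generators while keeping the support
  inside \<open>S\<close>, so that identities valid only on a carrier can be used.\<close>

lemma poly_mapping_single_induct [consumes 1, case_names zero add]:
  fixes x :: "'s \<Rightarrow>\<^sub>0 'k::comm_monoid_add"
  assumes "keys x \<subseteq> S" and "Q 0"
    and "\<And>y s a. keys y \<subseteq> S \<Longrightarrow> s \<in> S \<Longrightarrow> Q y \<Longrightarrow> Q (y + single s a)"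
  shows "Q x"
proof -
  have "Q (\<Sum>s\<in>B. single s (lookup x s))" if "finite B" "B \<subseteq> S" for B
    using that
  proof (induction B rule: finite_induct)
    case (insert b B)
    have "keys (\<Sum>s\<in>B. single s (lookup x s)) \<subseteq> S"
      using insert.prems by (intro order_trans[OF Poly_Mapping.keys_sum]) (auto split: if_splits)
    then have "Q ((\<Sum>s\<in>B. single s (lookup x s)) + single b (lookup x b))"
      using insert by (intro assms(3)) auto
    then show ?case
      using insert.hyps by (simp add: add.commute)
  qed (simp add: assms(2))
  from this[OF finite_keys assms(1)] show ?thesis
    using poly_mapping_expand[of x] by simp
qed

lemma pushforward_superset:
  assumes "finite A" "keys x \<subseteq> A"
  shows "pushforward f x = (\<Sum>s\<in>A. single (f s) (lookup x s))"
  unfolding pushforward_def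
  by (rule poly_mapping_sum_superset[of A x "\<lambda>s. single (f s)"]) (use assms in auto)

lemma pushforward_zero [simp]: "pushforward f 0 = 0"
  by (simp add: pushforward_def)

lemma pushforward_add: "pushforward f (x + y) = pushforward f x + pushforward f y"
  using keys_add[of x y]
  by (simp add: pushforward_superset[of "keys x \<union> keys y" _ f]
      lookup_add single_add sum.distrib)

lemma pushforward_uminus: "pushforward f (- x) = - pushforward f x"
  using pushforward_add[of f x "- x"] by (simp add: add_eq_0_iff)

lemma pushforward_diff: "pushforward f (x - y) = pushforward f x - pushforward f y"
  using pushforward_add[of f x "- y"] by (simp add: pushforward_uminus)

lemma pushforward_single [simp]: "pushforward f (single s a) = single (f s) a"
  using pushforward_superset[of "{s}" "single s a" f] by simp

lemma pushforward_scale: "pushforward f (scale c x) = scale c (pushforward f x)"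
  using pushforward_superset[OF _ keys_scale[of c x], of f]
  by (simp add: pushforward_def scale_sum lookup_scale)

lemma keys_pushforward: "keys (pushforward f x) \<subseteq> f ` keys x"
  unfolding pushforward_def
  by (intro order_trans[OF Poly_Mapping.keys_sum]) (auto split: if_splits)

text \<open>The hypothesis is confined to the support because inverse automorphisms cancel only on
  carriers.\<close>

lemma pushforward_comp:
  assumes "\<And>s. s \<in> keys x \<Longrightarrow> f (g s) = h s"
  shows "pushforward f (pushforward g x) = pushforward h x"
proof -
  have "keys x \<subseteq> {s. f (g s) = h s}" using assms by auto
  then show ?thesis
    by (induction x rule: poly_mapping_single_induct) (auto simp: pushforward_add)
qed

lemma pushforward_id:
  assumes "\<And>s. s \<in> keys x \<Longrightarrow> f s = s"
  shows "pushforward f x = x"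
  using poly_mapping_expand[of x] assms by (simp add: pushforward_def)

text \<open>Scalars range over the whole type \<open>'k\<close>, which removes the carrier
  conditions on scalars that \<open>module\<close> over \<open>ring_of_type_algebra\<close> brings
  along; \<open>module_k_space\<close> is the passage from there.\<close>

locale k_space = abelian_group V for V :: "('k::field, 'v) module" (structure) +
  assumes smult_closed [simp, intro]: "x \<in> carrier V \<Longrightarrow> c \<odot> x \<in> carrier V"
    and smult_l_distr: "x \<in> carrier V \<Longrightarrow> (a + b) \<odot> x = a \<odot> x \<oplus> b \<odot> x"
    and smult_r_distr: "x \<in> carrier V \<Longrightarrow> y \<in> carrier V \<Longrightarrow> a \<odot> (x \<oplus> y) = a \<odot> x \<oplus> a \<odot> y"
    and smult_assoc: "x \<in> carrier V \<Longrightarrow> (a * b) \<odot> x = a \<odot> (b \<odot> x)"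
    and smult_one [simp]: "x \<in> carrier V \<Longrightarrow> 1 \<odot> x = x"

locale k_algebra = ring A + k_space A for A :: "('k::field, 'v) module" (structure) +
  assumes smult_mult_left: "x \<in> carrier A \<Longrightarrow> y \<in> carrier A \<Longrightarrow> (c \<odot> x) \<otimes> y = c \<odot> (x \<otimes> y)"
    and smult_mult_right: "x \<in> carrier A \<Longrightarrow> y \<in> carrier A \<Longrightarrow> x \<otimes> (c \<odot> y) = c \<odot> (x \<otimes> y)"

context k_space
begin

lemma smult_zero_left [simp]: "x \<in> carrier V \<Longrightarrow> 0 \<odot> x = \<zero>"
  using smult_l_distr[of x 0 0] add.r_cancel_one'[of "0 \<odot> x" "0 \<odot> x"] by auto

lemma smult_zero_right [simp]: "a \<odot> \<zero> = \<zero>"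
  using smult_r_distr[of \<zero> \<zero> a] add.r_cancel_one'[of "a \<odot> \<zero>" "a \<odot> \<zero>"] by auto

lemma smult_minus_one: "x \<in> carrier V \<Longrightarrow> (- 1) \<odot> x = \<ominus> x"
  using smult_l_distr[of x "-1" 1] by (intro minus_equality[symmetric]) auto

lemma smult_finsum:
  assumes "finite I" "\<And>i. i \<in> I \<Longrightarrow> f i \<in> carrier V"
  shows "a \<odot> (\<Oplus>i\<in>I. f i) = (\<Oplus>i\<in>I. a \<odot> f i)"
  using assms
proof (induction I rule: finite_induct)
  case (insert i I)
  then have "f \<in> I \<rightarrow> carrier V" "(\<lambda>i. a \<odot> f i) \<in> I \<rightarrow> carrier V" by auto
  with insert show ?case by (simp add: smult_r_distr)
qed simp

end

lemma module_k_space: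
  fixes V :: "('k::field, 'v) module"
  assumes "module (ring_of_type_algebra :: 'k ring) V"
  shows "k_space V"
proof -
  interpret M: Module.module "ring_of_type_algebra :: 'k ring" V by fact
  show ?thesis
    using M.smult_closed M.smult_l_distr M.smult_r_distr M.smult_assoc1 M.smult_one
    by (intro k_space.intro k_space_axioms.intro M.abelian_group_axioms)
       (simp_all add: ring_of_type_algebra_def)
qed

section \<open>Free spaces and monoid algebras\<close>

lemma free_space_simps [simp]:
  "carrier (free_space S :: ('k::field, _) module) = {x. keys x \<subseteq> S}"
  "\<zero>\<^bsub>(free_space S :: ('k::field, _) module)\<^esub> = 0"
  "x \<oplus>\<^bsub>free_space S\<^esub> y = x + y"
  "c \<odot>\<^bsub>free_space S\<^esub> x = scale c x"
  by (simp_all add: free_space_def)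

lemma monoid_algebra_simps [simp]:
  "carrier (monoid_algebra G :: ('k::field, _) module) = {x. keys x \<subseteq> carrier G}"
  "\<zero>\<^bsub>(monoid_algebra G :: ('k::field, _) module)\<^esub> = 0"
  "x \<oplus>\<^bsub>monoid_algebra G\<^esub> y = x + y"
  "c \<odot>\<^bsub>monoid_algebra G\<^esub> x = scale c x"
  "\<one>\<^bsub>(monoid_algebra G :: ('k::field, _) module)\<^esub> = single \<one>\<^bsub>G\<^esub> 1"
  by (simp_all add: monoid_algebra_def free_space_def)

lemma keys_add_subset: "keys x \<subseteq> S \<Longrightarrow> keys y \<subseteq> S \<Longrightarrow> keys (x + y) \<subseteq> S"
  using keys_add[of x y] by blast

lemma abelian_group_keys_subset:
  assumes "carrier V = {x :: 's \<Rightarrow>\<^sub>0 'k::field. keys x \<subseteq> S}" "\<zero>\<^bsub>V\<^esub> = 0" "add V = (+)"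
  shows "abelian_group V"
proof (rule abelian_groupI)
  fix x assume "x \<in> carrier V"
  then show "\<exists>y\<in>carrier V. y \<oplus>\<^bsub>V\<^esub> x = \<zero>\<^bsub>V\<^esub>"
    by (intro bexI[of _ "- x"]) (auto simp: assms)
qed (simp_all add: assms keys_add_subset algebra_simps)

lemma k_space_free_space: "k_space (free_space S :: ('k::field, _) module)"
proof (intro k_space.intro k_space_axioms.intro)
  show "abelian_group (free_space S :: ('k, _) module)"
    by (rule abelian_group_keys_subset[of _ S]) (auto simp: free_space_def)
  fix x :: "_ \<Rightarrow>\<^sub>0 'k" and c assume "x \<in> carrier (free_space S)"
  then show "c \<odot>\<^bsub>free_space S\<^esub> x \<in> carrier (free_space S)"
    using keys_scale[of c x] by auto
qed (simp_all add: poly_mapping_eq_iff fun_eq_iff lookup_scale lookup_add algebra_simps)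

text \<open>Enlarging the two index sets only adds terms with coefficient 0. With index sets
  independent of the factors, bilinearity of the product becomes a computation with
  coefficients.\<close>

lemma monoid_algebra_mult_superset:
  assumes "finite B" "keys x \<subseteq> B" "finite C" "keys y \<subseteq> C"
  shows "x \<otimes>\<^bsub>monoid_algebra G\<^esub> y = (\<Sum>g\<in>B. \<Sum>h\<in>C.
    single (g \<otimes>\<^bsub>G\<^esub> h) (lookup x g * lookup y h))"
proof -
  have "x \<otimes>\<^bsub>monoid_algebra G\<^esub> y = (\<Sum>g\<in>keys x. \<Sum>h\<in>C.
    single (g \<otimes>\<^bsub>G\<^esub> h) (lookup x g * lookup y h))"
    unfolding monoid_algebra_def
    by (simp, rule sum.cong[OF refl], rule sum.mono_neutral_left)
       (use assms in \<open>auto simp: in_keys_iff\<close>)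
  also have "\<dots> = (\<Sum>g\<in>B. \<Sum>h\<in>C.
    single (g \<otimes>\<^bsub>G\<^esub> h) (lookup x g * lookup y h))"
    by (rule sum.mono_neutral_left) (use assms in \<open>auto simp: in_keys_iff\<close>)
  finally show ?thesis .
qed

lemma monoid_algebra_mult_add_left:
  "(x + y) \<otimes>\<^bsub>monoid_algebra G\<^esub> z = x \<otimes>\<^bsub>monoid_algebra G\<^esub> z + y \<otimes>\<^bsub>monoid_algebra G\<^esub> z"
  using keys_add[of x y]
  by (simp add: monoid_algebra_mult_superset[of "keys x \<union> keys y" _ "keys z"]
      lookup_add algebra_simps single_add sum.distrib)

lemma monoid_algebra_mult_add_right:
  "z \<otimes>\<^bsub>monoid_algebra G\<^esub> (x + y) = z \<otimes>\<^bsub>monoid_algebra G\<^esub> x + z \<otimes>\<^bsub>monoid_algebra G\<^esub> y"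
  using keys_add[of x y]
  by (simp add: monoid_algebra_mult_superset[of "keys z" _ "keys x \<union> keys y"]
      lookup_add algebra_simps single_add sum.distrib)

lemma monoid_algebra_mult_scale_left:
  "scale c x \<otimes>\<^bsub>monoid_algebra G\<^esub> z = scale c (x \<otimes>\<^bsub>monoid_algebra G\<^esub> z)"
  using keys_scale[of c x]
  by (simp add: monoid_algebra_mult_superset[of "keys x" _ "keys z"]
      lookup_scale scale_sum mult.assoc)

lemma monoid_algebra_mult_scale_right:
  "z \<otimes>\<^bsub>monoid_algebra G\<^esub> scale c x = scale c (z \<otimes>\<^bsub>monoid_algebra G\<^esub> x)"
  using keys_scale[of c x]
  by (simp add: monoid_algebra_mult_superset[of "keys z" _ "keys x"]
      lookup_scale scale_sum mult.left_commute)

lemma monoid_algebra_mult_single [simp]: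
  "single g a \<otimes>\<^bsub>monoid_algebra G\<^esub> single h b = single (g \<otimes>\<^bsub>G\<^esub> h) (a * b)"
  by (simp add: monoid_algebra_mult_superset[of "{g}" _ "{h}"])

lemma monoid_algebra_mult_zero [simp]:
  "0 \<otimes>\<^bsub>monoid_algebra G\<^esub> x = 0" "x \<otimes>\<^bsub>monoid_algebra G\<^esub> 0 = 0"
  by (simp_all add: monoid_algebra_def)

lemma monoid_algebra_mult_keys:
  assumes "monoid G" "keys x \<subseteq> carrier G" "keys y \<subseteq> carrier G"
  shows "keys (x \<otimes>\<^bsub>monoid_algebra G\<^esub> y) \<subseteq> carrier G"
proof -
  interpret monoid G by fact
  show ?thesis
    using assms(2)
  proof (induction x rule: poly_mapping_single_induct)
    case (add x g a)
    have "keys (single g a \<otimes>\<^bsub>monoid_algebra G\<^esub> y) \<subseteq> carrier G"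
      using assms(3)
      by (induction y rule: poly_mapping_single_induct)
         (use add.hyps in \<open>simp_all add: monoid_algebra_mult_add_right keys_add_subset\<close>)
    with add show ?case by (simp add: monoid_algebra_mult_add_left keys_add_subset)
  qed simp
qed

lemma k_algebra_monoid_algebra:
  assumes "monoid G"
  shows "k_algebra (monoid_algebra G :: ('k::field, _) module)"
proof -
  interpret monoid G by fact
  let ?A = "monoid_algebra G :: ('k, _) module"
  \<comment> \<open>Both sides are trilinear, so three nested inductions reduce associativity to
    that of \<open>G\<close> on single elements.\<close>
  have assoc: "x \<otimes>\<^bsub>?A\<^esub> y \<otimes>\<^bsub>?A\<^esub> z = x \<otimes>\<^bsub>?A\<^esub> (y \<otimes>\<^bsub>?A\<^esub> z)"
    if x: "keys x \<subseteq> carrier G" and y: "keys y \<subseteq> carrier G"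
      and z: "keys z \<subseteq> carrier G" for x y z
    using x
  proof (induction x rule: poly_mapping_single_induct)
    case (add x g a)
    have "single g a \<otimes>\<^bsub>?A\<^esub> y \<otimes>\<^bsub>?A\<^esub> z = single g a \<otimes>\<^bsub>?A\<^esub> (y \<otimes>\<^bsub>?A\<^esub> z)"
      using y
    proof (induction y rule: poly_mapping_single_induct)
      case (add y h b)
      have "single g a \<otimes>\<^bsub>?A\<^esub> single h b \<otimes>\<^bsub>?A\<^esub> z
          = single g a \<otimes>\<^bsub>?A\<^esub> (single h b \<otimes>\<^bsub>?A\<^esub> z)"
        using z
        by (induction z rule: poly_mapping_single_induct)
           (use \<open>g \<in> carrier G\<close> \<open>h \<in> carrier G\<close> in
             \<open>simp_all add: monoid_algebra_mult_add_right m_assoc mult.assoc\<close>)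
      with add show ?case by (simp add: monoid_algebra_mult_add_left monoid_algebra_mult_add_right)
    qed simp
    with add show ?case by (simp add: monoid_algebra_mult_add_left)
  qed simp
  have one: "single \<one>\<^bsub>G\<^esub> 1 \<otimes>\<^bsub>?A\<^esub> x = x" "x \<otimes>\<^bsub>?A\<^esub> single \<one>\<^bsub>G\<^esub> 1 = x"
    if "keys x \<subseteq> carrier G" for x
    using that
    by (induction x rule: poly_mapping_single_induct)
       (auto simp: monoid_algebra_mult_add_left monoid_algebra_mult_add_right)
  have "ring ?A"
  proof (rule ringI)
    show "abelian_group ?A"
      by (rule abelian_group_keys_subset[of _ "carrier G"]) (auto simp: monoid_algebra_def free_space_def)
    show "monoid ?A"
      by (rule monoidI) (simp_all add: assoc one monoid_algebra_mult_keys[OF assms])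
  qed (auto simp: monoid_algebra_mult_add_left monoid_algebra_mult_add_right)
  moreover have "k_space ?A"
  proof -
    interpret F: k_space "free_space (carrier G) :: ('k, _) module" by (rule k_space_free_space)
    show ?thesis
      using ring.is_abelian_group[OF calculation] F.smult_closed F.smult_l_distr F.smult_r_distr F.smult_assoc F.smult_one
      by (intro k_space.intro k_space_axioms.intro) auto
  qed
  ultimately show ?thesis
    by (intro k_algebra.intro k_algebra_axioms.intro)
       (auto simp: monoid_algebra_mult_scale_left monoid_algebra_mult_scale_right)
qed

lemma pushforward_mult:
  assumes x: "keys x \<subseteq> carrier G" and y: "keys y \<subseteq> carrier G"
    and f: "\<And>g h. g \<in> carrier G \<Longrightarrow> h \<in> carrier G \<Longrightarrow> f (g \<otimes>\<^bsub>G\<^esub> h) = f g \<otimes>\<^bsub>G'\<^esub> f h"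
  shows "pushforward f (x \<otimes>\<^bsub>monoid_algebra G\<^esub> y) = pushforward f x \<otimes>\<^bsub>monoid_algebra G'\<^esub> pushforward f y"
  using x
proof (induction x rule: poly_mapping_single_induct)
  case (add x g a)
  have "pushforward f (single g a \<otimes>\<^bsub>monoid_algebra G\<^esub> y)
      = pushforward f (single g a) \<otimes>\<^bsub>monoid_algebra G'\<^esub> pushforward f y"
    using y
    by (induction y rule: poly_mapping_single_induct)
       (use add.hyps f in \<open>simp_all add: pushforward_add monoid_algebra_mult_add_right\<close>)
  with add show ?case by (simp add: pushforward_add monoid_algebra_mult_add_left)
qed simp

lemma monoid_algebra_minus [simp]:
  assumes "monoid G" "keys x \<subseteq> carrier G" "keys y \<subseteq> carrier G"
  shows "x \<ominus>\<^bsub>monoid_algebra G\<^esub> y = x - (y :: _ \<Rightarrow>\<^sub>0 'k::field)"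
proof -
  interpret k_algebra "monoid_algebra G :: ('k, _) module"
    using assms(1) by (rule k_algebra_monoid_algebra)
  have "\<ominus>\<^bsub>monoid_algebra G\<^esub> y = - y"
    using assms by (intro minus_equality) auto
  then show ?thesis by (simp add: a_minus_def)
qed

section \<open>Quotients\<close>

text \<open>Serves both quotients: the one of a free space by \<open>jennings_kernel\<close> and,
  through the sublocale in \<open>k_ideal\<close>, the one of a free algebra by
  \<open>enveloping_ideal\<close>.\<close>

locale k_subspace = k_space V + additive_subgroup K V
  for K and V :: "('k::field, 'v) module" (structure) +
  assumes smult_mem: "x \<in> K \<Longrightarrow> c \<odot> x \<in> K"
begin

lemma abelian_subgroup: "abelian_subgroup K V"
  by (intro abelian_subgroupI3 additive_subgroup_axioms abelian_group_axioms)

abbreviation Q where "Q \<equiv> quotient_module V K"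
abbreviation cls where "cls x \<equiv> K +> x"

lemma carrier_quotient: "carrier Q = cls ` carrier V"
  by (auto simp: quotient_module_def ring.defs module.defs FactRing_def A_RCOSETS_defs a_r_coset_def r_coset_def)

lemma cls_closed [simp, intro]: "x \<in> carrier V \<Longrightarrow> cls x \<in> carrier Q"
  by (auto simp: carrier_quotient)

lemma quotientE:
  assumes "C \<in> carrier Q" obtains x where "x \<in> carrier V" "C = cls x"
  using assms by (auto simp: carrier_quotient)

lemma cls_zero: "cls \<zero> = K"
  using additive_subgroup.zero_closed[OF additive_subgroup_axioms] a_subset a_subgroup
  by (intro a_coset_join2) auto

lemma quotient_zero: "\<zero>\<^bsub>Q\<^esub> = cls \<zero>"
  using cls_zero by (simp add: quotient_module_def ring.defs module.defs FactRing_def)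

lemma quotient_add:
  "x \<in> carrier V \<Longrightarrow> y \<in> carrier V \<Longrightarrow> cls x \<oplus>\<^bsub>Q\<^esub> cls y = cls (x \<oplus> y)"
  using abelian_subgroup.a_rcos_sum[OF abelian_subgroup]
  by (simp add: quotient_module_def ring.defs module.defs FactRing_def)

text \<open>Scaling a coset elementwise yields a full coset only for a nonzero scalar; for the
  scalar 0 it collapses to zero. The summand \<open>K\<close> in the definition of the quotient
  repairs this case.\<close>

lemma quotient_smult:
  assumes "x \<in> carrier V" shows "c \<odot>\<^bsub>Q\<^esub> cls x = cls (c \<odot> x)"
proof -
  have "K <+>\<^bsub>V\<^esub> (\<lambda>y. c \<odot> y) ` cls x = cls (c \<odot> x)"
  proof (intro equalityI subsetI)
    fix y assume "y \<in> K <+>\<^bsub>V\<^esub> (\<lambda>y. c \<odot> y) ` cls x"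
    then obtain k k' where k: "k \<in> K" "k' \<in> K" "y = k \<oplus> c \<odot> (k' \<oplus> x)"
      by (auto simp: set_add_def set_mult_def a_r_coset_def r_coset_def)
    then have "y = (k \<oplus> c \<odot> k') \<oplus> c \<odot> x" "k \<oplus> c \<odot> k' \<in> K"
      using assms smult_mem a_subset by (auto simp: smult_r_distr a_assoc subset_eq)
    then show "y \<in> cls (c \<odot> x)"
      by (auto simp: a_r_coset_def r_coset_def)
  next
    fix y assume "y \<in> cls (c \<odot> x)"
    then obtain k where k: "k \<in> K" "y = k \<oplus> c \<odot> (\<zero> \<oplus> x)"
      using assms by (auto simp: a_r_coset_def r_coset_def)
    then show "y \<in> K <+>\<^bsub>V\<^esub> (\<lambda>y. c \<odot> y) ` cls x"
      using zero_closed by (fastforce simp: set_add_def set_mult_def a_r_coset_def r_coset_def)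
  qed
  then show ?thesis
    by (simp add: quotient_module_def ring.defs module.defs)
qed

lemma cls_eq_iff:
  assumes "x \<in> carrier V" "y \<in> carrier V" shows "cls x = cls y \<longleftrightarrow> x \<ominus> y \<in> K"
proof
  assume "cls x = cls y"
  then have "x \<in> cls y"
    using assms abelian_subgroup.a_rcos_self[OF abelian_subgroup, of x] by simp
  then obtain k where "k \<in> K" "x = k \<oplus> y" by (auto simp: a_r_coset_def r_coset_def)
  then show "x \<ominus> y \<in> K"
    using assms a_subset by (auto simp: a_minus_def a_assoc r_neg subset_eq)
next
  assume "x \<ominus> y \<in> K"
  moreover have "x = (x \<ominus> y) \<oplus> y" using assms by (simp add: a_minus_def a_assoc l_neg)
  ultimately have "x \<in> cls y" by (auto simp: a_r_coset_def r_coset_def)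
  then show "cls x = cls y"
    using assms a_repr_independence a_subgroup by metis
qed

lemma k_space_quotient: "k_space Q"
proof (intro k_space.intro k_space_axioms.intro)
  show "abelian_group Q"
  proof (rule abelian_groupI)
    fix x assume "x \<in> carrier Q"
    then obtain a where a: "a \<in> carrier V" "x = cls a" by (rule quotientE)
    then show "\<exists>y\<in>carrier Q. y \<oplus>\<^bsub>Q\<^esub> x = \<zero>\<^bsub>Q\<^esub>"
      by (intro bexI[of _ "cls (\<ominus> a)"]) (auto simp: quotient_add quotient_zero l_neg)
  qed (auto elim!: quotientE simp: quotient_add quotient_zero a_ac)
qed (auto elim!: quotientE simp: quotient_add quotient_zero quotient_smult smult_l_distr smult_r_distr smult_assoc)

end

locale k_ideal = k_algebra A + ideal I A for I and A :: "('k::field, 'v) module" (structure)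
begin

sublocale k_subspace I A
proof (unfold_locales)
  fix x c assume "x \<in> I"
  \<comment> \<open>A scalar multiple is a ring multiple by \<open>c \<odot> \<one>\<close>, so
    ideals are automatically subspaces.\<close>
  then have "(c \<odot> \<one>) \<otimes> x \<in> I" "x \<in> carrier A" by (auto intro: I_l_closed simp: Icarr)
  then show "c \<odot> x \<in> I" by (simp add: smult_mult_left)
qed

lemma quotient_mult:
  "x \<in> carrier A \<Longrightarrow> y \<in> carrier A \<Longrightarrow> cls x \<otimes>\<^bsub>Q\<^esub> cls y = cls (x \<otimes> y)"
  using rcoset_mult_add by (simp add: quotient_module_def ring.defs module.defs FactRing_def)

lemma quotient_one: "\<one>\<^bsub>Q\<^esub> = cls \<one>"
  by (simp add: quotient_module_def ring.defs module.defs FactRing_def)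

lemma k_algebra_quotient: "k_algebra Q"
proof -
  have "ring Q"
  proof (rule ringI)
    show "abelian_group Q" using k_space_quotient by (simp add: k_space_def)
    show "Group.monoid Q"
      by (rule monoidI) (auto elim!: quotientE simp: quotient_mult quotient_one m_assoc)
  qed (auto elim!: quotientE simp: quotient_add quotient_mult l_distr r_distr)
  then show ?thesis
    by (intro k_algebra.intro k_algebra_axioms.intro k_space_quotient)
       (auto elim!: quotientE simp: quotient_smult quotient_mult smult_mult_left smult_mult_right)
qed

end

section \<open>Invariance of the Jennings filtration\<close>

lemma keys_pushforward_subset:
  "keys x \<subseteq> S \<Longrightarrow> f ` S \<subseteq> T \<Longrightarrow> keys (pushforward f x) \<subseteq> T"
  using keys_pushforward[of f x] by blast

text \<open>Such a map permutes the left ideals and therefore the maximal ones, which makes the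
  radical and its powers invariant. The inverse \<open>\<eta>\<close> is part of the data so that
  preimages can be handled as images.\<close>

locale ring_automorphism = ring R for R (structure) +
  fixes \<theta> \<eta> :: "'a \<Rightarrow> 'a"
  assumes fwd_closed: "x \<in> carrier R \<Longrightarrow> \<theta> x \<in> carrier R"
    and bwd_closed: "x \<in> carrier R \<Longrightarrow> \<eta> x \<in> carrier R"
    and bwd_fwd: "x \<in> carrier R \<Longrightarrow> \<eta> (\<theta> x) = x"
    and fwd_bwd: "x \<in> carrier R \<Longrightarrow> \<theta> (\<eta> x) = x"
    and fwd_add: "x \<in> carrier R \<Longrightarrow> y \<in> carrier R \<Longrightarrow> \<theta> (x \<oplus> y) = \<theta> x \<oplus> \<theta> y"
    and fwd_mult: "x \<in> carrier R \<Longrightarrow> y \<in> carrier R \<Longrightarrow> \<theta> (x \<otimes> y) = \<theta> x \<otimes> \<theta> y"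
begin

lemma inverse_automorphism: "ring_automorphism R \<eta> \<theta>"
proof unfold_locales
  fix x y assume xy: "x \<in> carrier R" "y \<in> carrier R"
  have "\<eta> (\<theta> (\<eta> x) \<oplus> \<theta> (\<eta> y)) = \<eta> x \<oplus> \<eta> y"
    using xy by (simp add: bwd_closed bwd_fwd flip: fwd_add)
  then show "\<eta> (x \<oplus> y) = \<eta> x \<oplus> \<eta> y" using xy by (simp add: fwd_bwd)
  have "\<eta> (\<theta> (\<eta> x) \<otimes> \<theta> (\<eta> y)) = \<eta> x \<otimes> \<eta> y"
    using xy by (simp add: bwd_closed bwd_fwd flip: fwd_mult)
  then show "\<eta> (x \<otimes> y) = \<eta> x \<otimes> \<eta> y" using xy by (simp add: fwd_bwd)
qed (simp_all add: fwd_closed bwd_closed fwd_bwd bwd_fwd)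

lemma image_bwd_fwd: "S \<subseteq> carrier R \<Longrightarrow> \<eta> ` \<theta> ` S = S"
  by (force simp: bwd_fwd image_image subset_eq)

lemma image_carrier: "\<theta> ` carrier R = carrier R"
  using fwd_closed bwd_closed fwd_bwd by (force simp: image_iff)

lemma left_ideal_subset: "left_ideal I R \<Longrightarrow> I \<subseteq> carrier R"
  by (simp add: left_ideal_def additive_subgroup.a_subset)

lemma left_ideal_image:
  assumes "left_ideal I R" shows "left_ideal (\<theta> ` I) R"
  unfolding left_ideal_def
proof (intro conjI ballI)
  interpret I: additive_subgroup I R using assms by (simp add: left_ideal_def)
  note I = I.a_Hcarr
  have zero: "\<theta> \<zero> = \<zero>"
    using fwd_add[of \<zero> \<zero>] add.r_cancel_one'[of "\<theta> \<zero>" "\<theta> \<zero>"] by (simp add: fwd_closed)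
  have "subgroup (\<theta> ` I) (add_monoid R)"
  proof (rule add.subgroupI)
    show "\<theta> ` I \<subseteq> carrier R" using I fwd_closed by auto
    show "\<theta> ` I \<noteq> {}" using additive_subgroup.zero_closed[OF I.additive_subgroup_axioms] by blast
  next
    fix y assume "y \<in> \<theta> ` I"
    then obtain x where x: "x \<in> I" "y = \<theta> x" by auto
    have "\<ominus> y = \<theta> (\<ominus> x)"
      using fwd_add[of "\<ominus> x" x] x I by (intro minus_equality) (simp_all add: fwd_closed l_neg zero)
    moreover have "\<ominus> x \<in> I"
      using x subgroup.m_inv_closed[OF I.a_subgroup, of x] by (simp add: a_inv_def)
    ultimately show "\<ominus> y \<in> \<theta> ` I" by simp
  next
    fix y z assume "y \<in> \<theta> ` I" "z \<in> \<theta> ` I"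
    then obtain u v where "u \<in> I" "v \<in> I" "y = \<theta> u" "z = \<theta> v" by auto
    then show "y \<oplus> z \<in> \<theta> ` I"
      using I I.a_closed[of u v] by (auto simp flip: fwd_add)
  qed
  then show "additive_subgroup (\<theta> ` I) R" by (rule additive_subgroup.intro)
  fix x a assume "x \<in> carrier R" "a \<in> \<theta> ` I"
  then obtain b where b: "b \<in> I" "a = \<theta> b" by auto
  have "\<theta> (\<eta> x \<otimes> b) \<in> \<theta> ` I"
    using b assms \<open>x \<in> carrier R\<close> by (intro imageI) (auto simp: left_ideal_def bwd_closed)
  then show "x \<otimes> a \<in> \<theta> ` I"
    using b I \<open>x \<in> carrier R\<close> by (simp add: fwd_mult bwd_closed fwd_bwd)
qed

text \<open>A left ideal above the image of \<open>M\<close> is pulled back by \<open>\<eta>\<close>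
  to one above \<open>M\<close>, where maximality decides; applying \<open>\<theta>\<close> again
  returns the original ideal.\<close>

lemma maximal_left_ideal_image:
  assumes "maximal_left_ideal M R" shows "maximal_left_ideal (\<theta> ` M) R"
proof -
  interpret inv: ring_automorphism R \<eta> \<theta> by (rule inverse_automorphism)
  have M: "left_ideal M R" "M \<noteq> carrier R"
    and max: "\<And>I. left_ideal I R \<Longrightarrow> M \<subseteq> I \<Longrightarrow> I = M \<or> I = carrier R"
    using assms by (auto simp: maximal_left_ideal_def)
  have "\<theta> ` M \<noteq> carrier R"
    using M image_bwd_fwd[OF left_ideal_subset[OF M(1)]] inv.image_carrier by metis
  moreover have "I = \<theta> ` M \<or> I = carrier R" if I: "left_ideal I R" "\<theta> ` M \<subseteq> I" for I
  proof -
    have "M \<subseteq> \<eta> ` I" using image_mono[OF I(2), of \<eta>] image_bwd_fwd[OF left_ideal_subset[OF M(1)]] by simp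
    then have "\<eta> ` I = M \<or> \<eta> ` I = carrier R" using max inv.left_ideal_image[OF I(1)] by blast
    then show ?thesis
      using inv.image_bwd_fwd[OF left_ideal_subset[OF I(1)]] image_carrier by metis
  qed
  ultimately show ?thesis using left_ideal_image[OF M(1)] by (simp add: maximal_left_ideal_def)
qed

text \<open>To test \<open>\<theta> x\<close> against a maximal left ideal, test \<open>x\<close>
  against its image under \<open>\<eta>\<close>, which is again maximal.\<close>

lemma jacobson_radical_closed:
  assumes "x \<in> jacobson_radical R" shows "\<theta> x \<in> jacobson_radical R"
proof -
  interpret inv: ring_automorphism R \<eta> \<theta> by (rule inverse_automorphism)
  have x: "x \<in> carrier R" using assms by (simp add: jacobson_radical_def)
  have "\<theta> x \<in> M" if M: "maximal_left_ideal M R" for M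
  proof -
    have "x \<in> \<eta> ` M" using assms inv.maximal_left_ideal_image[OF M] by (simp add: jacobson_radical_def)
    moreover have "M \<subseteq> carrier R" using M left_ideal_subset by (simp add: maximal_left_ideal_def)
    ultimately show ?thesis by (auto simp: fwd_bwd)
  qed
  then show ?thesis using x by (simp add: jacobson_radical_def fwd_closed)
qed

text \<open>Membership in the carrier is proved along with invariance, since additivity and
  multiplicativity of \<open>\<theta>\<close> are available only there.\<close>

lemma radical_power_closed:
  "x \<in> radical_power R r \<Longrightarrow> x \<in> carrier R \<and> \<theta> x \<in> radical_power R r"
  unfolding radical_power_def
proof (induction r arbitrary: x)
  case (Suc r)
  from Suc.prems have "x \<in> ideal_prod R (jacobson_radical R) ((ideal_prod R (jacobson_radical R) ^^ r) (carrier R))"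
    by simp
  then have "x \<in> carrier R \<and> \<theta> x \<in> ideal_prod R (jacobson_radical R) ((ideal_prod R (jacobson_radical R) ^^ r) (carrier R))"
  proof induction
    case (prod i j)
    then have "i \<in> carrier R" "j \<in> carrier R" using Suc.IH by (auto simp: jacobson_radical_def)
    with prod Suc.IH show ?case
      by (auto simp: fwd_mult intro: ideal_prod.prod jacobson_radical_closed)
  qed (auto simp: fwd_add intro: ideal_prod.sum)
  then show ?case by simp
qed (simp add: fwd_closed)

end

text \<open>With \<open>f'\<close> as part of the data, \<open>inverse_automorphism\<close> gives
  every closure statement for the inverse as well; this is how inclusions become equalities
  below.\<close>

locale group_automorphism = group P for P :: "'a monoid" (structure) +
  fixes f f' :: "'a \<Rightarrow> 'a"
  assumes hom: "f \<in> hom P P" and hom': "f' \<in> hom P P"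
    and inverse_left: "x \<in> carrier P \<Longrightarrow> f' (f x) = x"
    and inverse_right: "x \<in> carrier P \<Longrightarrow> f (f' x) = x"
begin

lemma inverse_automorphism: "group_automorphism P f' f"
  by unfold_locales (simp_all add: hom hom' inverse_left inverse_right)

lemma f_closed [simp]: "x \<in> carrier P \<Longrightarrow> f x \<in> carrier P"
  using hom by (rule hom_in_carrier)

lemma f_one [simp]: "f \<one> = \<one>"
  using hom is_group by (intro hom_one) auto

lemma f_mult: "x \<in> carrier P \<Longrightarrow> y \<in> carrier P \<Longrightarrow> f (x \<otimes> y) = f x \<otimes> f y"
  using hom by (rule hom_mult)

lemma f_inv: "x \<in> carrier P \<Longrightarrow> f (inv x) = inv (f x)"
  using f_mult[of "inv x" x] by (intro inv_equality[symmetric]) auto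

lemma f_pow: "x \<in> carrier P \<Longrightarrow> f (x [^] (m::nat)) = f x [^] m"
  by (induction m) (simp_all add: f_mult)

lemma monoid_algebra_automorphism:
  "ring_automorphism (monoid_algebra P :: ('k::field, _) module) (pushforward f) (pushforward f')"
proof -
  interpret inv: group_automorphism P f' f by (rule inverse_automorphism)
  interpret k_algebra "monoid_algebra P :: ('k, _) module"
    by (rule k_algebra_monoid_algebra) (rule monoid_axioms)
  show ?thesis
  proof unfold_locales
    fix x y :: "'a \<Rightarrow>\<^sub>0 'k"
    assume x: "x \<in> carrier (monoid_algebra P)" and y: "y \<in> carrier (monoid_algebra P)"
    show "pushforward f x \<in> carrier (monoid_algebra P)" "pushforward f' x \<in> carrier (monoid_algebra P)"
      using x keys_pushforward_subset[of x "carrier P" f "carrier P"]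
        keys_pushforward_subset[of x "carrier P" f' "carrier P"]
      by (simp_all add: image_subset_iff)
    have "pushforward f' (pushforward f x) = pushforward id x" "pushforward f (pushforward f' x) = pushforward id x"
      using x by (auto intro!: pushforward_comp inverse_left inverse_right)
    then show "pushforward f' (pushforward f x) = x" "pushforward f (pushforward f' x) = x"
      by (simp_all add: pushforward_id)
    show "pushforward f (x \<otimes>\<^bsub>monoid_algebra P\<^esub> y) = pushforward f x \<otimes>\<^bsub>monoid_algebra P\<^esub> pushforward f y"
      using x y by (intro pushforward_mult) (auto simp: f_mult)
  qed (simp add: pushforward_add)
qed

text \<open>The induced automorphism of the group algebra sends \<open>g - 1\<close> to
  \<open>f g - 1\<close> and preserves the powers of the radical.\<close>

lemma jennings_filtration_closed:
  assumes "g \<in> jennings_filtration TYPE('k::field) P r"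
  shows "f g \<in> jennings_filtration TYPE('k) P r"
proof -
  interpret ring_automorphism "monoid_algebra P :: ('k, _) module" "pushforward f" "pushforward f'"
    by (rule monoid_algebra_automorphism)
  from assms show ?thesis
    using radical_power_closed
    by (force simp: jennings_filtration_def pushforward_diff)
qed

lemma image_jennings_filtration:
  "f ` jennings_filtration TYPE('k::field) P r = jennings_filtration TYPE('k) P r"
proof -
  interpret inv: group_automorphism P f' f by (rule inverse_automorphism)
  show ?thesis
    using jennings_filtration_closed inv.jennings_filtration_closed
    by (force simp: image_iff jennings_filtration_def inverse_right)
qed

end

section \<open>The Jennings kernel\<close>

lemma k_subspace_linear_span:
  fixes V :: "('k::field, 'v) module"
  assumes "k_space V" "S \<subseteq> carrier V"
  shows "k_subspace (linear_span V S) V" "S \<subseteq> linear_span V S"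
proof -
  interpret k_space V by fact
  let ?F = "{N. submodule N (ring_of_type_algebra :: 'k ring) V \<and> S \<subseteq> N}"
  \<comment> \<open>The intersected family is nonempty; without a member inside the carrier the
    intersection would not be bounded by it.\<close>
  have carrier: "carrier V \<in> ?F"
    using assms add.subgroup_self by (auto intro!: submodule.intro submodule_axioms.intro)
  then have sub: "linear_span V S \<subseteq> carrier V" by (auto simp: linear_span_def)
  have mem: "x \<in> linear_span V S \<longleftrightarrow> (\<forall>N\<in>?F. x \<in> N)" for x
    by (auto simp: linear_span_def)
  have F: "\<zero>\<^bsub>V\<^esub> \<in> N" "x \<in> N \<Longrightarrow> y \<in> N \<Longrightarrow> x \<oplus>\<^bsub>V\<^esub> y \<in> N" "x \<in> N \<Longrightarrow> \<ominus>\<^bsub>V\<^esub> x \<in> N" "x \<in> N \<Longrightarrow> c \<odot>\<^bsub>V\<^esub> x \<in> N"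
    if "N \<in> ?F" for N x y and c :: 'k
  proof -
    interpret submodule N "ring_of_type_algebra :: 'k ring" V using that by auto
    show "\<zero>\<^bsub>V\<^esub> \<in> N" "x \<in> N \<Longrightarrow> y \<in> N \<Longrightarrow> x \<oplus>\<^bsub>V\<^esub> y \<in> N" "x \<in> N \<Longrightarrow> \<ominus>\<^bsub>V\<^esub> x \<in> N" "x \<in> N \<Longrightarrow> c \<odot>\<^bsub>V\<^esub> x \<in> N"
      using one_closed m_closed m_inv_closed submodule.smult_closed[OF submodule_axioms]
      by (auto simp: a_inv_def ring_of_type_algebra_def)
  qed
  have "subgroup (linear_span V S) (add_monoid V)"
  proof (rule add.subgroupI)
    show "linear_span V S \<noteq> {}" using F(1) mem by blast
  qed (use sub mem F in \<open>auto simp flip: a_inv_def\<close>)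
  then show "k_subspace (linear_span V S) V"
    using mem F by unfold_locales (auto simp: subgroup.subset subgroup_def)
  show "S \<subseteq> linear_span V S" using mem by auto
qed

lemma linear_span_least:
  fixes V :: "('k::field, 'v) module"
  assumes "k_space V" "S \<subseteq> N" "N \<subseteq> carrier V" "\<zero>\<^bsub>V\<^esub> \<in> N"
    "\<And>x y. x \<in> N \<Longrightarrow> y \<in> N \<Longrightarrow> x \<oplus>\<^bsub>V\<^esub> y \<in> N" "\<And>c x. x \<in> N \<Longrightarrow> c \<odot>\<^bsub>V\<^esub> x \<in> N"
  shows "linear_span V S \<subseteq> N"
proof -
  interpret k_space V by fact
  have "\<ominus>\<^bsub>V\<^esub> x \<in> N" if "x \<in> N" for x
    using that assms(3) assms(6)[of x "-1"] by (simp add: smult_minus_one subset_eq)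
  then have "subgroup N (add_monoid V)"
    using assms by (intro add.subgroupI) (auto simp flip: a_inv_def)
  then have "submodule N (ring_of_type_algebra :: 'k ring) V"
    using assms by (intro submodule.intro submodule_axioms.intro) auto
  then show ?thesis using assms by (auto simp: linear_span_def)
qed

section \<open>Homomorphisms of restricted Lie algebras\<close>

lemma finite_lists_count: "finite {bs. length bs = m \<and> count_list bs True = l}"
  by (rule finite_subset[OF _ finite_lists_length_eq[of "UNIV :: bool set" m]]) auto

lemma (in restricted_lie_algebra) jacobson_s_closed:
  assumes "x \<in> carrier V" "y \<in> carrier V"
  shows "jacobson_s p V br x y i \<in> carrier V"
proof -
  interpret k_space V by (rule module_k_space) (rule module_axioms)
  have "foldr (\<lambda>b v. br (if b then x else y) v) bs x \<in> carrier V" for bs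
    using assms by (induction bs) (auto simp: br_closed)
  then show ?thesis unfolding jacobson_s_def by (intro k_space.smult_closed finsum_closed) (auto intro: k_space_axioms)
qed

text \<open>Compatibility with \<open>pm\<close> is deliberately absent. The p-map is not additive,
  so for the maps of interest this property is first checked on generators and then extended by
  \<open>hom_pm_add\<close>.\<close>

locale lie_algebra_hom = restricted_lie_algebra p V br pm
  for p :: nat and V :: "('k::field, 'v) module" (structure) and br pm +
  fixes a :: "'v \<Rightarrow> 'v"
  assumes hom_closed [simp]: "x \<in> carrier V \<Longrightarrow> a x \<in> carrier V"
    and hom_add: "x \<in> carrier V \<Longrightarrow> y \<in> carrier V \<Longrightarrow> a (x \<oplus> y) = a x \<oplus> a y"
    and hom_smult: "x \<in> carrier V \<Longrightarrow> a (c \<odot> x) = c \<odot> a x"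
    and hom_br: "x \<in> carrier V \<Longrightarrow> y \<in> carrier V \<Longrightarrow> a (br x y) = br (a x) (a y)"
begin

lemma hom_finsum:
  assumes "finite I" "\<And>i. i \<in> I \<Longrightarrow> F i \<in> carrier V"
  shows "a (\<Oplus>i\<in>I. F i) = (\<Oplus>i\<in>I. a (F i))"
proof -
  interpret k_space V by (rule module_k_space) (rule module_axioms)
  have zero: "a \<zero> = \<zero>" using hom_smult[of \<zero> 0] by simp
  show ?thesis
    using assms
  proof (induction I rule: finite_induct)
    case (insert i I)
    then have "F \<in> I \<rightarrow> carrier V" "(\<lambda>i. a (F i)) \<in> I \<rightarrow> carrier V" by auto
    with insert show ?case by (simp add: hom_add)
  qed (simp add: zero)
qed

lemma hom_jacobson_s:
  assumes "x \<in> carrier V" "y \<in> carrier V"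
  shows "a (jacobson_s p V br x y i) = jacobson_s p V br (a x) (a y) i"
proof -
  interpret k_space V by (rule module_k_space) (rule module_axioms)
  have cl: "foldr (\<lambda>b v. br (if b then x else y) v) bs x \<in> carrier V" for bs
    using assms by (induction bs) (auto simp: br_closed)
  have "a (foldr (\<lambda>b v. br (if b then x else y) v) bs x) = foldr (\<lambda>b v. br (if b then a x else a y) v) bs (a x)" for bs
    using assms by (induction bs) (auto simp: cl hom_br)
  then show ?thesis
    unfolding jacobson_s_def
    by (subst hom_smult) (auto simp: cl finite_lists_count hom_finsum intro!: finsum_closed)
qed

text \<open>By \<open>pm_add\<close> the failure of additivity of the p-map is a sum of scaled
  iterated brackets, and these are preserved by any linear map respecting brackets.\<close>

lemma hom_pm_add:
  assumes "x \<in> carrier V" "y \<in> carrier V" "a (pm x) = pm (a x)" "a (pm y) = pm (a y)"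
  shows "a (pm (x \<oplus> y)) = pm (a (x \<oplus> y))"
  using assms
  by (simp add: hom_add pm_add pm_closed jacobson_s_closed hom_finsum hom_jacobson_s finsum_closed Pi_def)

end

locale restricted_lie_automorphism = lie_algebra_hom p V br pm a
  for p :: nat and V :: "('k::field, 'v) module" (structure) and br pm a +
  fixes a' :: "'v \<Rightarrow> 'v"
  assumes a'_closed [simp]: "x \<in> carrier V \<Longrightarrow> a' x \<in> carrier V"
    and a'_a [simp]: "x \<in> carrier V \<Longrightarrow> a' (a x) = x"
    and a_a' [simp]: "x \<in> carrier V \<Longrightarrow> a (a' x) = x"
    and hom_pm: "x \<in> carrier V \<Longrightarrow> a (pm x) = pm (a x)"
begin

lemma inverse_automorphism: "restricted_lie_automorphism p V br pm a' a"
proof -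
  interpret k_space V by (rule module_k_space) (rule module_axioms)
  show ?thesis
  proof unfold_locales
    fix x y c assume xy: "x \<in> carrier V" "y \<in> carrier V"
    have "a' (a (a' x) \<oplus> a (a' y)) = a' x \<oplus> a' y" using xy by (simp del: a_a' flip: hom_add)
    then show "a' (x \<oplus> y) = a' x \<oplus> a' y" using xy by simp
    have "a' (br (a (a' x)) (a (a' y))) = br (a' x) (a' y)" using xy by (simp add: br_closed del: a_a' flip: hom_br)
    then show "a' (br x y) = br (a' x) (a' y)" using xy by simp
  next
    fix x c assume xy: "x \<in> carrier V"
    have "a' (c \<odot> a (a' x)) = c \<odot> a' x" using xy by (simp del: a_a' flip: hom_smult)
    then show "a' (c \<odot> x) = c \<odot> a' x" using xy by simp
    have "a' (pm (a (a' x))) = pm (a' x)" using xy by (simp add: pm_closed del: a_a' flip: hom_pm)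
    then show "a' (pm x) = pm (a' x)" using xy by simp
  qed simp_all
qed

end


text \<open>
  Right multiplication only concerns the last factor of \<open>radical_power\<close>, which is the whole ring;
  so it is not necessary to know that the Jacobson radical is a right ideal.
\<close>

lemma (in ring) radical_power_ideal:
  shows "radical_power R r \<subseteq> carrier R" "\<zero> \<in> radical_power R r"
    "x \<in> radical_power R r \<Longrightarrow> y \<in> radical_power R r \<Longrightarrow> x \<oplus> y \<in> radical_power R r"
    "c \<in> carrier R \<Longrightarrow> x \<in> radical_power R r \<Longrightarrow> c \<otimes> x \<in> radical_power R r"
    "c \<in> carrier R \<Longrightarrow> x \<in> radical_power R r \<Longrightarrow> x \<otimes> c \<in> radical_power R r"
proof -
  let ?J = "jacobson_radical R"
  have J: "?J \<subseteq> carrier R" "\<zero> \<in> ?J" "\<And>c i. c \<in> carrier R \<Longrightarrow> i \<in> ?J \<Longrightarrow> c \<otimes> i \<in> ?J"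
    by (auto simp: jacobson_radical_def maximal_left_ideal_def left_ideal_def additive_subgroup.zero_closed)
  have "radical_power R r \<subseteq> carrier R \<and> \<zero> \<in> radical_power R r \<and>
    (\<forall>x\<in>radical_power R r. \<forall>y\<in>radical_power R r. x \<oplus> y \<in> radical_power R r) \<and>
    (\<forall>c\<in>carrier R. \<forall>x\<in>radical_power R r. c \<otimes> x \<in> radical_power R r \<and> x \<otimes> c \<in> radical_power R r)"
  proof (induction r)
    case (Suc r)
    let ?X = "radical_power R r"
    have X: "radical_power R (Suc r) = ideal_prod R ?J ?X" by (simp add: radical_power_def)
    have sub: "x \<in> carrier R" if "x \<in> ideal_prod R ?J ?X" for x
      using that by induction (use Suc J in auto)
    moreover have "\<zero> \<in> ideal_prod R ?J ?X"
      using ideal_prod.prod[of \<zero> ?J \<zero> ?X R] Suc J by auto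
    moreover have "c \<otimes> x \<in> ideal_prod R ?J ?X \<and> x \<otimes> c \<in> ideal_prod R ?J ?X"
      if c: "c \<in> carrier R" and x: "x \<in> ideal_prod R ?J ?X" for c x
      using x
    proof induction
      case (prod i j)
      have "(c \<otimes> i) \<otimes> j \<in> ideal_prod R ?J ?X" "i \<otimes> (j \<otimes> c) \<in> ideal_prod R ?J ?X"
        using prod c Suc.IH J by (auto intro!: ideal_prod.prod)
      then show ?case using prod c Suc.IH J by (simp add: m_assoc subset_eq)
    next
      case (sum x y)
      then show ?case using c sub by (auto simp: l_distr r_distr intro: ideal_prod.sum)
    qed
    ultimately show ?case by (auto simp: X intro: ideal_prod.sum)
  qed (simp add: radical_power_def)
  then show "radical_power R r \<subseteq> carrier R" "\<zero> \<in> radical_power R r"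
    "x \<in> radical_power R r \<Longrightarrow> y \<in> radical_power R r \<Longrightarrow> x \<oplus> y \<in> radical_power R r"
    "c \<in> carrier R \<Longrightarrow> x \<in> radical_power R r \<Longrightarrow> c \<otimes> x \<in> radical_power R r"
    "c \<in> carrier R \<Longrightarrow> x \<in> radical_power R r \<Longrightarrow> x \<otimes> c \<in> radical_power R r"
    by blast+
qed

section \<open>The Jennings filtration and the presentation of its graded pieces\<close>

lemma jennings_filtration_subset: "jennings_filtration TYPE('k::field) P r \<subseteq> carrier P"
  by (auto simp: jennings_filtration_def)

text \<open>The powers of the radical absorb multiplication on both sides. The closure properties
  are then read off from \<open>inv g - 1 = - inv g (g - 1)\<close>,
  \<open>g h - 1 = (g - 1) h + (h - 1)\<close> and
  \<open>h g (inv h) - 1 = h (g - 1) (inv h)\<close>.\<close>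

lemma normal_jennings_filtration:
  assumes "group P" shows "jennings_filtration TYPE('k::field) P r \<lhd> P"
proof -
  interpret group P by fact
  let ?A = "monoid_algebra P :: ('k, _) module"
  interpret A: k_algebra ?A by (rule k_algebra_monoid_algebra) (rule monoid_axioms)
  note rp = A.radical_power_ideal[where r = r, simplified]
  let ?s = "\<lambda>g. single g (1::'k)"
  let ?F = "jennings_filtration TYPE('k) P r"
  have mem: "g \<in> ?F \<longleftrightarrow> g \<in> carrier P \<and> ?s g - ?s \<one>\<^bsub>P\<^esub> \<in> radical_power ?A r" for g
    by (simp add: jennings_filtration_def)
  have diff: "u \<otimes>\<^bsub>?A\<^esub> (x - y) = u \<otimes>\<^bsub>?A\<^esub> x - u \<otimes>\<^bsub>?A\<^esub> y"
      "(x - y) \<otimes>\<^bsub>?A\<^esub> u = x \<otimes>\<^bsub>?A\<^esub> u - y \<otimes>\<^bsub>?A\<^esub> u" for u x y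
    using monoid_algebra_mult_add_right[of P u "x - y" y] monoid_algebra_mult_add_left[of P "x - y" y u]
    by simp_all
  show ?thesis
    unfolding normal_inv_iff
  proof (intro conjI ballI subgroupI)
    show "?F \<subseteq> carrier P" by (rule jennings_filtration_subset)
    show "?F \<noteq> {}" using rp(2) mem[of "\<one>\<^bsub>P\<^esub>"] by auto
  next
    fix g assume g: "g \<in> ?F"
    have "(single (inv\<^bsub>P\<^esub> g) (- 1)) \<otimes>\<^bsub>?A\<^esub> (?s g - ?s \<one>\<^bsub>P\<^esub>) \<in> radical_power ?A r"
      using g by (intro rp(4)) (auto simp: mem)
    also have "(single (inv\<^bsub>P\<^esub> g) (- 1)) \<otimes>\<^bsub>?A\<^esub> (?s g - ?s \<one>\<^bsub>P\<^esub>) = ?s (inv\<^bsub>P\<^esub> g) - ?s \<one>\<^bsub>P\<^esub>"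
      using g by (simp add: mem diff) (simp add: single_uminus)
    finally show "inv\<^bsub>P\<^esub> g \<in> ?F" using g by (simp add: mem)
  next
    fix g h assume g: "g \<in> ?F" and h: "h \<in> ?F"
    have "(?s g - ?s \<one>\<^bsub>P\<^esub>) \<otimes>\<^bsub>?A\<^esub> ?s h + (?s h - ?s \<one>\<^bsub>P\<^esub>) \<in> radical_power ?A r"
      using g h by (intro rp(3) rp(5)) (auto simp: mem)
    also have "(?s g - ?s \<one>\<^bsub>P\<^esub>) \<otimes>\<^bsub>?A\<^esub> ?s h + (?s h - ?s \<one>\<^bsub>P\<^esub>) = ?s (g \<otimes>\<^bsub>P\<^esub> h) - ?s \<one>\<^bsub>P\<^esub>"
      using g h by (simp add: mem diff)
    finally show "g \<otimes>\<^bsub>P\<^esub> h \<in> ?F" using g h by (simp add: mem)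
  next
    fix h g assume h: "h \<in> carrier P" and g: "g \<in> ?F"
    have "?s h \<otimes>\<^bsub>?A\<^esub> (?s g - ?s \<one>\<^bsub>P\<^esub>) \<otimes>\<^bsub>?A\<^esub> ?s (inv\<^bsub>P\<^esub> h) \<in> radical_power ?A r"
      using g h by (intro rp(4) rp(5)) (auto simp: mem)
    also have "?s h \<otimes>\<^bsub>?A\<^esub> (?s g - ?s \<one>\<^bsub>P\<^esub>) \<otimes>\<^bsub>?A\<^esub> ?s (inv\<^bsub>P\<^esub> h) = ?s (h \<otimes>\<^bsub>P\<^esub> g \<otimes>\<^bsub>P\<^esub> inv\<^bsub>P\<^esub> h) - ?s \<one>\<^bsub>P\<^esub>"
      using g h by (simp add: mem diff)
    finally show "h \<otimes>\<^bsub>P\<^esub> g \<otimes>\<^bsub>P\<^esub> inv\<^bsub>P\<^esub> h \<in> ?F" using g h by (simp add: mem)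
  qed
qed

lemma mem_jennings_gens:
  "(r, A) \<in> jennings_gens TYPE('k::field) P \<longleftrightarrow>
    1 \<le> r \<and> (\<exists>g\<in>jennings_filtration TYPE('k) P r. A = jennings_filtration TYPE('k) P (Suc r) #>\<^bsub>P\<^esub> g)"
  by (auto simp: jennings_gens_def jennings_quotient_def FactGroup_def RCOSETS_def r_coset_def)

lemma jennings_gens_subset:
  assumes "group P" "(r, A) \<in> jennings_gens TYPE('k::field) P" shows "A \<subseteq> carrier P"
proof -
  interpret group P by fact
  from assms(2) obtain g where "g \<in> jennings_filtration TYPE('k) P r"
    "A = jennings_filtration TYPE('k) P (Suc r) #>\<^bsub>P\<^esub> g"
    by (auto simp: mem_jennings_gens)
  then show ?thesis
    using jennings_filtration_subset[where 'k='k and P=P] r_coset_subset_G by (metis subsetD)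
qed

lemma jennings_quotient_mult: "A \<otimes>\<^bsub>jennings_quotient k P r\<^esub> B = A <#>\<^bsub>P\<^esub> B"
  by (simp add: jennings_quotient_def FactGroup_def set_mult_def)

text \<open>Normality of the next filtration step makes the product of two cosets a coset, and
  closure of step \<open>r\<close> keeps its representative there. This puts the additivity
  relations inside the free space on the generators.\<close>

lemma jennings_gens_mult:
  assumes "group P" "(r, A) \<in> jennings_gens TYPE('k::field) P" "(r, B) \<in> jennings_gens TYPE('k) P"
  shows "(r, A <#>\<^bsub>P\<^esub> B) \<in> jennings_gens TYPE('k) P"
proof -
  interpret normal "jennings_filtration TYPE('k) P (Suc r)" P by (rule normal_jennings_filtration) fact
  interpret F: normal "jennings_filtration TYPE('k) P r" P by (rule normal_jennings_filtration) fact
  from assms(2,3) obtain g h where "g \<in> jennings_filtration TYPE('k) P r" "h \<in> jennings_filtration TYPE('k) P r" "1 \<le> r"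
    "A = jennings_filtration TYPE('k) P (Suc r) #>\<^bsub>P\<^esub> g" "B = jennings_filtration TYPE('k) P (Suc r) #>\<^bsub>P\<^esub> h"
    by (auto simp: mem_jennings_gens)
  then show ?thesis
    using jennings_filtration_subset[where 'k='k and P=P and r=r]
    by (auto simp: mem_jennings_gens rcos_sum subset_eq intro!: bexI[of _ "g \<otimes>\<^bsub>P\<^esub> h"])
qed

lemma jennings_relations_subset:
  assumes "group P"
  shows "jennings_relations P \<subseteq> carrier (free_space (jennings_gens TYPE('k::field) P) :: ('k, _) module)"
proof -
  have "keys (single (r, A <#>\<^bsub>P\<^esub> B) (1::'k)
        - (single (r, A) 1 + single (r, B) 1)) \<subseteq> jennings_gens TYPE('k) P"
    if "(r, A) \<in> jennings_gens TYPE('k) P" "(r, B) \<in> jennings_gens TYPE('k) P" for r A B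
    using that jennings_gens_mult[OF assms that]
    by (intro order_trans[OF keys_diff] Un_least keys_add_subset) auto
  then show ?thesis by (fastforce simp: jennings_relations_def jennings_quotient_mult)
qed

lemma k_subspace_jennings_kernel:
  assumes "group P"
  shows "k_subspace (jennings_kernel P) (free_space (jennings_gens TYPE('k::field) P) :: ('k, _) module)"
  unfolding jennings_kernel_def
  by (rule k_subspace_linear_span[OF k_space_free_space jennings_relations_subset[OF assms]])

section \<open>Automorphisms of the Jennings Lie algebra\<close>

context group_automorphism
begin

abbreviation gens_map :: "nat \<times> 'a set \<Rightarrow> nat \<times> 'a set" where
  "gens_map \<equiv> \<lambda>(r, A). (r, f ` A)"

lemma image_jennings_coset:
  assumes "g \<in> carrier P"
  shows "f ` (jennings_filtration TYPE('k::field) P r #> g) = jennings_filtration TYPE('k) P r #> f g"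
proof -
  have coset: "S #> x = (\<lambda>h. h \<otimes> x) ` S" for S x by (auto simp: r_coset_def)
  have "f ` (jennings_filtration TYPE('k) P r #> g) = (\<lambda>h. f h \<otimes> f g) ` jennings_filtration TYPE('k) P r"
    unfolding coset image_image
    by (rule image_cong) (use assms jennings_filtration_subset[where 'k = 'k and P = P and r = r] f_mult in auto)
  also have "\<dots> = (\<lambda>h. h \<otimes> f g) ` (f ` jennings_filtration TYPE('k) P r)"
    by (simp add: image_image)
  finally show ?thesis
    by (simp add: image_jennings_filtration coset)
qed

lemma gens_map_closed:
  "s \<in> jennings_gens TYPE('k::field) P \<Longrightarrow> gens_map s \<in> jennings_gens TYPE('k) P"
  using jennings_filtration_subset[where 'k='k and P = P] jennings_filtration_closed[where 'k='k]
  by (cases s) (force simp: mem_jennings_gens image_jennings_coset subset_eq)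

lemma pushforward_gens_closed:
  "keys x \<subseteq> jennings_gens TYPE('k::field) P \<Longrightarrow>
   keys (pushforward gens_map (x :: _ \<Rightarrow>\<^sub>0 'k)) \<subseteq> jennings_gens TYPE('k) P"
  by (erule keys_pushforward_subset) (auto dest: gens_map_closed)

lemma image_set_mult:
  "A \<subseteq> carrier P \<Longrightarrow> B \<subseteq> carrier P \<Longrightarrow> f ` (A <#> B) = f ` A <#> f ` B"
  by (force simp: set_mult_def f_mult image_iff subset_eq)

text \<open>The preimage of the kernel is a subspace, so it suffices to look at the spanning
  relations; the one for \<open>A\<close> and \<open>B\<close> goes to the one for their images
  under \<open>f\<close>.\<close>

lemma pushforward_kernel_closed:
  assumes "x \<in> jennings_kernel P"
  shows "pushforward gens_map (x :: _ \<Rightarrow>\<^sub>0 'k::field) \<in> jennings_kernel P"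
proof -
  let ?F = "free_space (jennings_gens TYPE('k) P) :: ('k, _) module"
  interpret K: k_subspace "jennings_kernel P" ?F
    by (rule k_subspace_jennings_kernel) (rule group_axioms)
  let ?N = "{x \<in> carrier ?F. pushforward gens_map x \<in> jennings_kernel P}"
  have rel: "jennings_relations P \<subseteq> (jennings_kernel P :: (_ \<Rightarrow>\<^sub>0 'k) set)"
    unfolding jennings_kernel_def
    by (rule k_subspace_linear_span(2)[OF k_space_free_space jennings_relations_subset]) (rule group_axioms)
  have "linear_span ?F (jennings_relations P) \<subseteq> ?N"
  proof (rule linear_span_least[OF k_space_free_space])
    have "pushforward gens_map x \<in> jennings_relations P" if "x \<in> jennings_relations P" for x :: "_ \<Rightarrow>\<^sub>0 'k"
    proof -
      from that obtain r A B where x: "x = single (r, A <#> B) 1 - (single (r, A) 1 + single (r, B) 1)"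
        and rA: "(r, A) \<in> jennings_gens TYPE('k) P" and rB: "(r, B) \<in> jennings_gens TYPE('k) P"
        by (auto simp: jennings_relations_def jennings_quotient_mult)
      have "pushforward gens_map x = single (r, f ` A <#> f ` B) 1
          - (single (r, f ` A) 1 + single (r, f ` B) 1)"
        using jennings_gens_subset[OF group_axioms rA] jennings_gens_subset[OF group_axioms rB]
        by (simp add: x pushforward_add pushforward_diff image_set_mult)
      then show ?thesis
        using gens_map_closed[OF rA] gens_map_closed[OF rB]
        by (auto simp: jennings_relations_def jennings_quotient_mult)
    qed
    then show "jennings_relations P \<subseteq> ?N"
      using rel jennings_relations_subset[OF group_axioms, where 'k='k] by auto
  next
    fix c x assume "x \<in> ?N"
    then show "c \<odot>\<^bsub>?F\<^esub> x \<in> ?N"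
      using keys_scale[of c x] K.smult_mem[of "pushforward gens_map x" c] by (auto simp: pushforward_scale)
  next
    fix x y assume "x \<in> ?N" "y \<in> ?N"
    then show "x \<oplus>\<^bsub>?F\<^esub> y \<in> ?N"
      using keys_add[of x y] K.a_closed[of "pushforward gens_map x" "pushforward gens_map y"]
      by (auto simp: pushforward_add)
  qed (use additive_subgroup.zero_closed[OF K.additive_subgroup_axioms] in auto)
  then show ?thesis using assms by (auto simp: jennings_kernel_def)
qed

text \<open>An inclusion would not suffice: \<open>jennings_map\<close> acts elementwise, and the
  image of a coset is a full coset only because the kernel is hit entirely. Surjectivity comes from
  the inverse automorphism.\<close>

lemma image_kernel:
  "pushforward gens_map ` jennings_kernel P = (jennings_kernel P :: (_ \<Rightarrow>\<^sub>0 'k::field) set)"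
proof -
  interpret inv: group_automorphism P f' f by (rule inverse_automorphism)
  interpret K: k_subspace "jennings_kernel P" "free_space (jennings_gens TYPE('k) P) :: ('k, _) module"
    by (rule k_subspace_jennings_kernel) (rule group_axioms)
  have "x \<in> pushforward gens_map ` jennings_kernel P" if x: "x \<in> jennings_kernel P" for x :: "_ \<Rightarrow>\<^sub>0 'k"
  proof -
    have "pushforward gens_map (pushforward inv.gens_map x) = pushforward id x"
    proof (rule pushforward_comp)
      fix s assume "s \<in> keys x"
      then have "s \<in> jennings_gens TYPE('k) P" using x K.a_subset by auto
      \<comment> \<open>Generators are sets of group elements; applying \<open>f'\<close> and then
        \<open>f\<close> returns such a set only if it lies in the carrier.\<close>
      then have "snd s \<subseteq> carrier P" using jennings_gens_subset[OF group_axioms, of "fst s" "snd s"] by simp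
      then have "f ` f' ` snd s = snd s" by (force simp: image_image inverse_right subset_eq)
      then show "gens_map (inv.gens_map s) = id s" by (simp add: case_prod_beta)
    qed
    then show ?thesis
      using inv.pushforward_kernel_closed[OF x] by (intro image_eqI[of _ _ "pushforward inv.gens_map x"]) (simp_all add: pushforward_id)
  qed
  then show ?thesis using pushforward_kernel_closed by auto
qed

lemma jennings_map_coset:
  "jennings_map f (jennings_kernel P +>\<^bsub>(free_space (jennings_gens TYPE('k) P) :: ('k::field, _) module)\<^esub> x)
    = jennings_kernel P +>\<^bsub>(free_space (jennings_gens TYPE('k) P) :: ('k, _) module)\<^esub> pushforward gens_map x"
proof -
  let ?F = "free_space (jennings_gens TYPE('k) P) :: ('k, _) module"
  have coset: "S +>\<^bsub>?F\<^esub> x = (\<lambda>y. y + x) ` S" for S x by (auto simp: a_r_coset_def r_coset_def)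
  have "jennings_map f (jennings_kernel P +>\<^bsub>?F\<^esub> x)
      = (\<lambda>y. y + pushforward gens_map x) ` (pushforward gens_map ` jennings_kernel P)"
    by (simp add: jennings_map_def coset image_image pushforward_add)
  then show ?thesis by (simp add: image_kernel coset)
qed

lemma jennings_map_elt:
  "g \<in> carrier P \<Longrightarrow> jennings_map f (jennings_elt P r g :: (_ \<Rightarrow>\<^sub>0 'k::field) set) = jennings_elt P r (f g)"
  by (simp add: jennings_elt_def jennings_map_coset image_jennings_coset)

end

lemma jennings_elt_closed:
  assumes "group P" "1 \<le> r" "g \<in> jennings_filtration TYPE('k::field) P r"
  shows "jennings_elt P r g \<in> carrier (Jen P :: ('k, _) module)"
proof -
  interpret K: k_subspace "jennings_kernel P" "free_space (jennings_gens TYPE('k) P) :: ('k, _) module"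
    by (rule k_subspace_jennings_kernel) fact
  show ?thesis
    unfolding Jen_def jennings_elt_def using assms
    by (intro K.cls_closed) (auto simp: mem_jennings_gens)
qed

lemma k_space_Jen: "group P \<Longrightarrow> k_space (Jen P :: ('k::field, _) module)"
  unfolding Jen_def by (rule k_subspace.k_space_quotient[OF k_subspace_jennings_kernel])

text \<open>The classes of group elements span \<open>Jen P\<close>. The step adds one scalar
  multiple instead of assuming that \<open>Q\<close> is stable under sums, so the principle also
  serves the p-map, which is not additive.\<close>

lemma Jen_induct [consumes 2, case_names zero add]:
  fixes C :: "('a, 'k::field) jen"
  assumes "group P" "C \<in> carrier (Jen P)" and zero: "Q \<zero>\<^bsub>(Jen P :: ('k, _) module)\<^esub>"
    and add: "\<And>C r g c. C \<in> carrier (Jen P) \<Longrightarrow> Q C \<Longrightarrow> 1 \<le> r \<Longrightarrow> g \<in> jennings_filtration TYPE('k) P r \<Longrightarrow>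
      jennings_elt P r g \<in> carrier (Jen P :: ('k, _) module) \<Longrightarrow>
      Q (C \<oplus>\<^bsub>Jen P\<^esub> c \<odot>\<^bsub>Jen P\<^esub> jennings_elt P r g)"
  shows "Q C"
proof -
  interpret K: k_subspace "jennings_kernel P" "free_space (jennings_gens TYPE('k) P) :: ('k, _) module"
    by (rule k_subspace_jennings_kernel) fact
  obtain x where x: "keys x \<subseteq> jennings_gens TYPE('k) P" "C = K.cls x"
    using assms(2) unfolding Jen_def by (rule K.quotientE) auto
  from x(1) have "Q (K.cls x)"
  proof (induction x rule: poly_mapping_single_induct)
    case zero
    then show ?case using assms(3) K.quotient_zero by (simp add: Jen_def)
  next
    case (add y s c)
    obtain r g where s: "s = (r, jennings_filtration TYPE('k) P (Suc r) #>\<^bsub>P\<^esub> g)" "1 \<le> r" "g \<in> jennings_filtration TYPE('k) P r"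
      using add.hyps(2) by (cases s) (auto simp: mem_jennings_gens)
    have "K.cls (y + single s c) = K.cls y \<oplus>\<^bsub>Jen P\<^esub> c \<odot>\<^bsub>Jen P\<^esub> jennings_elt P r g"
      using add.hyps s K.quotient_smult[of "single s 1" c] K.quotient_add[of y "single s c"]
      by (simp add: Jen_def jennings_elt_def)
    moreover have "K.cls y \<in> carrier (Jen P)" unfolding Jen_def using add.hyps by (intro K.cls_closed) auto
    ultimately show ?case
      using assms(4)[OF _ add.IH s(2,3) jennings_elt_closed[OF assms(1) s(2,3)]] by simp
  qed
  then show ?thesis by (simp add: x)
qed

context group_automorphism
begin

lemma jennings_map_linear:
  fixes C D :: "('a, 'k::field) jen"
  assumes "C \<in> carrier (Jen P)" "D \<in> carrier (Jen P)"
  shows "jennings_map f C \<in> carrier (Jen P)"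
    and "jennings_map f (C \<oplus>\<^bsub>Jen P\<^esub> D) = jennings_map f C \<oplus>\<^bsub>Jen P\<^esub> jennings_map f D"
    and "jennings_map f (c \<odot>\<^bsub>Jen P\<^esub> C) = c \<odot>\<^bsub>Jen P\<^esub> jennings_map f C"
proof -
  interpret K: k_subspace "jennings_kernel P" "free_space (jennings_gens TYPE('k) P) :: ('k, _) module"
    by (rule k_subspace_jennings_kernel) (rule group_axioms)
  obtain x where x: "keys x \<subseteq> jennings_gens TYPE('k) P" "C = K.cls x"
    using assms(1) unfolding Jen_def by (rule K.quotientE) auto
  obtain y where y: "keys y \<subseteq> jennings_gens TYPE('k) P" "D = K.cls y"
    using assms(2) unfolding Jen_def by (rule K.quotientE) auto
  note closed = pushforward_gens_closed[OF x(1)] pushforward_gens_closed[OF y(1)]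
  show "jennings_map f C \<in> carrier (Jen P)"
    using closed unfolding Jen_def x jennings_map_coset by (intro K.cls_closed) auto
  show "jennings_map f (C \<oplus>\<^bsub>Jen P\<^esub> D) = jennings_map f C \<oplus>\<^bsub>Jen P\<^esub> jennings_map f D"
    using x y closed K.quotient_add[of x y] K.quotient_add[of "pushforward gens_map x" "pushforward gens_map y"]
    by (simp add: Jen_def jennings_map_coset pushforward_add)
  show "jennings_map f (c \<odot>\<^bsub>Jen P\<^esub> C) = c \<odot>\<^bsub>Jen P\<^esub> jennings_map f C"
    using x closed K.quotient_smult[of x c] K.quotient_smult[of "pushforward gens_map x" c]
    by (simp add: Jen_def jennings_map_coset pushforward_scale)
qed

lemma jennings_map_zero:
  "jennings_map f \<zero>\<^bsub>(Jen P :: ('k::field, _) module)\<^esub> = \<zero>\<^bsub>(Jen P :: ('k, _) module)\<^esub>" (is "_ = ?z")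
proof -
  interpret J: k_space "Jen P :: ('k, _) module" by (rule k_space_Jen) (rule group_axioms)
  have "jennings_map f (0 \<odot>\<^bsub>Jen P\<^esub> ?z) = 0 \<odot>\<^bsub>Jen P\<^esub> jennings_map f ?z"
    by (rule jennings_map_linear) auto
  then show ?thesis using jennings_map_linear(1)[of ?z ?z] by simp
qed

text \<open>On the spanning classes bracket and p-map are the commutator and the p-th power in
  \<open>P\<close>, which \<open>f\<close> preserves. Bilinearity extends the first statement,
  \<open>hom_pm_add\<close> the second.\<close>

lemma jennings_map_restricted_lie:
  assumes st: "jennings_structure p P br pm" and "p > 0"
  shows "lie_algebra_hom p (Jen P :: ('k::field, _) module) br pm (jennings_map f)"
    and "C \<in> carrier (Jen P) \<Longrightarrow> jennings_map f (pm C) = pm (jennings_map f C)"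
proof -
  let ?J = "Jen P :: ('k, _) module"
  interpret restricted_lie_algebra p ?J br pm using st by (simp add: jennings_structure_def)
  interpret J: k_space ?J by (rule k_space_Jen) (rule group_axioms)
  have br_elt: "\<And>r s g h. 1 \<le> r \<Longrightarrow> 1 \<le> s \<Longrightarrow> g \<in> jennings_filtration TYPE('k) P r \<Longrightarrow> h \<in> jennings_filtration TYPE('k) P s \<Longrightarrow>
      br (jennings_elt P r g) (jennings_elt P s h) = jennings_elt P (r + s) (g \<otimes> h \<otimes> inv g \<otimes> inv h)"
    and pm_elt: "\<And>r g. 1 \<le> r \<Longrightarrow> g \<in> jennings_filtration TYPE('k) P r \<Longrightarrow>
      pm (jennings_elt P r g) = jennings_elt P (p * r) (g [^] p)"
    using st by (auto simp: jennings_structure_def)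
  note sub = jennings_filtration_subset[where 'k = 'k and P = P, THEN subsetD]
  note lin = jennings_map_linear[where 'k = 'k]
  have br_zero: "br \<zero>\<^bsub>?J\<^esub> C = \<zero>\<^bsub>?J\<^esub>" "br C \<zero>\<^bsub>?J\<^esub> = \<zero>\<^bsub>?J\<^esub>" if "C \<in> carrier ?J" for C
    using br_smult_left[of "\<zero>\<^bsub>?J\<^esub>" C 0] br_smult_right[of C "\<zero>\<^bsub>?J\<^esub>" 0] that by (simp_all add: br_closed)
  have br_hom: "jennings_map f (br C D) = br (jennings_map f C) (jennings_map f D)"
    if C: "C \<in> carrier ?J" and D: "D \<in> carrier ?J" for C D
    using group_axioms C
  proof (induction C rule: Jen_induct)
    case (add C r g c)
    have "jennings_map f (br (jennings_elt P r g) D) = br (jennings_map f (jennings_elt P r g)) (jennings_map f D)"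
      using group_axioms D
    proof (induction D rule: Jen_induct)
      case (add D s h d)
      note rg = \<open>1 \<le> r\<close> \<open>g \<in> jennings_filtration TYPE('k) P r\<close> \<open>jennings_elt P r g \<in> carrier ?J\<close>
      have "jennings_map f (br (jennings_elt P r g) (jennings_elt P s h)) =
          br (jennings_map f (jennings_elt P r g)) (jennings_map f (jennings_elt P s h))"
        using add.hyps rg
        by (simp add: br_elt jennings_map_elt sub f_mult f_inv jennings_filtration_closed)
      with add rg show ?case by (simp add: br_add_right br_smult_right br_closed lin)
    qed (use add.hyps in \<open>simp add: br_zero jennings_map_zero lin\<close>)
    with add D show ?case by (simp add: br_add_left br_smult_left br_closed lin)
  qed (use D in \<open>simp add: br_zero jennings_map_zero lin\<close>)
  show hom: "lie_algebra_hom p ?J br pm (jennings_map f)"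
    by unfold_locales (auto simp: lin br_hom)
  interpret hom: lie_algebra_hom p ?J br pm "jennings_map f" by (rule hom)
  show "jennings_map f (pm C) = pm (jennings_map f C)" if "C \<in> carrier ?J" for C
    using group_axioms that
  proof (induction C rule: Jen_induct)
    case zero
    \<comment> \<open>The value at zero comes from \<open>pm_smult\<close> with scalar 0, as
      \<open>0 ^ p = 0\<close> for positive \<open>p\<close>.\<close>
    have "pm \<zero>\<^bsub>?J\<^esub> = \<zero>\<^bsub>?J\<^esub>" using pm_smult[of "\<zero>\<^bsub>?J\<^esub>" 0] \<open>p > 0\<close> by (simp add: pm_closed zero_power)
    then show ?case by (simp add: jennings_map_zero)
  next
    case (add C r g c)
    have "jennings_map f (pm (jennings_elt P r g)) = pm (jennings_map f (jennings_elt P r g))"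
      using add.hyps by (simp add: pm_elt jennings_map_elt sub f_pow jennings_filtration_closed)
    then have "jennings_map f (pm (c \<odot>\<^bsub>?J\<^esub> jennings_elt P r g)) = pm (jennings_map f (c \<odot>\<^bsub>?J\<^esub> jennings_elt P r g))"
      using add.hyps by (simp add: pm_smult pm_closed lin)
    then show ?case
      using add by (intro hom.hom_pm_add) auto
  qed
qed

end

lemma jennings_map_comp:
  fixes C :: "('a, 'k::field) jen"
  assumes "group_automorphism P f f'" "group_automorphism P g g'" "group_automorphism P h h'"
    and fgh: "\<And>x. x \<in> carrier P \<Longrightarrow> f (g x) = h x" and C: "C \<in> carrier (Jen P)"
  shows "jennings_map f (jennings_map g C) = jennings_map h C"
proof -
  interpret f: group_automorphism P f f' by fact
  interpret g: group_automorphism P g g' by fact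
  interpret h: group_automorphism P h h' by fact
  interpret J: k_space "Jen P :: ('k, _) module" by (rule k_space_Jen) (rule f.group_axioms)
  show ?thesis
    using f.group_axioms C
  proof (induction C rule: Jen_induct)
    case (add C r x c)
    have "jennings_map f (jennings_map g (jennings_elt P r x)) = (jennings_map h (jennings_elt P r x) :: ('a, 'k) jen)"
      using add.hyps jennings_filtration_subset[of P r, where 'k = 'k]
      by (auto simp: f.jennings_map_elt g.jennings_map_elt h.jennings_map_elt fgh subset_eq)
    with add show ?case
      by (simp add: f.jennings_map_linear g.jennings_map_linear h.jennings_map_linear)
  qed (simp add: f.jennings_map_zero g.jennings_map_zero h.jennings_map_zero)
qed

lemma jennings_map_id:
  fixes C :: "('a, 'k::field) jen"
  assumes "group_automorphism P f f'" and f: "\<And>x. x \<in> carrier P \<Longrightarrow> f x = x" and C: "C \<in> carrier (Jen P)"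
  shows "jennings_map f C = C"
proof -
  interpret f: group_automorphism P f f' by fact
  interpret J: k_space "Jen P :: ('k, _) module" by (rule k_space_Jen) (rule f.group_axioms)
  show ?thesis
    using f.group_axioms C
  proof (induction C rule: Jen_induct)
    case (add C r x c)
    have "jennings_map f (jennings_elt P r x) = (jennings_elt P r x :: ('a, 'k) jen)"
      using add.hyps jennings_filtration_subset[of P r, where 'k = 'k]
      by (auto simp: f.jennings_map_elt f subset_eq)
    with add show ?case by (simp add: f.jennings_map_linear)
  qed (simp add: f.jennings_map_zero)
qed

context group_automorphism
begin

lemma jennings_map_cancel:
  assumes "C \<in> carrier (Jen P :: ('k::field, _) module)"
  shows "jennings_map f' (jennings_map f C) = C"
proof -
  interpret id: group_automorphism P "\<lambda>x. x" "\<lambda>x. x"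
    by unfold_locales (auto simp: hom_def)
  have "jennings_map f' (jennings_map f C) = jennings_map (\<lambda>x. x) C"
    using assms inverse_left
    by (rule jennings_map_comp[OF inverse_automorphism group_automorphism_axioms id.group_automorphism_axioms, rotated])
  also have "\<dots> = C"
    using assms by (intro jennings_map_id[OF id.group_automorphism_axioms]) simp_all
  finally show ?thesis .
qed

lemma jennings_map_automorphism:
  assumes "jennings_structure p P br pm" "p > 0"
  shows "restricted_lie_automorphism p (Jen P :: ('k::field, _) module) br pm (jennings_map f) (jennings_map f')"
proof -
  interpret inv: group_automorphism P f' f by (rule inverse_automorphism)
  interpret hom: lie_algebra_hom p "Jen P :: ('k, _) module" br pm "jennings_map f"
    by (rule jennings_map_restricted_lie) fact+
  show ?thesis
    by unfold_locales
       (simp_all add: jennings_map_cancel inv.jennings_map_cancel jennings_map_restricted_lie(2)[OF assms]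
         inv.jennings_map_linear)
qed

end

section \<open>Restricted enveloping algebras\<close>

lemma monoid_words: "Group.monoid (words S)"
  by (rule monoidI) (auto simp: words_def)

lemma words_simps [simp]:
  "carrier (words S) = lists S" "xs \<otimes>\<^bsub>words S\<^esub> ys = xs @ ys" "\<one>\<^bsub>words S\<^esub> = []"
  by (simp_all add: words_def)

lemma k_algebra_free_algebra: "k_algebra (free_algebra S :: ('k::field, _) module)"
  unfolding free_algebra_def by (rule k_algebra_monoid_algebra) (rule monoid_words)

lemma free_algebra_simps [simp]:
  "carrier (free_algebra S :: ('k::field, _) module) = {x. keys x \<subseteq> lists S}"
  "\<zero>\<^bsub>(free_algebra S :: ('k::field, _) module)\<^esub> = 0"
  "x \<oplus>\<^bsub>free_algebra S\<^esub> y = x + y"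
  "c \<odot>\<^bsub>free_algebra S\<^esub> x = scale c x"
  "\<one>\<^bsub>(free_algebra S :: ('k::field, _) module)\<^esub> = single [] 1"
  "single xs b \<otimes>\<^bsub>free_algebra S\<^esub> single ys c = single (xs @ ys) (b * (c :: 'k))"
  by (simp_all add: free_algebra_def)

lemma free_algebra_minus [simp]:
  assumes "keys x \<subseteq> lists S" "keys y \<subseteq> lists S"
  shows "x \<ominus>\<^bsub>free_algebra S\<^esub> y = x - (y :: _ \<Rightarrow>\<^sub>0 'k::field)"
  using assms by (simp add: free_algebra_def monoid_words)

lemma letter_pow:
  "letter x [^]\<^bsub>free_algebra S\<^esub> m = (single (replicate m x) 1 :: _ \<Rightarrow>\<^sub>0 'k::field)"
  by (induction m) (simp_all add: letter_def nat_pow_def replicate_append_same)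

lemma keys_diff_subset:
  "keys x \<subseteq> S \<Longrightarrow> keys y \<subseteq> S \<Longrightarrow> keys (x - y :: _ \<Rightarrow>\<^sub>0 'k::field) \<subseteq> S"
  by (rule order_trans[OF keys_diff]) auto

context restricted_lie_algebra
begin

abbreviation T :: "('k, 'v list \<Rightarrow>\<^sub>0 'k) module" where "T \<equiv> free_algebra (carrier V)"
abbreviation rels where "rels \<equiv> enveloping_relations p V br pm"
abbreviation I where "I \<equiv> enveloping_ideal p V br pm"
abbreviation U where "U \<equiv> restricted_enveloping p V br pm"
abbreviation incl where "incl \<equiv> enveloping_incl p V br pm"

text \<open>Writes the four families of relations with explicit words, so that their images under
  letterwise maps can be computed by simplification.\<close>

lemma enveloping_relations_cases [consumes 1, case_names add smult br pm]:
  assumes "t \<in> rels"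
  obtains x y where "x \<in> carrier V" "y \<in> carrier V"
      "t = single [x \<oplus> y] 1 - (single [x] 1 + single [y] 1)"
  | c x where "x \<in> carrier V" "t = single [c \<odot> x] 1 - single [x] c"
  | x y where "x \<in> carrier V" "y \<in> carrier V"
      "t = single [x, y] 1 - single [y, x] 1 - single [br x y] 1"
  | x where "x \<in> carrier V" "t = single (replicate p x) 1 - single [pm x] 1"
  using assms unfolding enveloping_relations_def Let_def letter_pow by (auto simp: letter_def)

lemma enveloping_relations_intros:
  "x \<in> carrier V \<Longrightarrow> y \<in> carrier V \<Longrightarrow>
    single [x \<oplus> y] 1 - (single [x] 1 + single [y] 1) \<in> rels"
  "x \<in> carrier V \<Longrightarrow> single [c \<odot> x] 1 - single [x] c \<in> rels"
  "x \<in> carrier V \<Longrightarrow> y \<in> carrier V \<Longrightarrow>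
    single [x, y] 1 - single [y, x] 1 - single [br x y] 1 \<in> rels"
  "x \<in> carrier V \<Longrightarrow> single (replicate p x) 1 - single [pm x] 1 \<in> rels"
  unfolding enveloping_relations_def Let_def letter_pow by (auto simp: letter_def)

lemma enveloping_relations_subset: "rels \<subseteq> carrier T"
proof
  interpret k_space V by (rule module_k_space) (rule module_axioms)
  fix t assume "t \<in> rels"
  then show "t \<in> carrier T"
    by (cases rule: enveloping_relations_cases)
       (simp_all add: keys_diff_subset keys_add_subset br_closed pm_closed in_lists_conv_set)
qed

lemma k_ideal_enveloping: "k_ideal I T"
  and enveloping_relations_ideal: "rels \<subseteq> I"
  and enveloping_ideal_minimal: "ideal J T \<Longrightarrow> rels \<subseteq> J \<Longrightarrow> I \<subseteq> J"
proof -
  interpret T: k_algebra T by (rule k_algebra_free_algebra)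
  show "k_ideal I T"
    unfolding enveloping_ideal_def
    by (intro k_ideal.intro T.k_algebra_axioms T.genideal_ideal enveloping_relations_subset)
  show "rels \<subseteq> I" unfolding enveloping_ideal_def by (intro T.genideal_self enveloping_relations_subset)
  show "ideal J T \<Longrightarrow> rels \<subseteq> J \<Longrightarrow> I \<subseteq> J" unfolding enveloping_ideal_def by (rule T.genideal_minimal)
qed

lemma k_algebra_enveloping: "k_algebra U"
  unfolding restricted_enveloping_def by (intro k_ideal.k_algebra_quotient k_ideal_enveloping)

lemma envelopingE:
  assumes "C \<in> carrier U" obtains x where "keys x \<subseteq> lists (carrier V)" "C = I +>\<^bsub>T\<^esub> x"
proof -
  interpret k_ideal I T by (rule k_ideal_enveloping)
  show thesis using assms that unfolding restricted_enveloping_def by (elim quotientE) auto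
qed

lemma enveloping_incl_closed [simp, intro]: "x \<in> carrier V \<Longrightarrow> incl x \<in> carrier U"
proof -
  interpret k_ideal I T by (rule k_ideal_enveloping)
  show "x \<in> carrier V \<Longrightarrow> incl x \<in> carrier U"
    unfolding restricted_enveloping_def enveloping_incl_def letter_def by (intro cls_closed) auto
qed

lemma enveloping_incl_relations:
  assumes "x \<in> carrier V" "y \<in> carrier V"
  shows "incl (x \<oplus> y) = incl x \<oplus>\<^bsub>U\<^esub> incl y"
    and "incl (c \<odot> x) = c \<odot>\<^bsub>U\<^esub> incl x"
    and "incl x \<otimes>\<^bsub>U\<^esub> incl y \<ominus>\<^bsub>U\<^esub> incl y \<otimes>\<^bsub>U\<^esub> incl x = incl (br x y)"
    and "incl x [^]\<^bsub>U\<^esub> p = incl (pm x)"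
proof -
  interpret V: k_space V by (rule module_k_space) (rule module_axioms)
  interpret k_ideal I T by (rule k_ideal_enveloping)
  interpret U: k_algebra U by (rule k_algebra_enveloping)
  let ?s = "\<lambda>xs. single xs 1"
  have U: "U = Q" by (simp add: restricted_enveloping_def)
  have incl: "incl x = cls (?s [x])" for x by (simp add: enveloping_incl_def letter_def)
  have eq: "cls u = cls v" if "u - v \<in> I" "keys u \<subseteq> lists (carrier V)" "keys v \<subseteq> lists (carrier V)" for u v
    using that by (subst cls_eq_iff) auto
  note rel = enveloping_relations_ideal[THEN subsetD, OF enveloping_relations_intros(1)]
    enveloping_relations_ideal[THEN subsetD, OF enveloping_relations_intros(2)]
    enveloping_relations_ideal[THEN subsetD, OF enveloping_relations_intros(3)]
    enveloping_relations_ideal[THEN subsetD, OF enveloping_relations_intros(4)]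
  have add: "cls u \<oplus>\<^bsub>U\<^esub> cls v = cls (u + v)" and mult: "cls u \<otimes>\<^bsub>U\<^esub> cls v = cls (u \<otimes>\<^bsub>T\<^esub> v)"
    if "keys u \<subseteq> lists (carrier V)" "keys v \<subseteq> lists (carrier V)" for u v
    using that quotient_add[of u v] quotient_mult[of u v] by (simp_all add: U)
  have keys2: "keys (?s xs + ?s ys :: _ \<Rightarrow>\<^sub>0 'k) \<subseteq> lists (carrier V)"
    if "xs \<in> lists (carrier V)" "ys \<in> lists (carrier V)" for xs ys
    using that by (intro keys_add_subset) auto
  have "incl (x \<oplus> y) = cls (?s [x] + ?s [y])"
    unfolding incl using assms rel(1)[OF assms] keys2[of "[x]" "[y]"] by (intro eq) auto
  also have "\<dots> = incl x \<oplus>\<^bsub>U\<^esub> incl y" unfolding incl using assms by (intro add[symmetric]) auto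
  finally show "incl (x \<oplus> y) = incl x \<oplus>\<^bsub>U\<^esub> incl y" .
  have "incl (c \<odot> x) = cls (single [x] c)"
    unfolding incl using assms rel(2)[OF assms(1), of c] by (intro eq) auto
  also have "\<dots> = c \<odot>\<^bsub>U\<^esub> incl x" unfolding incl U using assms quotient_smult[of "?s [x]" c] by simp
  finally show "incl (c \<odot> x) = c \<odot>\<^bsub>U\<^esub> incl x" .
  have "incl x \<otimes>\<^bsub>U\<^esub> incl y = cls (?s [x, y])" "incl y \<otimes>\<^bsub>U\<^esub> incl x = cls (?s [y, x])"
    unfolding incl using assms by (simp_all add: mult)
  \<comment> \<open>The bracket relation is used in the additive form
    \<open>x y = [x, y] + y x\<close>, so that a difference of cosets has to be formed only at the
    very end.\<close>
  moreover have "cls (?s [x, y]) = cls (?s [br x y] + ?s [y, x])"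
    using rel(3)[OF assms] assms keys2[of "[br x y]" "[y, x]"] by (intro eq) (auto simp: br_closed algebra_simps)
  moreover have "cls (?s [br x y] + ?s [y, x]) = incl (br x y) \<oplus>\<^bsub>U\<^esub> cls (?s [y, x])"
    unfolding incl using assms by (intro add[symmetric]) (auto simp: br_closed)
  moreover have "cls (?s [y, x]) \<in> carrier U" unfolding U using assms by (intro cls_closed) auto
  ultimately show "incl x \<otimes>\<^bsub>U\<^esub> incl y \<ominus>\<^bsub>U\<^esub> incl y \<otimes>\<^bsub>U\<^esub> incl x = incl (br x y)"
    using assms by (simp add: br_closed a_minus_def U.a_assoc U.r_neg)
  have "incl x [^]\<^bsub>U\<^esub> m = cls (?s (replicate m x))" for m :: nat
  proof (induction m)
    case 0
    then show ?case by (simp add: U quotient_one)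
  next
    case (Suc m)
    have "replicate m x \<in> lists (carrier V)" using assms by (auto simp: in_lists_conv_set)
    with Suc show ?case using assms by (simp add: incl mult replicate_append_same)
  qed
  moreover have "cls (?s (replicate p x)) = incl (pm x)"
    unfolding incl using assms rel(4)[OF assms(1)] by (intro eq) (auto simp: pm_closed)
  ultimately show "incl x [^]\<^bsub>U\<^esub> p = incl (pm x)" by simp
qed

end

context restricted_lie_automorphism
begin

lemma pushforward_map_keys:
  "keys x \<subseteq> lists (carrier V) \<Longrightarrow> keys (pushforward (map a) x) \<subseteq> lists (carrier V)"
  by (erule keys_pushforward_subset) auto

lemma pushforward_map_mult:
  assumes "keys x \<subseteq> lists (carrier V)" "keys y \<subseteq> lists (carrier V)"
  shows "pushforward (map a) (x \<otimes>\<^bsub>T\<^esub> y) = pushforward (map a) x \<otimes>\<^bsub>T\<^esub> pushforward (map a) y"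
  unfolding free_algebra_def using assms by (intro pushforward_mult) auto

text \<open>The preimage of \<open>I\<close> is an ideal and contains the relations, because each
  relation is carried to a relation of the same family; for the one on p-th powers this is
  \<open>hom_pm\<close>. Minimality of \<open>I\<close> concludes.\<close>

lemma enveloping_ideal_closed:
  assumes "x \<in> I" shows "pushforward (map a) x \<in> I"
proof -
  interpret V: k_space V by (rule module_k_space) (rule module_axioms)
  interpret k_ideal I T by (rule k_ideal_enveloping)
  let ?N = "{x \<in> carrier T. pushforward (map a) x \<in> I}"
  have "ideal ?N T"
  proof (rule idealI)
    show "ring T" by (rule ring_axioms)
    show "subgroup ?N (add_monoid T)"
    proof (rule add.subgroupI)
      show "?N \<noteq> {}" using additive_subgroup.zero_closed[OF additive_subgroup_axioms] by (auto intro!: exI[of _ 0])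
    next
      fix x assume x: "x \<in> ?N"
      then have "(-1) \<odot>\<^bsub>T\<^esub> pushforward (map a) x \<in> I" by (intro smult_mem) auto
      moreover have "\<ominus>\<^bsub>T\<^esub> x = scale (-1) x" using x smult_minus_one[of x] by simp
      ultimately show "\<ominus>\<^bsub>T\<^esub> x \<in> ?N"
        using x keys_scale[of "-1" x] by (simp add: pushforward_scale subset_trans)
    next
      fix x y assume "x \<in> ?N" "y \<in> ?N"
      then show "x \<oplus>\<^bsub>T\<^esub> y \<in> ?N"
        using a_closed[of "pushforward (map a) x" "pushforward (map a) y"]
        by (simp add: pushforward_add keys_add_subset)
    qed auto
  next
    fix x y assume "x \<in> ?N" "y \<in> carrier T"
    then show "y \<otimes>\<^bsub>T\<^esub> x \<in> ?N" "x \<otimes>\<^bsub>T\<^esub> y \<in> ?N"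
      using m_closed[of y x] m_closed[of x y] pushforward_map_keys[of y]
        I_l_closed[of "pushforward (map a) x" "pushforward (map a) y"]
        I_r_closed[of "pushforward (map a) x" "pushforward (map a) y"]
      by (auto simp: pushforward_map_mult)
  qed
  moreover have "rels \<subseteq> ?N"
  proof
    fix t assume t: "t \<in> rels"
    then have "pushforward (map a) t \<in> rels"
    proof (cases rule: enveloping_relations_cases)
      case (add x y)
      then show ?thesis
        using enveloping_relations_intros(1)[of "a x" "a y"] by (simp add: pushforward_diff pushforward_add hom_add)
    next
      case (smult c x)
      then show ?thesis
        using enveloping_relations_intros(2)[of "a x" c] by (simp add: pushforward_diff hom_smult)
    next
      case (br x y)
      then show ?thesis
        using enveloping_relations_intros(3)[of "a x" "a y"] by (simp add: pushforward_diff hom_br)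
    next
      case (pm x)
      then show ?thesis
        using enveloping_relations_intros(4)[of "a x"] by (simp add: pushforward_diff hom_pm)
    qed
    then show "t \<in> ?N" using t enveloping_relations_subset enveloping_relations_ideal by auto
  qed
  ultimately have "I \<subseteq> ?N" by (rule enveloping_ideal_minimal)
  then show ?thesis using assms by auto
qed

lemma image_enveloping_ideal: "pushforward (map a) ` I = I"
proof -
  interpret inv: restricted_lie_automorphism p V br pm a' a by (rule inverse_automorphism)
  interpret k_ideal I T by (rule k_ideal_enveloping)
  have "x \<in> pushforward (map a) ` I" if x: "x \<in> I" for x
  proof -
    have "pushforward (map a) (pushforward (map a') x) = pushforward id x"
    proof (rule pushforward_comp)
      fix xs assume "xs \<in> keys x"
      then have "xs \<in> lists (carrier V)" using x a_subset by auto
      then show "map a (map a' xs) = id xs" by (induction xs) auto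
    qed
    then show ?thesis
      using inv.enveloping_ideal_closed[OF x]
      by (intro image_eqI[of _ _ "pushforward (map a') x"]) (simp_all add: pushforward_id)
  qed
  then show ?thesis using enveloping_ideal_closed by auto
qed

lemma enveloping_map_coset:
  "enveloping_map a (I +>\<^bsub>T\<^esub> x) = I +>\<^bsub>T\<^esub> pushforward (map a) x"
proof -
  have coset: "S +>\<^bsub>T\<^esub> x = (\<lambda>y. y + x) ` S" for S x by (auto simp: a_r_coset_def r_coset_def)
  have "enveloping_map a (I +>\<^bsub>T\<^esub> x) = (\<lambda>y. y + pushforward (map a) x) ` (pushforward (map a) ` I)"
    by (simp add: enveloping_map_def coset image_image pushforward_add)
  then show ?thesis by (simp add: image_enveloping_ideal coset)
qed

lemma enveloping_map_incl: "enveloping_map a (incl x) = incl (a x)"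
  by (simp add: enveloping_incl_def enveloping_map_coset letter_def)

lemma enveloping_map_hom:
  assumes "u \<in> carrier U" "v \<in> carrier U"
  shows "enveloping_map a u \<in> carrier U"
    and "enveloping_map a (u \<oplus>\<^bsub>U\<^esub> v) = enveloping_map a u \<oplus>\<^bsub>U\<^esub> enveloping_map a v"
    and "enveloping_map a (u \<otimes>\<^bsub>U\<^esub> v) = enveloping_map a u \<otimes>\<^bsub>U\<^esub> enveloping_map a v"
    and "enveloping_map a (c \<odot>\<^bsub>U\<^esub> u) = c \<odot>\<^bsub>U\<^esub> enveloping_map a u"
    and "enveloping_map a \<one>\<^bsub>U\<^esub> = \<one>\<^bsub>U\<^esub>"
proof -
  interpret k_ideal I T by (rule k_ideal_enveloping)
  have U: "U = Q" by (simp add: restricted_enveloping_def)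
  obtain x where x: "keys x \<subseteq> lists (carrier V)" "u = cls x" using assms(1) by (rule envelopingE)
  obtain y where y: "keys y \<subseteq> lists (carrier V)" "v = cls y" using assms(2) by (rule envelopingE)
  note closed = pushforward_map_keys[OF x(1)] pushforward_map_keys[OF y(1)]
  show "enveloping_map a u \<in> carrier U"
    unfolding x enveloping_map_coset U using closed by (intro cls_closed) simp
  show "enveloping_map a (u \<oplus>\<^bsub>U\<^esub> v) = enveloping_map a u \<oplus>\<^bsub>U\<^esub> enveloping_map a v"
    using x y closed quotient_add[of x y] quotient_add[of "pushforward (map a) x" "pushforward (map a) y"]
    by (simp add: U enveloping_map_coset pushforward_add)
  show "enveloping_map a (u \<otimes>\<^bsub>U\<^esub> v) = enveloping_map a u \<otimes>\<^bsub>U\<^esub> enveloping_map a v"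
    using x y closed quotient_mult[of x y] quotient_mult[of "pushforward (map a) x" "pushforward (map a) y"]
    by (simp add: U enveloping_map_coset pushforward_map_mult)
  show "enveloping_map a (c \<odot>\<^bsub>U\<^esub> u) = c \<odot>\<^bsub>U\<^esub> enveloping_map a u"
    using x closed quotient_smult[of x c] quotient_smult[of "pushforward (map a) x" c]
    by (simp add: U enveloping_map_coset pushforward_scale)
  show "enveloping_map a \<one>\<^bsub>U\<^esub> = \<one>\<^bsub>U\<^esub>"
    by (simp add: U quotient_one enveloping_map_coset)
qed

end

lemma (in restricted_lie_algebra) enveloping_map_comp:
  assumes "restricted_lie_automorphism p V br pm a a'" "restricted_lie_automorphism p V br pm b b'"
    "restricted_lie_automorphism p V br pm c c'"
    and abc: "\<And>x. x \<in> carrier V \<Longrightarrow> a (b x) = c x" and u: "u \<in> carrier U"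
  shows "enveloping_map a (enveloping_map b u) = enveloping_map c u"
proof -
  interpret a: restricted_lie_automorphism p V br pm a a' by fact
  interpret b: restricted_lie_automorphism p V br pm b b' by fact
  interpret c: restricted_lie_automorphism p V br pm c c' by fact
  obtain x where x: "keys x \<subseteq> lists (carrier V)" "u = I +>\<^bsub>T\<^esub> x" using u by (rule envelopingE)
  have "pushforward (map a) (pushforward (map b) x) = pushforward (map c) x"
    using x(1) abc by (intro pushforward_comp) (auto simp: in_lists_conv_set)
  then show ?thesis by (simp add: x a.enveloping_map_coset b.enveloping_map_coset c.enveloping_map_coset)
qed

lemma (in restricted_lie_algebra) enveloping_map_id:
  assumes "restricted_lie_automorphism p V br pm a a'"
    and "\<And>x. x \<in> carrier V \<Longrightarrow> a x = x" and u: "u \<in> carrier U"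
  shows "enveloping_map a u = u"
proof -
  interpret a: restricted_lie_automorphism p V br pm a a' by fact
  obtain x where x: "keys x \<subseteq> lists (carrier V)" "u = I +>\<^bsub>T\<^esub> x" using u by (rule envelopingE)
  have "pushforward (map a) x = x"
    using x(1) assms(2) by (intro pushforward_id) (auto simp: in_lists_conv_set intro!: map_idI)
  then show ?thesis by (simp add: x a.enveloping_map_coset)
qed

section \<open>Skew group algebras\<close>

lemma (in abelian_monoid) finsum_swap:
  assumes "finite I" "finite J" "\<And>i j. i \<in> I \<Longrightarrow> j \<in> J \<Longrightarrow> F i j \<in> carrier G"
  shows "(\<Oplus>i\<in>I. \<Oplus>j\<in>J. F i j) = (\<Oplus>j\<in>J. \<Oplus>i\<in>I. F i j)"
  using assms(1,3)
proof (induction I rule: finite_induct)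
  case (insert i I)
  have "(\<Oplus>i\<in>insert i I. \<Oplus>j\<in>J. F i j) = (\<Oplus>j\<in>J. F i j) \<oplus> (\<Oplus>j\<in>J. \<Oplus>i\<in>I. F i j)"
    using insert by (subst finsum_insert) (auto intro!: finsum_closed)
  also have "\<dots> = (\<Oplus>j\<in>J. F i j \<oplus> (\<Oplus>i\<in>I. F i j))"
    using insert by (intro finsum_addf[symmetric]) (auto intro!: finsum_closed)
  also have "\<dots> = (\<Oplus>j\<in>J. \<Oplus>i\<in>insert i I. F i j)"
    using insert by (intro finsum_cong') (auto intro!: finsum_closed)
  finally show ?case .
qed simp

locale algebra_action = k_algebra U + H: group H
  for U :: "('k::field, 'u) module" (structure) and H :: "'h monoid" and act :: "'h \<Rightarrow> 'u \<Rightarrow> 'u" +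
  assumes finite_H: "finite (carrier H)"
    and act_closed [simp]: "h \<in> carrier H \<Longrightarrow> u \<in> carrier U \<Longrightarrow> act h u \<in> carrier U"
    and act_add: "h \<in> carrier H \<Longrightarrow> u \<in> carrier U \<Longrightarrow> v \<in> carrier U \<Longrightarrow> act h (u \<oplus> v) = act h u \<oplus> act h v"
    and act_mult: "h \<in> carrier H \<Longrightarrow> u \<in> carrier U \<Longrightarrow> v \<in> carrier U \<Longrightarrow> act h (u \<otimes> v) = act h u \<otimes> act h v"
    and act_smult: "h \<in> carrier H \<Longrightarrow> u \<in> carrier U \<Longrightarrow> act h (c \<odot> u) = c \<odot> act h u"
    and act_one_right: "h \<in> carrier H \<Longrightarrow> act h \<one> = \<one>"
    and act_comp: "h \<in> carrier H \<Longrightarrow> h' \<in> carrier H \<Longrightarrow> u \<in> carrier U \<Longrightarrow> act (h \<otimes>\<^bsub>H\<^esub> h') u = act h (act h' u)"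
    and act_one_left: "u \<in> carrier U \<Longrightarrow> act \<one>\<^bsub>H\<^esub> u = u"
begin

abbreviation A where "A \<equiv> skew_group_algebra U H act"
abbreviation mono where "mono \<equiv> skew_monomial U H"

lemma skew_simps:
  "carrier A = carrier H \<rightarrow>\<^sub>E carrier U"
  "x \<otimes>\<^bsub>A\<^esub> y = (\<lambda>g\<in>carrier H. \<Oplus>h\<in>carrier H. x h \<otimes> act h (y (inv\<^bsub>H\<^esub> h \<otimes>\<^bsub>H\<^esub> g)))"
  "\<one>\<^bsub>A\<^esub> = mono \<one> \<one>\<^bsub>H\<^esub>"
  "\<zero>\<^bsub>A\<^esub> = (\<lambda>g\<in>carrier H. \<zero>)"
  "x \<oplus>\<^bsub>A\<^esub> y = (\<lambda>g\<in>carrier H. x g \<oplus> y g)"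
  "c \<odot>\<^bsub>A\<^esub> x = (\<lambda>g\<in>carrier H. c \<odot> x g)"
  by (simp_all add: skew_group_algebra_def skew_monomial_def)

lemma act_zero: "h \<in> carrier H \<Longrightarrow> act h \<zero> = \<zero>"
  using act_smult[of h \<zero> 0] by simp

lemma act_finsum:
  assumes "h \<in> carrier H" "finite I" "\<And>i. i \<in> I \<Longrightarrow> f i \<in> carrier U"
  shows "act h (\<Oplus>i\<in>I. f i) = (\<Oplus>i\<in>I. act h (f i))"
  using assms(2,3)
proof (induction I rule: finite_induct)
  case (insert i I)
  then have "f \<in> I \<rightarrow> carrier U" "(\<lambda>i. act h (f i)) \<in> I \<rightarrow> carrier U" using assms(1) by auto
  with insert assms(1) show ?case by (simp add: act_add)
qed (simp add: act_zero assms(1))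

lemma skew_apply_closed: "x \<in> carrier A \<Longrightarrow> h \<in> carrier H \<Longrightarrow> x h \<in> carrier U"
  by (auto simp: skew_simps)

lemma skew_eqI: "x \<in> carrier A \<Longrightarrow> y \<in> carrier A \<Longrightarrow> (\<And>h. h \<in> carrier H \<Longrightarrow> x h = y h) \<Longrightarrow> x = y"
  by (auto simp: skew_simps intro: PiE_ext)

lemma skew_mult_closed: "x \<in> carrier A \<Longrightarrow> y \<in> carrier A \<Longrightarrow> x \<otimes>\<^bsub>A\<^esub> y \<in> carrier A"
  using skew_apply_closed[of x] skew_apply_closed[of y]
  unfolding skew_simps(1)[symmetric] by (auto simp: skew_simps(1,2) intro!: finsum_closed)

text \<open>At \<open>g\<close> both sides are double sums over \<open>H\<close>. For fixed
  \<open>a\<close>, the substitution of \<open>a b\<close> for \<open>h\<close> permutes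
  \<open>H\<close>, and then the two sums agree termwise by \<open>act_mult\<close> and
  \<open>act_comp\<close>.\<close>

lemma skew_assoc:
  assumes x: "x \<in> carrier A" and y: "y \<in> carrier A" and z: "z \<in> carrier A"
  shows "x \<otimes>\<^bsub>A\<^esub> y \<otimes>\<^bsub>A\<^esub> z = x \<otimes>\<^bsub>A\<^esub> (y \<otimes>\<^bsub>A\<^esub> z)"
proof (rule skew_eqI)
  fix g assume g: "g \<in> carrier H"
  note cl = skew_apply_closed[OF x] skew_apply_closed[OF y] skew_apply_closed[OF z]
  let ?F = "\<lambda>h a. (x a \<otimes> act a (y (inv\<^bsub>H\<^esub> a \<otimes>\<^bsub>H\<^esub> h))) \<otimes> act h (z (inv\<^bsub>H\<^esub> h \<otimes>\<^bsub>H\<^esub> g))"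
  let ?G = "\<lambda>a b. x a \<otimes> act a (y b \<otimes> act b (z (inv\<^bsub>H\<^esub> b \<otimes>\<^bsub>H\<^esub> (inv\<^bsub>H\<^esub> a \<otimes>\<^bsub>H\<^esub> g))))"
  have "(x \<otimes>\<^bsub>A\<^esub> y \<otimes>\<^bsub>A\<^esub> z) g = (\<Oplus>h\<in>carrier H. \<Oplus>a\<in>carrier H. ?F h a)"
    unfolding skew_simps using g cl finite_H
    by (auto intro!: finsum_cong' finsum_ldistr)
  also have "\<dots> = (\<Oplus>a\<in>carrier H. \<Oplus>h\<in>carrier H. ?F h a)"
    using g cl finite_H by (intro finsum_swap) auto
  also have "\<dots> = (\<Oplus>a\<in>carrier H. \<Oplus>b\<in>carrier H. ?G a b)"
  proof (rule finsum_cong')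
    fix a assume a: "a \<in> carrier H"
    have inj: "inj_on ((\<otimes>\<^bsub>H\<^esub>) a) (carrier H)" using a by (auto simp: inj_on_def)
    have img: "(\<otimes>\<^bsub>H\<^esub>) a ` carrier H = carrier H" using a by (rule H.surj_const_mult)
    have "(\<Oplus>h\<in>carrier H. ?F h a) = (\<Oplus>b\<in>carrier H. ?F (a \<otimes>\<^bsub>H\<^esub> b) a)"
      using finsum_reindex[OF _ inj, of "\<lambda>h. ?F h a"] img a g cl by auto
    also have "\<dots> = (\<Oplus>b\<in>carrier H. ?G a b)"
    proof (rule finsum_cong')
      fix b assume b: "b \<in> carrier H"
      have "inv\<^bsub>H\<^esub> a \<otimes>\<^bsub>H\<^esub> (a \<otimes>\<^bsub>H\<^esub> b) = b" "inv\<^bsub>H\<^esub> (a \<otimes>\<^bsub>H\<^esub> b) \<otimes>\<^bsub>H\<^esub> g = inv\<^bsub>H\<^esub> b \<otimes>\<^bsub>H\<^esub> (inv\<^bsub>H\<^esub> a \<otimes>\<^bsub>H\<^esub> g)"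
        using a b g by (simp_all add: H.inv_mult_group H.m_assoc flip: H.m_assoc[of "inv\<^bsub>H\<^esub> a" a b])
      then show "?F (a \<otimes>\<^bsub>H\<^esub> b) a = ?G a b"
        using a b g cl by (simp add: act_mult act_comp m_assoc)
    qed (use a g cl in auto)
    finally show "(\<Oplus>h\<in>carrier H. ?F h a) = (\<Oplus>b\<in>carrier H. ?G a b)" .
  qed (use g cl in \<open>auto intro!: finsum_closed\<close>)
  also have "\<dots> = (x \<otimes>\<^bsub>A\<^esub> (y \<otimes>\<^bsub>A\<^esub> z)) g"
    unfolding skew_simps using g cl finite_H
    by (auto intro!: finsum_cong' simp: act_finsum finsum_rdistr Pi_def)
  finally show "(x \<otimes>\<^bsub>A\<^esub> y \<otimes>\<^bsub>A\<^esub> z) g = (x \<otimes>\<^bsub>A\<^esub> (y \<otimes>\<^bsub>A\<^esub> z)) g" .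
qed (use assms in \<open>auto intro!: skew_mult_closed\<close>)

lemma mono_closed [simp]: "u \<in> carrier U \<Longrightarrow> h \<in> carrier H \<Longrightarrow> mono u h \<in> carrier A"
  by (auto simp: skew_simps skew_monomial_def)

lemma mono_mult_apply:
  assumes "u \<in> carrier U" "h \<in> carrier H" "y \<in> carrier A" "g \<in> carrier H"
  shows "(mono u h \<otimes>\<^bsub>A\<^esub> y) g = u \<otimes> act h (y (inv\<^bsub>H\<^esub> h \<otimes>\<^bsub>H\<^esub> g))"
proof -
  have "(mono u h \<otimes>\<^bsub>A\<^esub> y) g = (\<Oplus>a\<in>carrier H. if a = h then u \<otimes> act a (y (inv\<^bsub>H\<^esub> a \<otimes>\<^bsub>H\<^esub> g)) else \<zero>)"
    unfolding skew_simps using assms skew_apply_closed[OF assms(3)]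
    by (auto intro!: finsum_cong' simp: skew_monomial_def)
  also have "\<dots> = u \<otimes> act h (y (inv\<^bsub>H\<^esub> h \<otimes>\<^bsub>H\<^esub> g))"
    using assms finite_H skew_apply_closed[OF assms(3)] by (subst add.finprod_singleton_swap) auto
  finally show ?thesis .
qed

lemma mono_mult:
  assumes "u \<in> carrier U" "v \<in> carrier U" "h \<in> carrier H" "h' \<in> carrier H"
  shows "mono u h \<otimes>\<^bsub>A\<^esub> mono v h' = mono (u \<otimes> act h v) (h \<otimes>\<^bsub>H\<^esub> h')"
proof (rule skew_eqI)
  fix g assume g: "g \<in> carrier H"
  then have "inv\<^bsub>H\<^esub> h \<otimes>\<^bsub>H\<^esub> g = h' \<longleftrightarrow> g = h \<otimes>\<^bsub>H\<^esub> h'"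
    using assms by (metis H.inv_solve_left)
  then show "(mono u h \<otimes>\<^bsub>A\<^esub> mono v h') g = mono (u \<otimes> act h v) (h \<otimes>\<^bsub>H\<^esub> h') g"
    using assms g by (simp add: mono_mult_apply) (simp add: skew_monomial_def act_zero)
qed (use assms in \<open>auto intro!: skew_mult_closed\<close>)

lemma k_algebra_skew: "k_algebra A"
proof -
  have A: "abelian_group A"
  proof (rule abelian_groupI)
    fix x assume x: "x \<in> carrier A"
    then show "\<exists>y\<in>carrier A. y \<oplus>\<^bsub>A\<^esub> x = \<zero>\<^bsub>A\<^esub>"
      using skew_apply_closed[OF x]
      by (intro bexI[of _ "\<lambda>g\<in>carrier H. \<ominus> x g"]) (auto simp: skew_simps l_neg intro!: restrict_ext)
  qed (auto simp: skew_simps fun_eq_iff a_ac extensional_def PiE_def Pi_iff)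
  have one: "\<one>\<^bsub>A\<^esub> \<otimes>\<^bsub>A\<^esub> x = x" "x \<otimes>\<^bsub>A\<^esub> \<one>\<^bsub>A\<^esub> = x" if x: "x \<in> carrier A" for x
  proof -
    have one_closed: "\<one>\<^bsub>A\<^esub> \<in> carrier A" by (simp add: skew_simps(3))
    show "\<one>\<^bsub>A\<^esub> \<otimes>\<^bsub>A\<^esub> x = x"
      using x skew_apply_closed[OF x] one_closed
      by (intro skew_eqI skew_mult_closed) (auto simp: skew_simps(3) mono_mult_apply act_one_left)
    show "x \<otimes>\<^bsub>A\<^esub> \<one>\<^bsub>A\<^esub> = x"
    proof (rule skew_eqI)
      fix g assume g: "g \<in> carrier H"
      have "inv\<^bsub>H\<^esub> h \<otimes>\<^bsub>H\<^esub> g = \<one>\<^bsub>H\<^esub> \<longleftrightarrow> h = g" if "h \<in> carrier H" for h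
        using g that by (metis H.inv_solve_left H.one_closed H.r_one)
      then have "(x \<otimes>\<^bsub>A\<^esub> \<one>\<^bsub>A\<^esub>) g = (\<Oplus>h\<in>carrier H. if h = g then x h else \<zero>)"
        unfolding skew_simps using g skew_apply_closed[OF x]
        by (auto intro!: finsum_cong' simp: skew_monomial_def act_one_right act_zero)
      then show "(x \<otimes>\<^bsub>A\<^esub> \<one>\<^bsub>A\<^esub>) g = x g"
        using g finite_H skew_apply_closed[OF x] by (simp add: add.finprod_singleton_swap Pi_def)
    qed (use x one_closed in \<open>auto intro!: skew_mult_closed\<close>)
  qed
  have "ring A"
  proof (rule ringI[OF A])
    show "Group.monoid A"
      using one by (intro monoidI) (auto simp: skew_assoc skew_mult_closed skew_simps(3))
    fix x y z assume xyz: "x \<in> carrier A" "y \<in> carrier A" "z \<in> carrier A"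
    note cl = xyz[THEN skew_apply_closed]
    have "(x \<oplus>\<^bsub>A\<^esub> y) \<otimes>\<^bsub>A\<^esub> z = (\<lambda>g\<in>carrier H. \<Oplus>h\<in>carrier H. x h \<otimes> act h (z (inv\<^bsub>H\<^esub> h \<otimes>\<^bsub>H\<^esub> g)) \<oplus> y h \<otimes> act h (z (inv\<^bsub>H\<^esub> h \<otimes>\<^bsub>H\<^esub> g)))"
      unfolding skew_simps using cl by (intro restrict_ext finsum_cong') (auto simp: l_distr)
    then show "(x \<oplus>\<^bsub>A\<^esub> y) \<otimes>\<^bsub>A\<^esub> z = x \<otimes>\<^bsub>A\<^esub> z \<oplus>\<^bsub>A\<^esub> y \<otimes>\<^bsub>A\<^esub> z"
      using cl by (simp add: skew_simps finsum_addf Pi_def cong: restrict_cong)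
    have "z \<otimes>\<^bsub>A\<^esub> (x \<oplus>\<^bsub>A\<^esub> y) = (\<lambda>g\<in>carrier H. \<Oplus>h\<in>carrier H. z h \<otimes> act h (x (inv\<^bsub>H\<^esub> h \<otimes>\<^bsub>H\<^esub> g)) \<oplus> z h \<otimes> act h (y (inv\<^bsub>H\<^esub> h \<otimes>\<^bsub>H\<^esub> g)))"
      unfolding skew_simps using cl by (intro restrict_ext finsum_cong') (auto simp: act_add r_distr)
    then show "z \<otimes>\<^bsub>A\<^esub> (x \<oplus>\<^bsub>A\<^esub> y) = z \<otimes>\<^bsub>A\<^esub> x \<oplus>\<^bsub>A\<^esub> z \<otimes>\<^bsub>A\<^esub> y"
      using cl by (simp add: skew_simps finsum_addf Pi_def cong: restrict_cong)
  qed
  moreover have "k_space A"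
    using A by (intro k_space.intro k_space_axioms.intro)
      (auto simp: skew_simps smult_l_distr smult_r_distr smult_assoc fun_eq_iff extensional_def PiE_def Pi_iff)
  moreover have "(c \<odot>\<^bsub>A\<^esub> x) \<otimes>\<^bsub>A\<^esub> y = c \<odot>\<^bsub>A\<^esub> (x \<otimes>\<^bsub>A\<^esub> y)" "x \<otimes>\<^bsub>A\<^esub> (c \<odot>\<^bsub>A\<^esub> y) = c \<odot>\<^bsub>A\<^esub> (x \<otimes>\<^bsub>A\<^esub> y)"
    if xy: "x \<in> carrier A" "y \<in> carrier A" for x y and c :: 'k
  proof -
    note cl = xy[THEN skew_apply_closed]
    show "(c \<odot>\<^bsub>A\<^esub> x) \<otimes>\<^bsub>A\<^esub> y = c \<odot>\<^bsub>A\<^esub> (x \<otimes>\<^bsub>A\<^esub> y)" "x \<otimes>\<^bsub>A\<^esub> (c \<odot>\<^bsub>A\<^esub> y) = c \<odot>\<^bsub>A\<^esub> (x \<otimes>\<^bsub>A\<^esub> y)"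
      unfolding skew_simps using cl finite_H
      by (auto intro!: restrict_ext finsum_cong' simp: smult_finsum smult_mult_left smult_mult_right act_smult)
  qed
  ultimately show ?thesis by (intro k_algebra.intro k_algebra_axioms.intro)
qed

end

section \<open>Relations in an algebra containing a group\<close>

lemma characters_simps:
  assumes "group H" "\<psi> \<in> characters (H :: 'h monoid)" "g \<in> carrier H" "h \<in> carrier H"
  shows "\<psi> (g \<otimes>\<^bsub>H\<^esub> h) = \<psi> g * \<psi> h" "\<psi> g \<noteq> (0 :: 'k::field)" "\<psi> \<one>\<^bsub>H\<^esub> = 1" "\<psi> (inv\<^bsub>H\<^esub> g) = inverse (\<psi> g)"
proof -
  interpret group H by fact
  have hom: "\<psi> \<in> hom H (field_units :: 'k monoid)" using assms(2) by (simp add: characters_def)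
  have mult: "\<psi> (g \<otimes>\<^bsub>H\<^esub> h) = \<psi> g * \<psi> h" if "g \<in> carrier H" "h \<in> carrier H" for g h
    using hom_mult[OF hom that] by (simp add: ring_of_type_algebra_def)
  then show "\<psi> (g \<otimes>\<^bsub>H\<^esub> h) = \<psi> g * \<psi> h" using assms by simp
  have nz: "\<psi> g \<noteq> 0" if "g \<in> carrier H" for g
    using hom_in_carrier[OF hom that] by (simp add: ring_of_type_algebra_def)
  then show "\<psi> g \<noteq> 0" using assms by simp
  show one: "\<psi> \<one>\<^bsub>H\<^esub> = 1" using mult[of "\<one>\<^bsub>H\<^esub>" "\<one>\<^bsub>H\<^esub>"] nz[of "\<one>\<^bsub>H\<^esub>"] by simp
  show "\<psi> (inv\<^bsub>H\<^esub> g) = inverse (\<psi> g)"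
    using mult[of "inv\<^bsub>H\<^esub> g" g] assms one by (simp add: field_simps nz)
qed

lemma (in group) center_subset: "group_center G \<subseteq> carrier G"
  unfolding group_center_def by blast

lemma (in group) center_comm: "z \<in> group_center G \<Longrightarrow> g \<in> carrier G \<Longrightarrow> z \<otimes> g = g \<otimes> z"
  unfolding group_center_def by blast

lemma (in group) centerI:
  "z \<in> carrier G \<Longrightarrow> (\<And>g. g \<in> carrier G \<Longrightarrow> z \<otimes> g = g \<otimes> z) \<Longrightarrow> z \<in> group_center G"
  unfolding group_center_def by blast

lemma (in group) subgroup_center: "subgroup (group_center G) G"
proof (rule subgroupI)
  show "group_center G \<subseteq> carrier G" by (rule center_subset)
  show "group_center G \<noteq> {}" using centerI[of \<one>] by auto
next
  fix a assume a: "a \<in> group_center G"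
  have "inv a \<otimes> g = g \<otimes> inv a" if g: "g \<in> carrier G" for g
  proof -
    have a': "a \<in> carrier G" "a \<otimes> g = g \<otimes> a" using a g center_subset center_comm by auto
    have "inv a \<otimes> g = inv a \<otimes> (g \<otimes> a) \<otimes> inv a" using a'(1) g by (simp add: m_assoc)
    also have "\<dots> = inv a \<otimes> (a \<otimes> g) \<otimes> inv a" by (simp only: a'(2))
    also have "\<dots> = g \<otimes> inv a" using a'(1) g by (simp flip: m_assoc)
    finally show ?thesis .
  qed
  then show "inv a \<in> group_center G" using a center_subset by (intro centerI) auto
next
  fix a b assume ab: "a \<in> group_center G" "b \<in> group_center G"
  then have ab': "a \<in> carrier G" "b \<in> carrier G" using center_subset by auto
  have "a \<otimes> b \<otimes> g = g \<otimes> (a \<otimes> b)" if g: "g \<in> carrier G" for g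
  proof -
    have "a \<otimes> b \<otimes> g = a \<otimes> (b \<otimes> g)" using ab' g by (rule m_assoc)
    also have "b \<otimes> g = g \<otimes> b" using ab(2) g by (rule center_comm)
    also have "a \<otimes> (g \<otimes> b) = (a \<otimes> g) \<otimes> b" using ab' g by (simp add: m_assoc)
    also have "a \<otimes> g = g \<otimes> a" using ab(1) g by (rule center_comm)
    also have "(g \<otimes> a) \<otimes> b = g \<otimes> (a \<otimes> b)" using ab' g by (simp add: m_assoc)
    finally show ?thesis .
  qed
  then show "a \<otimes> b \<in> group_center G" using ab' by (intro centerI) auto
qed

text \<open>The calculations with group elements, eigenvectors and idempotents use only an algebra
  and a multiplicative map from \<open>H\<close> into it. Working at this level keeps the function
  representation of the skew group algebra out of sight.\<close>

locale group_in_algebra = k_algebra A + H: group H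
  for A :: "('k::field, 'v) module" (structure) and H :: "'h monoid" +
  fixes G :: "'h \<Rightarrow> 'v"
  assumes finite_H: "finite (carrier H)"
    and G_closed [simp]: "h \<in> carrier H \<Longrightarrow> G h \<in> carrier A"
    and G_mult: "g \<in> carrier H \<Longrightarrow> h \<in> carrier H \<Longrightarrow> G (g \<otimes>\<^bsub>H\<^esub> h) = G g \<otimes> G h"
begin

text \<open>Abstract form of \<open>char_idempotent\<close>; it will be \<open>e\<close> for the
  commutator subgroup with \<chi>, and \<open>e\<^sub>\<phi>\<close> for the centre with
  \<phi>.\<close>

definition idem :: "'h set \<Rightarrow> ('h \<Rightarrow> 'k) \<Rightarrow> 'v" where
  "idem S \<phi> = inverse (of_nat (card S)) \<odot> (\<Oplus>h\<in>S. \<phi> (inv\<^bsub>H\<^esub> h) \<odot> G h)"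

text \<open>The conjugation rule is stated without inverses in the algebra. Nonvanishing of \<psi>
  is included so that it can also be solved for \<open>w \<otimes> G h\<close>.\<close>

definition eigen :: "'v \<Rightarrow> ('h \<Rightarrow> 'k) \<Rightarrow> bool" where
  "eigen w \<psi> \<longleftrightarrow> w \<in> carrier A \<and> (\<forall>h\<in>carrier H. \<psi> h \<noteq> 0 \<and> G h \<otimes> w = \<psi> h \<odot> (w \<otimes> G h))"

text \<open>In this locale \<open>Z\<close> is the whole centre; the subgroup called
  \<open>Z\<close> in the theorem appears only as an index set of \<open>idem\<close>.\<close>

abbreviation Z where "Z \<equiv> group_center H"

abbreviation E where "E \<equiv> idem Z"

abbreviation M :: "'h \<Rightarrow> 'v \<Rightarrow> ('h \<Rightarrow> 'k) \<Rightarrow> 'v" where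
  "M g w \<phi> \<equiv> G g \<otimes> w \<otimes> E \<phi>"

lemma idem_summand_closed: "S \<subseteq> carrier H \<Longrightarrow> (\<lambda>h. \<phi> (inv\<^bsub>H\<^esub> h) \<odot> G h) \<in> S \<rightarrow> carrier A"
  by auto

lemma idem_closed [simp, intro]: "S \<subseteq> carrier H \<Longrightarrow> idem S \<phi> \<in> carrier A"
  unfolding idem_def using idem_summand_closed[of S \<phi>] by (intro k_space.smult_closed[OF k_space_axioms] finsum_closed)

lemma idem_mult:
  assumes "S \<subseteq> carrier H" "x \<in> carrier A"
  shows "idem S \<phi> \<otimes> x = inverse (of_nat (card S)) \<odot> (\<Oplus>h\<in>S. \<phi> (inv\<^bsub>H\<^esub> h) \<odot> (G h \<otimes> x))"
    and "x \<otimes> idem S \<phi> = inverse (of_nat (card S)) \<odot> (\<Oplus>h\<in>S. \<phi> (inv\<^bsub>H\<^esub> h) \<odot> (x \<otimes> G h))"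
proof -
  have fin: "finite S" using assms finite_H finite_subset by blast
  have G: "G h \<in> carrier A" if "h \<in> S" for h using assms that by auto
  have "(\<Oplus>h\<in>S. \<phi> (inv\<^bsub>H\<^esub> h) \<odot> G h) \<otimes> x = (\<Oplus>h\<in>S. \<phi> (inv\<^bsub>H\<^esub> h) \<odot> (G h \<otimes> x))"
    using assms G fin by (subst finsum_ldistr) (auto intro!: finsum_cong' simp: smult_mult_left)
  then show "idem S \<phi> \<otimes> x = inverse (of_nat (card S)) \<odot> (\<Oplus>h\<in>S. \<phi> (inv\<^bsub>H\<^esub> h) \<odot> (G h \<otimes> x))"
    using assms idem_summand_closed[of S \<phi>] by (simp add: idem_def smult_mult_left)
  have "x \<otimes> (\<Oplus>h\<in>S. \<phi> (inv\<^bsub>H\<^esub> h) \<odot> G h) = (\<Oplus>h\<in>S. \<phi> (inv\<^bsub>H\<^esub> h) \<odot> (x \<otimes> G h))"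
    using assms G fin by (subst finsum_rdistr) (auto intro!: finsum_cong' simp: smult_mult_right)
  then show "x \<otimes> idem S \<phi> = inverse (of_nat (card S)) \<odot> (\<Oplus>h\<in>S. \<phi> (inv\<^bsub>H\<^esub> h) \<odot> (x \<otimes> G h))"
    using assms idem_summand_closed[of S \<phi>] by (simp add: idem_def smult_mult_right)
qed

text \<open>Every summand contributes exactly \<open>x\<close>, and the factor in front divides by
  their number. Two functions \<phi> and \<theta> are kept apart so that the lemma also applies to
  \<open>e\<close> acting on \<open>e\<^sub>\<phi>\<close>.\<close>

lemma idem_absorb:
  assumes S: "S \<subseteq> carrier H" "of_nat (card S) \<noteq> (0 :: 'k)"
    and inverse: "\<And>h. h \<in> S \<Longrightarrow> \<phi> (inv\<^bsub>H\<^esub> h) * \<theta> h = 1"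
    and x: "x \<in> carrier A" "\<And>h. h \<in> S \<Longrightarrow> G h \<otimes> x = \<theta> h \<odot> x"
  shows "idem S \<phi> \<otimes> x = x"
proof -
  have fin: "finite S" using S finite_H finite_subset by blast
  have *: "(\<Oplus>h\<in>T. x) = of_nat (card T) \<odot> x" if "finite T" for T :: "'h set"
    using that x(1) by (induction T rule: finite_induct) (simp_all add: smult_l_distr Pi_def)
  have "(\<Oplus>h\<in>S. \<phi> (inv\<^bsub>H\<^esub> h) \<odot> (G h \<otimes> x)) = (\<Oplus>h\<in>S. x)"
    using x inverse by (intro finsum_cong') (auto simp flip: smult_assoc)
  then show ?thesis
    using S x fin by (simp add: idem_mult * flip: smult_assoc)
qed

lemma Z_subset: "Z \<subseteq> carrier H" by (rule H.center_subset)

lemma G_center_comm: "z \<in> Z \<Longrightarrow> h \<in> carrier H \<Longrightarrow> G z \<otimes> G h = G h \<otimes> G z"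
  using H.center_comm[of z h] Z_subset by (auto simp flip: G_mult)

lemma E_comm:
  assumes "h \<in> carrier H" shows "E \<phi> \<otimes> G h = G h \<otimes> E \<phi>"
proof -
  have "(\<Oplus>z\<in>Z. \<phi> (inv\<^bsub>H\<^esub> z) \<odot> (G z \<otimes> G h)) = (\<Oplus>z\<in>Z. \<phi> (inv\<^bsub>H\<^esub> z) \<odot> (G h \<otimes> G z))"
  proof (rule finsum_cong')
    fix z assume "z \<in> Z"
    then show "\<phi> (inv\<^bsub>H\<^esub> z) \<odot> (G z \<otimes> G h) = \<phi> (inv\<^bsub>H\<^esub> z) \<odot> (G h \<otimes> G z)"
      using G_center_comm[of z h] assms by simp
  qed (use assms Z_subset in auto)
  then show ?thesis using assms Z_subset by (simp add: idem_mult)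
qed

text \<open>Moving \<open>w\<close> past a central \<open>z\<close> costs \<psi>(z), which is
  cancelled by the value of \<psi> at the inverse of \<open>z\<close> that the twist puts into the
  coefficient.\<close>

lemma E_eigen:
  assumes w: "eigen w \<psi>" and \<psi>: "\<And>z. z \<in> Z \<Longrightarrow> \<psi> (inv\<^bsub>H\<^esub> z) * \<psi> z = 1"
  shows "E (twist H \<phi> \<psi>) \<otimes> w = w \<otimes> E \<phi>"
proof -
  interpret Z: subgroup Z H by (rule H.subgroup_center)
  have w': "w \<in> carrier A" and "\<And>h. h \<in> carrier H \<Longrightarrow> G h \<otimes> w = \<psi> h \<odot> (w \<otimes> G h)"
    using w by (auto simp: eigen_def)
  then have "(\<Oplus>h\<in>Z. twist H \<phi> \<psi> (inv\<^bsub>H\<^esub> h) \<odot> (G h \<otimes> w)) = (\<Oplus>h\<in>Z. \<phi> (inv\<^bsub>H\<^esub> h) \<odot> (w \<otimes> G h))"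
    using \<psi> by (intro finsum_cong') (auto simp: twist_def mult.assoc simp flip: smult_assoc)
  then show ?thesis using w' Z_subset by (simp add: idem_mult)
qed

text \<open>Multiplication by \<open>z\<close> permutes the centre. After reindexing the sum by it,
  the coefficients match because \<phi>(z) times the value of \<phi> at the inverse of
  \<open>z h\<close> is its value at the inverse of \<open>h\<close>.\<close>

lemma G_center_E:
  assumes z: "z \<in> Z" and \<phi>: "\<phi> \<in> characters (H\<lparr>carrier := Z\<rparr>)"
  shows "G z \<otimes> E \<phi> = \<phi> z \<odot> E \<phi>"
proof -
  interpret Z: subgroup Z H by (rule H.subgroup_center)
  have grp: "group (H\<lparr>carrier := Z\<rparr>)" by (rule Z.subgroup_is_group) (rule H.group_axioms)
  have \<phi>_mult: "\<phi> (a \<otimes>\<^bsub>H\<^esub> b) = \<phi> a * \<phi> b" if "a \<in> Z" "b \<in> Z" for a b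
    using characters_simps(1)[OF grp \<phi>] that by simp
  have inj: "inj_on ((\<otimes>\<^bsub>H\<^esub>) z) Z" using z by (auto simp: inj_on_def)
  have img: "(\<otimes>\<^bsub>H\<^esub>) z ` Z = Z" using group.surj_const_mult[OF grp, of z] z by simp
  have "(\<Oplus>h\<in>Z. \<phi> (inv\<^bsub>H\<^esub> h) \<odot> G h) = (\<Oplus>h\<in>Z. \<phi> (inv\<^bsub>H\<^esub> (z \<otimes>\<^bsub>H\<^esub> h)) \<odot> G (z \<otimes>\<^bsub>H\<^esub> h))"
    using finsum_reindex[OF _ inj, of "\<lambda>h. \<phi> (inv\<^bsub>H\<^esub> h) \<odot> G h"] img Z_subset z by (auto simp: Pi_def)
  then have "\<phi> z \<odot> (\<Oplus>h\<in>Z. \<phi> (inv\<^bsub>H\<^esub> h) \<odot> G h) = \<phi> z \<odot> (\<Oplus>h\<in>Z. \<phi> (inv\<^bsub>H\<^esub> (z \<otimes>\<^bsub>H\<^esub> h)) \<odot> G (z \<otimes>\<^bsub>H\<^esub> h))"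
    by (simp only:)
  also have "\<dots> = (\<Oplus>h\<in>Z. \<phi> z \<odot> (\<phi> (inv\<^bsub>H\<^esub> (z \<otimes>\<^bsub>H\<^esub> h)) \<odot> G (z \<otimes>\<^bsub>H\<^esub> h)))"
    using z by (intro smult_finsum finite_subset[OF Z_subset finite_H]) auto
  finally have "\<phi> z \<odot> (\<Oplus>h\<in>Z. \<phi> (inv\<^bsub>H\<^esub> h) \<odot> G h)
      = (\<Oplus>h\<in>Z. \<phi> z \<odot> (\<phi> (inv\<^bsub>H\<^esub> (z \<otimes>\<^bsub>H\<^esub> h)) \<odot> G (z \<otimes>\<^bsub>H\<^esub> h)))" .
  moreover have "\<phi> z * \<phi> (inv\<^bsub>H\<^esub> (z \<otimes>\<^bsub>H\<^esub> h)) = \<phi> (inv\<^bsub>H\<^esub> h)" if "h \<in> Z" for h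
  proof -
    have "z \<otimes>\<^bsub>H\<^esub> inv\<^bsub>H\<^esub> (z \<otimes>\<^bsub>H\<^esub> h) = inv\<^bsub>H\<^esub> h"
    proof -
      have zh: "z \<in> carrier H" "h \<in> carrier H" using z that Z_subset by auto
      have "z \<otimes>\<^bsub>H\<^esub> inv\<^bsub>H\<^esub> (z \<otimes>\<^bsub>H\<^esub> h) = (z \<otimes>\<^bsub>H\<^esub> inv\<^bsub>H\<^esub> h) \<otimes>\<^bsub>H\<^esub> inv\<^bsub>H\<^esub> z"
        using zh by (simp add: H.inv_mult_group H.m_assoc)
      also have "z \<otimes>\<^bsub>H\<^esub> inv\<^bsub>H\<^esub> h = inv\<^bsub>H\<^esub> h \<otimes>\<^bsub>H\<^esub> z" using z zh by (intro H.center_comm) auto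
      finally show ?thesis using zh by (simp add: H.m_assoc)
    qed
    then show ?thesis using z that by (simp flip: \<phi>_mult)
  qed
  then have "(\<Oplus>h\<in>Z. \<phi> z \<odot> (\<phi> (inv\<^bsub>H\<^esub> (z \<otimes>\<^bsub>H\<^esub> h)) \<odot> G (z \<otimes>\<^bsub>H\<^esub> h)))
      = (\<Oplus>h\<in>Z. \<phi> (inv\<^bsub>H\<^esub> h) \<odot> (G z \<otimes> G h))"
    using z by (intro finsum_cong') (simp_all add: G_mult flip: smult_assoc)
  ultimately have "\<phi> z \<odot> (\<Oplus>h\<in>Z. \<phi> (inv\<^bsub>H\<^esub> h) \<odot> G h) = (\<Oplus>h\<in>Z. \<phi> (inv\<^bsub>H\<^esub> h) \<odot> (G z \<otimes> G h))"
    by (simp only:)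
  moreover have s: "(\<Oplus>h\<in>Z. \<phi> (inv\<^bsub>H\<^esub> h) \<odot> G h) \<in> carrier A" (is "?s \<in> _")
    using idem_summand_closed[OF Z_subset] by (rule finsum_closed)
  ultimately have "G z \<otimes> E \<phi> = inverse (of_nat (card Z)) \<odot> (\<phi> z \<odot> ?s)"
    using z by (simp add: idem_mult Z_subset)
  also have "\<dots> = \<phi> z \<odot> (inverse (of_nat (card Z)) \<odot> ?s)"
    by (simp only: smult_assoc[OF s, symmetric] mult.commute)
  finally show ?thesis by (simp only: idem_def)
qed

end

section \<open>Products of the elements \<open>g w e\<^sub>\<phi>\<close> and the two
  relations\<close>

locale twisted_relations = group_in_algebra A H G
  for A :: "('k::field, 'v) module" (structure) and H :: "'h monoid" and G :: "'h \<Rightarrow> 'v" +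
  assumes card_center: "of_nat (card (group_center H)) \<noteq> (0 :: 'k)"
begin

lemma E_idem:
  assumes "\<phi> \<in> characters (H\<lparr>carrier := Z\<rparr>)"
  shows "E \<phi> \<otimes> E \<phi> = E \<phi>"
proof -
  interpret Z: subgroup Z H by (rule H.subgroup_center)
  have grp: "group (H\<lparr>carrier := Z\<rparr>)" by (rule Z.subgroup_is_group) (rule H.group_axioms)
  show ?thesis
    using assms G_center_E Z_subset card_center characters_simps(2,4)[OF grp assms]
    by (intro idem_absorb[where \<theta> = \<phi>]) (auto simp: H.m_inv_consistent[OF H.subgroup_center])
qed

lemma eigen_mult:
  assumes "eigen v \<psi>" "eigen w \<psi>'" shows "eigen (v \<otimes> w) (\<lambda>h. \<psi> h * \<psi>' h)"
proof -
  have cl: "v \<in> carrier A" "w \<in> carrier A" using assms by (auto simp: eigen_def)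
  have "G h \<otimes> (v \<otimes> w) = (\<psi> h * \<psi>' h) \<odot> (v \<otimes> w \<otimes> G h)" if h: "h \<in> carrier H" for h
  proof -
    have "G h \<otimes> (v \<otimes> w) = (G h \<otimes> v) \<otimes> w" using h cl by (simp add: m_assoc)
    also have "\<dots> = \<psi> h \<odot> (v \<otimes> G h \<otimes> w)" using assms h cl by (simp add: eigen_def smult_mult_left)
    also have "v \<otimes> G h \<otimes> w = v \<otimes> (G h \<otimes> w)" using h cl by (simp add: m_assoc)
    also have "\<psi> h \<odot> \<dots> = (\<psi> h * \<psi>' h) \<odot> (v \<otimes> w \<otimes> G h)"
      using assms h cl by (simp add: eigen_def smult_mult_right smult_assoc m_assoc)
    finally show ?thesis .
  qed
  then show ?thesis using assms by (simp add: eigen_def)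
qed

text \<open>The inner idempotent commutes with \<open>G g\<close>, turns into
  \<open>E \<phi>\<close> on passing \<open>v\<close>, and is absorbed by the outer one. Then
  \<open>w\<close> moves past \<open>G g\<close>, which costs the inverse of \<psi>(g).\<close>

lemma M_mult:
  assumes "eigen w \<psi>" "eigen v \<theta>" "g \<in> carrier H" "g' \<in> carrier H"
    "\<phi> \<in> characters (H\<lparr>carrier := Z\<rparr>)" "\<And>z. z \<in> Z \<Longrightarrow> \<theta> (inv\<^bsub>H\<^esub> z) * \<theta> z = 1"
  shows "M g' w (twist H \<phi> \<theta>) \<otimes> M g v \<phi> = inverse (\<psi> g) \<odot> M (g' \<otimes>\<^bsub>H\<^esub> g) (w \<otimes> v) \<phi>"
proof -
  have cl: "v \<in> carrier A" "w \<in> carrier A" "G g \<in> carrier A" "G g' \<in> carrier A"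
    "E \<phi> \<in> carrier A" "E (twist H \<phi> \<theta>) \<in> carrier A"
    using assms Z_subset by (auto simp: eigen_def)
  have "E (twist H \<phi> \<theta>) \<otimes> (G g \<otimes> (v \<otimes> E \<phi>)) = G g \<otimes> (E (twist H \<phi> \<theta>) \<otimes> v \<otimes> E \<phi>)"
    using cl assms(3) E_comm[of g "twist H \<phi> \<theta>"] by (simp add: m_assoc[symmetric])
  also have "\<dots> = G g \<otimes> (v \<otimes> E \<phi>)"
    using cl assms by (simp add: E_eigen[OF assms(2)] m_assoc E_idem)
  finally have 1: "E (twist H \<phi> \<theta>) \<otimes> (G g \<otimes> (v \<otimes> E \<phi>)) = G g \<otimes> (v \<otimes> E \<phi>)" .
  have "w \<otimes> G g = inverse (\<psi> g) \<odot> (G g \<otimes> w)"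
    using assms cl by (simp add: eigen_def flip: smult_assoc)
  then have 2: "w \<otimes> (G g \<otimes> (v \<otimes> E \<phi>)) = inverse (\<psi> g) \<odot> (G g \<otimes> (w \<otimes> (v \<otimes> E \<phi>)))"
    using cl by (simp add: smult_mult_left flip: m_assoc)
  have "M g' w (twist H \<phi> \<theta>) \<otimes> M g v \<phi> = G g' \<otimes> (w \<otimes> (E (twist H \<phi> \<theta>) \<otimes> (G g \<otimes> (v \<otimes> E \<phi>))))"
    using cl by (simp add: m_assoc)
  also have "\<dots> = inverse (\<psi> g) \<odot> M (g' \<otimes>\<^bsub>H\<^esub> g) (w \<otimes> v) \<phi>"
    using cl assms by (simp add: 1 2 smult_mult_right G_mult m_assoc)
  finally show ?thesis .
qed

text \<open>The central element moves right through \<open>w\<close> with factor \<psi>(z) and is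
  then absorbed by \<open>E \<phi>\<close> with factor \<phi>(z). This is the origin of the factors
  at \<open>z\<close>, \<open>z'\<close> and \<open>z''\<close> in all three parameters.\<close>

lemma M_center:
  assumes "eigen w \<psi>" "g \<in> carrier H" "z \<in> Z" "\<phi> \<in> characters (H\<lparr>carrier := Z\<rparr>)"
  shows "M (g \<otimes>\<^bsub>H\<^esub> z) w \<phi> = (\<psi> z * \<phi> z) \<odot> M g w \<phi>"
proof -
  have z: "z \<in> carrier H" using assms Z_subset by auto
  have cl: "w \<in> carrier A" "G g \<in> carrier A" "G z \<in> carrier A" "E \<phi> \<in> carrier A"
    using assms z Z_subset by (auto simp: eigen_def)
  have "M (g \<otimes>\<^bsub>H\<^esub> z) w \<phi> = G g \<otimes> (G z \<otimes> w \<otimes> E \<phi>)"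
    using cl z assms by (simp add: G_mult m_assoc)
  also have "G z \<otimes> w = \<psi> z \<odot> (w \<otimes> G z)" using assms z by (simp add: eigen_def)
  also have "G g \<otimes> (\<psi> z \<odot> (w \<otimes> G z) \<otimes> E \<phi>) = \<psi> z \<odot> (G g \<otimes> (w \<otimes> (G z \<otimes> E \<phi>)))"
    using cl by (simp add: smult_mult_left smult_mult_right m_assoc)
  also have "\<dots> = (\<psi> z * \<phi> z) \<odot> M g w \<phi>"
    using cl assms by (simp add: G_center_E smult_mult_right smult_assoc m_assoc)
  finally show ?thesis .
qed

lemma M_closed [simp, intro]: "g \<in> carrier H \<Longrightarrow> w \<in> carrier A \<Longrightarrow> M g w \<phi> \<in> carrier A"
  using Z_subset by auto

lemma M_add:
  "g \<in> carrier H \<Longrightarrow> v \<in> carrier A \<Longrightarrow> w \<in> carrier A \<Longrightarrow> M g (v \<oplus> w) \<phi> = M g v \<phi> \<oplus> M g w \<phi>"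
  using Z_subset by (simp add: l_distr r_distr idem_closed)

lemma M_smult:
  "g \<in> carrier H \<Longrightarrow> w \<in> carrier A \<Longrightarrow> M g (c \<odot> w) \<phi> = c \<odot> M g w \<phi>"
  using Z_subset by (simp add: smult_mult_left smult_mult_right idem_closed)

lemma M_lincomb:
  assumes "finite I" "g \<in> carrier H" "\<And>k. k \<in> I \<Longrightarrow> w k \<in> carrier A"
  shows "M g (\<Oplus>k\<in>I. a k \<odot> w k) \<phi> = (\<Oplus>k\<in>I. a k \<odot> M g (w k) \<phi>)"
  using assms(1,3)
proof (induction I rule: finite_induct)
  case (insert k I)
  have 1: "(\<lambda>k. a k \<odot> w k) \<in> I \<rightarrow> carrier A" "(\<lambda>k. a k \<odot> M g (w k) \<phi>) \<in> I \<rightarrow> carrier A"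
    using insert assms(2) by (auto simp: M_closed)
  then have "M g (\<Oplus>k\<in>insert k I. a k \<odot> w k) \<phi> = M g (a k \<odot> w k) \<phi> \<oplus> M g (\<Oplus>k\<in>I. a k \<odot> w k) \<phi>"
    using insert assms(2) by (simp add: M_add)
  then show ?case using 1 insert assms(2) by (simp add: M_smult M_closed)
qed (use assms(2) Z_subset in \<open>simp add: idem_closed\<close>)

text \<open>A factorisation of \<open>g\<close> through \<open>h k\<close> and a central element is
  available only for nonzero coefficients, so the vanishing terms are discarded before the central
  factors are turned into scalars.\<close>

lemma M_lincomb_center:
  assumes I: "finite I" and g: "g \<in> carrier H" and w: "\<And>k. k \<in> I \<Longrightarrow> eigen (w k) (\<psi> k)"
    and \<phi>: "\<phi> \<in> characters (H\<lparr>carrier := Z\<rparr>)"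
    and z: "\<And>k. k \<in> I \<Longrightarrow> a k \<noteq> 0 \<Longrightarrow> h k \<in> carrier H \<and> z k \<in> Z \<and> g = h k \<otimes>\<^bsub>H\<^esub> z k"
  shows "b \<odot> M g (\<Oplus>k\<in>I. a k \<odot> w k) \<phi> =
    (\<Oplus>k\<in>{k \<in> I. a k \<noteq> 0}. (a k * (b * \<psi> k (z k) * \<phi> (z k))) \<odot> M (h k) (w k) \<phi>)"
proof -
  have w': "w k \<in> carrier A" if "k \<in> I" for k using w[OF that] by (simp add: eigen_def)
  have "b \<odot> M g (\<Oplus>k\<in>I. a k \<odot> w k) \<phi> = (\<Oplus>k\<in>I. b \<odot> (a k \<odot> M g (w k) \<phi>))"
    using I g w' by (simp add: M_lincomb smult_finsum M_closed)
  also have "\<dots> = (\<Oplus>k\<in>{k \<in> I. a k \<noteq> 0}. b \<odot> (a k \<odot> M g (w k) \<phi>))"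
    using I g w' by (intro add.finprod_mono_neutral_cong_left[symmetric]) auto
  also have "\<dots> = (\<Oplus>k\<in>{k \<in> I. a k \<noteq> 0}. (a k * (b * \<psi> k (z k) * \<phi> (z k))) \<odot> M (h k) (w k) \<phi>)"
  proof (rule finsum_cong'[OF refl])
    fix k assume k: "k \<in> {k \<in> I. a k \<noteq> 0}"
    then have "M g (w k) \<phi> = (\<psi> k (z k) * \<phi> (z k)) \<odot> M (h k) (w k) \<phi>"
      using z[of k] M_center[OF w[of k] _ _ \<phi>] by auto
    moreover have "M (h k) (w k) \<phi> \<in> carrier A" using k z[of k] w' by auto
    ultimately show "b \<odot> (a k \<odot> M g (w k) \<phi>) = (a k * (b * \<psi> k (z k) * \<phi> (z k))) \<odot> M (h k) (w k) \<phi>"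
      by (simp add: mult_ac flip: smult_assoc)
  qed (use z w' in auto)
  finally show ?thesis .
qed

lemma commutation_relation:
  fixes w :: "nat \<Rightarrow> 'v"
  assumes I: "finite I" "i \<in> I" "j \<in> I" and w: "\<And>k. k \<in> I \<Longrightarrow> eigen (w k) (\<psi> k)"
    and \<psi>: "\<And>k. k \<in> I \<Longrightarrow> \<psi> k \<in> characters H"
    and \<phi>: "\<phi> \<in> characters (H\<lparr>carrier := Z\<rparr>)"
    and g: "gi \<in> carrier H" "gj \<in> carrier H" "gi' \<in> carrier H" "gj' \<in> carrier H"
    and z: "z \<in> Z" "gj' \<otimes>\<^bsub>H\<^esub> gi = gi' \<otimes>\<^bsub>H\<^esub> gj \<otimes>\<^bsub>H\<^esub> z"
    and bracket: "w i \<otimes> w j \<ominus> w j \<otimes> w i = (\<Oplus>k\<in>I. c k \<odot> w k)"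
    and z': "\<And>k. k \<in> I \<Longrightarrow> c k \<noteq> 0 \<Longrightarrow> h k \<in> carrier H \<and> z' k \<in> Z \<and> gj' \<otimes>\<^bsub>H\<^esub> gi = h k \<otimes>\<^bsub>H\<^esub> z' k"
  shows "M gj' (w j) (twist H \<phi> (\<psi> i)) \<otimes> M gi (w i) \<phi> \<ominus>
      (\<psi> i (gj \<otimes>\<^bsub>H\<^esub> z) * \<psi> j (inv\<^bsub>H\<^esub> gi \<otimes>\<^bsub>H\<^esub> z) * \<phi> z) \<odot>
        (M gi' (w i) (twist H \<phi> (\<psi> j)) \<otimes> M gj (w j) \<phi>)
    = \<ominus> (\<Oplus>k\<in>{k \<in> I. c k \<noteq> 0}. (c k * (inverse (\<psi> j gi) * \<psi> k (z' k) * \<phi> (z' k))) \<odot> M (h k) (w k) \<phi>)"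
proof -
  note ch = characters_simps[OF H.group_axioms \<psi>]
  have zH: "z \<in> carrier H" using z Z_subset by auto
  have cl: "w i \<in> carrier A" "w j \<in> carrier A" "(\<Oplus>k\<in>I. c k \<odot> w k) \<in> carrier A"
    using w I by (auto simp: eigen_def intro!: finsum_closed)
  have inv1: "\<psi> k (inv\<^bsub>H\<^esub> z) * \<psi> k z = 1" if "k \<in> I" "z \<in> Z" for k z
    using ch[OF that(1)] Z_subset that(2) by auto
  let ?g = "gj' \<otimes>\<^bsub>H\<^esub> gi" and ?b = "inverse (\<psi> j gi)"
  have gH: "?g \<in> carrier H" using g by simp
  have 1: "M gj' (w j) (twist H \<phi> (\<psi> i)) \<otimes> M gi (w i) \<phi> = ?b \<odot> M ?g (w j \<otimes> w i) \<phi>"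
    using M_mult[OF w w g(1,4) \<phi>, of j i] I inv1 by simp
  let ?q = "\<psi> i (gj \<otimes>\<^bsub>H\<^esub> z) * \<psi> j (inv\<^bsub>H\<^esub> gi \<otimes>\<^bsub>H\<^esub> z) * \<phi> z"
  let ?X = "M (gi' \<otimes>\<^bsub>H\<^esub> gj) (w i \<otimes> w j) \<phi>"
  have X: "?X \<in> carrier A" using g cl by auto
  have "?q \<odot> (M gi' (w i) (twist H \<phi> (\<psi> j)) \<otimes> M gj (w j) \<phi>) = ?q \<odot> (inverse (\<psi> i gj) \<odot> ?X)"
    using M_mult[OF w w g(2,3) \<phi>, of i j] I inv1 by simp
  also have "\<dots> = (?q * inverse (\<psi> i gj)) \<odot> ?X" by (rule smult_assoc[OF X, symmetric])
  \<comment> \<open>Here the form of \<open>q\<close> is explained: \<psi> of index \<open>i\<close>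
    at \<open>gj\<close> cancels, and what remains is the scalar \<open>?b\<close> of the other
    product times the scalar by which \<open>z\<close> acts on
    \<open>w i \<otimes> w j\<close>.\<close>
  also have "?q * inverse (\<psi> i gj) = ?b * (\<psi> i z * \<psi> j z * \<phi> z)"
    using g zH I ch by simp
  also have "\<dots> \<odot> ?X = ?b \<odot> ((\<psi> i z * \<psi> j z * \<phi> z) \<odot> ?X)" by (rule smult_assoc[OF X])
  also have "(\<psi> i z * \<psi> j z * \<phi> z) \<odot> ?X = M ?g (w i \<otimes> w j) \<phi>"
    unfolding z(2) using M_center[OF eigen_mult[OF w w] _ z(1) \<phi>] I g by simp
  finally have 2: "?q \<odot> (M gi' (w i) (twist H \<phi> (\<psi> j)) \<otimes> M gj (w j) \<phi>) = ?b \<odot> M ?g (w i \<otimes> w j) \<phi>" .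
  \<comment> \<open>The bracket belongs to the product that is subtracted, which produces the minus
    sign on the right-hand side of the relation.\<close>
  have "w i \<otimes> w j = (\<Oplus>k\<in>I. c k \<odot> w k) \<oplus> w j \<otimes> w i"
    unfolding bracket[symmetric] using cl by (simp add: a_minus_def a_assoc l_neg)
  then have "M ?g (w i \<otimes> w j) \<phi> = M ?g (\<Oplus>k\<in>I. c k \<odot> w k) \<phi> \<oplus> M ?g (w j \<otimes> w i) \<phi>"
    using cl gH by (simp add: M_add)
  moreover have "x \<ominus> (y \<oplus> x) = \<ominus> y" if "x \<in> carrier A" "y \<in> carrier A" for x y
    using that by (simp add: a_minus_def minus_add a_ac r_neg1 r_neg2)
  ultimately have "?b \<odot> M ?g (w j \<otimes> w i) \<phi> \<ominus> ?b \<odot> M ?g (w i \<otimes> w j) \<phi> = \<ominus> (?b \<odot> M ?g (\<Oplus>k\<in>I. c k \<odot> w k) \<phi>)"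
    using cl gH by (simp add: smult_r_distr M_closed)
  then show ?thesis
    unfolding 1 2 using M_lincomb_center[OF I(1) gH w \<phi> z', where b = ?b] by simp
qed

lemma power_relation:
  fixes w :: "nat \<Rightarrow> 'v" and \<gamma> :: "nat \<Rightarrow> 'h"
  assumes I: "finite I" "i \<in> I" and w: "\<And>k. k \<in> I \<Longrightarrow> eigen (w k) (\<psi> k)"
    and \<psi>: "\<And>k. k \<in> I \<Longrightarrow> \<psi> k \<in> characters H"
    and \<phi>: "\<phi> \<in> characters (H\<lparr>carrier := Z\<rparr>)"
    and \<gamma>: "\<And>m. \<gamma> m \<in> carrier H" and "p > 0"
    and pow: "w i [^] p = (\<Oplus>k\<in>I. d k \<odot> w k)"
    and z: "\<And>k. k \<in> I \<Longrightarrow> d k \<noteq> 0 \<Longrightarrow> h k \<in> carrier H \<and> z k \<in> Z \<and> desc_prod H \<gamma> p = h k \<otimes>\<^bsub>H\<^esub> z k"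
  shows "desc_prod A (\<lambda>m. M (\<gamma> m) (w i) (twist_pow H \<phi> (\<psi> i) m)) p =
    (\<Oplus>k\<in>{k \<in> I. d k \<noteq> 0}. (d k * ((\<Prod>m<p - 1. inverse (\<psi> i (\<gamma> m)) ^ (p - 1 - m)) * \<psi> k (z k) * \<phi> (z k))) \<odot> M (h k) (w k) \<phi>)"
proof -
  note ch = characters_simps[OF H.group_axioms \<psi>[OF I(2)]]
  have wi: "w i \<in> carrier A" using w[OF I(2)] by (simp add: eigen_def)
  have dp: "desc_prod H \<gamma> m \<in> carrier H" for m using \<gamma> by (induction m) auto
  have \<psi>dp: "inverse (\<psi> i (desc_prod H \<gamma> m)) = (\<Prod>l<m. inverse (\<psi> i (\<gamma> l)))" for m
    using \<gamma> dp ch(3)[OF H.one_closed H.one_closed] by (induction m) (simp_all add: ch)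
  have eig: "eigen (w i [^] m) (\<lambda>h. \<psi> i h ^ m)" for m :: nat
  proof (induction m)
    case 0
    then show ?case by (simp add: eigen_def)
  next
    case (Suc m)
    show ?case using eigen_mult[OF Suc w[OF I(2)]] by (simp add: mult.commute)
  qed
  \<comment> \<open>The induction starts with one factor, because the empty product is 1 and carries
    no idempotent. Among \<open>Suc m\<close> factors, \<open>m - l\<close> stand to the left of
    \<open>\<gamma> l\<close>, and each contributes one inverse value of \<psi> there.\<close>
  have "desc_prod A (\<lambda>m. M (\<gamma> m) (w i) (twist_pow H \<phi> (\<psi> i) m)) (Suc m) =
      (\<Prod>l<m. inverse (\<psi> i (\<gamma> l)) ^ (m - l)) \<odot> M (desc_prod H \<gamma> (Suc m)) (w i [^] Suc m) \<phi>" for m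
  proof (induction m)
    case 0
    interpret Z: subgroup Z H by (rule H.subgroup_center)
    have "twist_pow H \<phi> (\<psi> i) 0 = \<phi>"
      using \<phi> by (auto simp: twist_pow_def twist_def fun_eq_iff characters_def extensional_def)
    then show ?case using \<gamma>[of 0] wi Z_subset by (simp add: M_closed)
  next
    case (Suc m)
    let ?D = "desc_prod H \<gamma> (Suc m)" and ?c = "\<Prod>l<m. inverse (\<psi> i (\<gamma> l)) ^ (m - l)"
    have inv1: "\<psi> i (inv\<^bsub>H\<^esub> z) ^ Suc m * \<psi> i z ^ Suc m = 1" if "z \<in> Z" for z
    proof -
      have "\<psi> i (inv\<^bsub>H\<^esub> z) * \<psi> i z = 1" using ch Z_subset that by auto
      then show ?thesis by (simp only: power_mult_distrib[symmetric] power_one)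
    qed
    have cl: "M (\<gamma> (Suc m)) (w i) (twist_pow H \<phi> (\<psi> i) (Suc m)) \<in> carrier A"
      "M ?D (w i [^] Suc m) \<phi> \<in> carrier A"
      using \<gamma> dp[of "Suc m"] wi by (blast intro: M_closed nat_pow_closed)+
    have "M (\<gamma> (Suc m)) (w i) (twist_pow H \<phi> (\<psi> i) (Suc m)) \<otimes> (?c \<odot> M ?D (w i [^] Suc m) \<phi>)
       = ?c \<odot> (M (\<gamma> (Suc m)) (w i) (twist_pow H \<phi> (\<psi> i) (Suc m)) \<otimes> M ?D (w i [^] Suc m) \<phi>)"
      using cl by (rule smult_mult_right)
    also have "M (\<gamma> (Suc m)) (w i) (twist_pow H \<phi> (\<psi> i) (Suc m)) \<otimes> M ?D (w i [^] Suc m) \<phi>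
       = inverse (\<psi> i ?D) \<odot> M (\<gamma> (Suc m) \<otimes>\<^bsub>H\<^esub> ?D) (w i \<otimes> w i [^] Suc m) \<phi>"
      unfolding twist_pow_def using M_mult[OF w[OF I(2)] eig dp \<gamma> \<phi> inv1] .
    also have "w i \<otimes> w i [^] Suc m = w i [^] Suc (Suc m)" using wi by (rule nat_pow_Suc2[symmetric])
    also have "?c \<odot> (inverse (\<psi> i ?D) \<odot> M (\<gamma> (Suc m) \<otimes>\<^bsub>H\<^esub> ?D) (w i [^] Suc (Suc m)) \<phi>)
       = (?c * inverse (\<psi> i ?D)) \<odot> M (\<gamma> (Suc m) \<otimes>\<^bsub>H\<^esub> ?D) (w i [^] Suc (Suc m)) \<phi>"
      using \<gamma> dp wi by (intro smult_assoc[symmetric] M_closed) (auto simp del: nat_pow_Suc desc_prod.simps)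
    also have "?c * inverse (\<psi> i ?D) = (\<Prod>l<Suc m. inverse (\<psi> i (\<gamma> l)) ^ (Suc m - l))"
    proof -
      \<comment> \<open>For \<open>l = m\<close> the exponent \<open>m - l\<close> is 0, so the
        previous product may be extended by this index before one further factor is split off
        everywhere.\<close>
      have "(\<Prod>l<Suc m. inverse (\<psi> i (\<gamma> l)) ^ (Suc m - l)) = (\<Prod>l<Suc m. inverse (\<psi> i (\<gamma> l)) ^ (m - l) * inverse (\<psi> i (\<gamma> l)))"
        by (intro prod.cong refl) (auto simp: Suc_diff_le)
      then show ?thesis by (simp only: prod.distrib \<psi>dp) simp
    qed
    finally show ?case using Suc by simp
  qed
  from this[of "p - 1"] have "desc_prod A (\<lambda>m. M (\<gamma> m) (w i) (twist_pow H \<phi> (\<psi> i) m)) p =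
      (\<Prod>l<p - 1. inverse (\<psi> i (\<gamma> l)) ^ (p - 1 - l)) \<odot> M (desc_prod H \<gamma> p) (w i [^] p) \<phi>"
    using \<open>p > 0\<close> by simp
  then show ?thesis
    unfolding pow using M_lincomb_center[OF I(1) dp w \<phi> z] by simp
qed

end

section \<open>The twisted algebra\<close>

lemma corner_right_simps [simp]:
  "carrier (corner_right A e) = (\<lambda>x. x \<otimes>\<^bsub>A\<^esub> e) ` carrier A"
  "x \<otimes>\<^bsub>corner_right A e\<^esub> y = x \<otimes>\<^bsub>A\<^esub> y"
  "x \<oplus>\<^bsub>corner_right A e\<^esub> y = x \<oplus>\<^bsub>A\<^esub> y"
  "\<zero>\<^bsub>corner_right A e\<^esub> = \<zero>\<^bsub>A\<^esub>"
  "\<one>\<^bsub>corner_right A e\<^esub> = e"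
  "c \<odot>\<^bsub>corner_right A e\<^esub> x = c \<odot>\<^bsub>A\<^esub> x"
  by (simp_all add: corner_right_def)

context k_algebra
begin

lemma corner_rightI: "x \<in> carrier A \<Longrightarrow> x \<otimes> e = x \<Longrightarrow> x \<in> carrier (corner_right A e)"
  by (force simp: image_iff)

lemma abelian_group_corner_right:
  assumes e: "e \<in> carrier A"
  shows "abelian_group (corner_right A e)"
proof (rule abelian_groupI)
  fix x assume "x \<in> carrier (corner_right A e)"
  then obtain a where "a \<in> carrier A" "x = a \<otimes> e" by auto
  then show "\<exists>y\<in>carrier (corner_right A e). y \<oplus>\<^bsub>corner_right A e\<^esub> x = \<zero>\<^bsub>corner_right A e\<^esub>"
    using e imageI[of "\<ominus> a" "carrier A" "\<lambda>x. x \<otimes> e"]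
    by (intro bexI[of _ "(\<ominus> a) \<otimes> e"]) (simp_all only: corner_right_simps l_minus a_inv_closed l_neg m_closed)
next
  fix x y assume "x \<in> carrier (corner_right A e)" "y \<in> carrier (corner_right A e)"
  then obtain a b where "a \<in> carrier A" "x = a \<otimes> e" "b \<in> carrier A" "y = b \<otimes> e" by auto
  then show "x \<oplus>\<^bsub>corner_right A e\<^esub> y \<in> carrier (corner_right A e)"
    using e by (auto simp: l_distr[symmetric])
next
  show "\<zero>\<^bsub>corner_right A e\<^esub> \<in> carrier (corner_right A e)"
    using e by (auto intro!: image_eqI[of _ _ \<zero>])
qed (use e in \<open>auto simp: a_ac\<close>)

text \<open>\<open>a_inv\<close> and \<open>finsum\<close> refer to the carrier of the record.
  Negatives and finite sums in the corner therefore agree with those of \<open>A\<close> only after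
  their terms have been placed in the corner.\<close>

lemma corner_right_minus:
  assumes e: "e \<in> carrier A" and y: "y \<in> carrier (corner_right A e)"
  shows "\<ominus>\<^bsub>corner_right A e\<^esub> y = \<ominus> y" and "x \<ominus>\<^bsub>corner_right A e\<^esub> y = x \<ominus> y"
proof -
  interpret C: abelian_group "corner_right A e" using e by (rule abelian_group_corner_right)
  obtain a where a: "a \<in> carrier A" "y = a \<otimes> e" using y by auto
  then have "(\<ominus> a) \<otimes> e \<in> carrier (corner_right A e)"
    using imageI[of "\<ominus> a" "carrier A" "\<lambda>x. x \<otimes> e"] by (simp only: corner_right_simps a_inv_closed)
  then have "\<ominus> y \<in> carrier (corner_right A e)" using a e by (simp only: l_minus)
  then show "\<ominus>\<^bsub>corner_right A e\<^esub> y = \<ominus> y"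
    using y a e by (intro C.minus_equality) (auto simp: l_neg)
  then show "x \<ominus>\<^bsub>corner_right A e\<^esub> y = x \<ominus> y"
    by (simp add: a_minus_def)
qed

lemma corner_right_finsum:
  assumes e: "e \<in> carrier A" and I: "finite I" "\<And>i. i \<in> I \<Longrightarrow> f i \<in> carrier (corner_right A e)"
  shows "finsum (corner_right A e) f I = finsum A f I"
    and "finsum A f I \<in> carrier (corner_right A e)"
proof -
  interpret C: abelian_group "corner_right A e" using e by (rule abelian_group_corner_right)
  have sub: "carrier (corner_right A e) \<subseteq> carrier A" using e by auto
  show eq: "finsum (corner_right A e) f I = finsum A f I"
    using I
  proof (induction I rule: finite_induct)
    case (insert i I)
    then have "f \<in> I \<rightarrow> carrier (corner_right A e)" "f i \<in> carrier (corner_right A e)" by auto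
    moreover from this sub have "f \<in> I \<rightarrow> carrier A" "f i \<in> carrier A" by blast+
    ultimately show ?case
      using insert.hyps insert.IH[OF insert.prems] by simp
  qed simp
  show "finsum A f I \<in> carrier (corner_right A e)"
    unfolding eq[symmetric] using I by (intro C.finsum_closed) auto
qed

text \<open>Multiplication is the same in both records; only the empty product differs, being
  \<open>e\<close> in the corner. The rightmost factor \<open>f 0\<close> absorbs it.\<close>

lemma corner_right_desc_prod:
  assumes "f 0 \<in> carrier A" "f 0 \<otimes> e = f 0" "p > 0"
  shows "desc_prod (corner_right A e) f p = desc_prod A f p"
proof -
  have "desc_prod (corner_right A e) f (Suc m) = desc_prod A f (Suc m)" for m
    using assms by (induction m) simp_all
  from this[of "p - 1"] show ?thesis using \<open>p > 0\<close> by simp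
qed

end

text \<open>By the hypothesis relating \<chi> and \<phi>, the coefficients of
  \<open>idem S \<chi>\<close> cancel the scalars by which \<open>S\<close> acts on
  \<open>E \<phi>\<close>. As the two idempotents commute, the elements \<open>M g w \<phi>\<close>
  are fixed on the right and so belong to the corner.\<close>

lemma (in twisted_relations) M_idem:
  assumes S: "S \<subseteq> Z" "of_nat (card S) \<noteq> (0 :: 'k)" and inv: "\<And>h. h \<in> S \<Longrightarrow> \<chi> (inv\<^bsub>H\<^esub> h) * \<phi> h = 1"
    and \<phi>: "\<phi> \<in> characters (H\<lparr>carrier := Z\<rparr>)" and g: "g \<in> carrier H" and w: "w \<in> carrier A"
  shows "M g w \<phi> \<otimes> idem S \<chi> = M g w \<phi>"
proof -
  have S': "S \<subseteq> carrier H" using S Z_subset by auto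
  have "idem S \<chi> \<otimes> E \<phi> = E \<phi>"
    using S S' Z_subset inv G_center_E[OF _ \<phi>] by (intro idem_absorb[where \<theta> = \<phi>]) auto
  moreover have "idem S \<chi> \<otimes> E \<phi> = E \<phi> \<otimes> idem S \<chi>"
  proof -
    have "(\<Oplus>h\<in>S. \<chi> (inv\<^bsub>H\<^esub> h) \<odot> (G h \<otimes> E \<phi>)) = (\<Oplus>h\<in>S. \<chi> (inv\<^bsub>H\<^esub> h) \<odot> (E \<phi> \<otimes> G h))"
      using S' Z_subset by (intro finsum_cong') (auto simp: E_comm)
    then show ?thesis
      by (simp only: idem_mult(1)[OF S' idem_closed[OF Z_subset]] idem_mult(2)[OF S' idem_closed[OF Z_subset]])
  qed
  ultimately show ?thesis
    using g w S' Z_subset by (simp add: m_assoc)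
qed

section \<open>Embedding the Jennings Lie algebra and \<open>H\<close> into the skew group
  algebra\<close>

context algebra_action
begin

lemma mono_linear:
  assumes "u \<in> carrier U" "v \<in> carrier U"
  shows "mono (u \<oplus> v) h = mono u h \<oplus>\<^bsub>A\<^esub> mono v h" "mono (c \<odot> u) h = c \<odot>\<^bsub>A\<^esub> mono u h"
  using assms by (auto simp: skew_simps skew_monomial_def intro!: restrict_ext)

lemma mono_embed:
  assumes "u \<in> carrier U" "v \<in> carrier U"
  shows "mono u \<one>\<^bsub>H\<^esub> \<otimes>\<^bsub>A\<^esub> mono v \<one>\<^bsub>H\<^esub> = mono (u \<otimes> v) \<one>\<^bsub>H\<^esub>"
    and "mono u \<one>\<^bsub>H\<^esub> [^]\<^bsub>A\<^esub> (m :: nat) = mono (u [^] m) \<one>\<^bsub>H\<^esub>"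
    and "mono (u \<ominus> v) \<one>\<^bsub>H\<^esub> = mono u \<one>\<^bsub>H\<^esub> \<ominus>\<^bsub>A\<^esub> mono v \<one>\<^bsub>H\<^esub>"
proof -
  interpret A: k_algebra A by (rule k_algebra_skew)
  have mult: "mono u \<one>\<^bsub>H\<^esub> \<otimes>\<^bsub>A\<^esub> mono v \<one>\<^bsub>H\<^esub> = mono (u \<otimes> v) \<one>\<^bsub>H\<^esub>" if "u \<in> carrier U" "v \<in> carrier U" for u v
    using that by (simp add: mono_mult act_one_left)
  show "mono u \<one>\<^bsub>H\<^esub> \<otimes>\<^bsub>A\<^esub> mono v \<one>\<^bsub>H\<^esub> = mono (u \<otimes> v) \<one>\<^bsub>H\<^esub>" using assms by (rule mult)
  show "mono u \<one>\<^bsub>H\<^esub> [^]\<^bsub>A\<^esub> (m :: nat) = mono (u [^] m) \<one>\<^bsub>H\<^esub>"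
    using assms(1) by (induction m) (simp_all add: skew_simps(3) mult)
  have "mono (u \<ominus> v) \<one>\<^bsub>H\<^esub> = mono u \<one>\<^bsub>H\<^esub> \<oplus>\<^bsub>A\<^esub> mono ((- 1) \<odot> v) \<one>\<^bsub>H\<^esub>"
    using assms by (simp add: a_minus_def smult_minus_one mono_linear(1))
  then show "mono (u \<ominus> v) \<one>\<^bsub>H\<^esub> = mono u \<one>\<^bsub>H\<^esub> \<ominus>\<^bsub>A\<^esub> mono v \<one>\<^bsub>H\<^esub>"
    using assms by (simp add: mono_linear(2) A.smult_minus_one a_minus_def)
qed

lemma group_in_skew: "group_in_algebra A H (mono \<one>)"
proof -
  interpret A: k_algebra A by (rule k_algebra_skew)
  show ?thesis
    by unfold_locales (auto simp: finite_H mono_mult act_one_right skew_simps(3))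
qed

text \<open>In the skew group algebra \<open>h u = (act h u) h\<close>, so an eigenvector of the
  action satisfies the conjugation rule of \<open>eigen\<close>.\<close>

lemma mono_eigen:
  assumes "u \<in> carrier U" "\<And>h. h \<in> carrier H \<Longrightarrow> act h u = \<psi> h \<odot> u" "\<And>h. h \<in> carrier H \<Longrightarrow> \<psi> h \<noteq> 0"
  shows "group_in_algebra.eigen A H (mono \<one>) (mono u \<one>\<^bsub>H\<^esub>) \<psi>"
proof -
  interpret G: group_in_algebra A H "mono \<one>" by (rule group_in_skew)
  show ?thesis
    using assms by (auto simp: G.eigen_def mono_mult act_one_right mono_linear(2)[of u u])
qed

end

locale jennings_action =
  fixes p :: nat and P :: "'a monoid" and H :: "'h monoid" and \<pi> :: "'h \<Rightarrow> 'a \<Rightarrow> 'a"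
    and br :: "('a, 'k::field) jen \<Rightarrow> ('a, 'k) jen \<Rightarrow> ('a, 'k) jen" and pm :: "('a, 'k) jen \<Rightarrow> ('a, 'k) jen"
  assumes group_P: "group P" and group_H: "group H" and finite_H: "finite (carrier H)" and p_pos: "p > 0"
    and automorphism: "h \<in> carrier H \<Longrightarrow> group_automorphism P (\<pi> h) (\<pi> (inv\<^bsub>H\<^esub> h))"
    and \<pi>_mult: "h \<in> carrier H \<Longrightarrow> h' \<in> carrier H \<Longrightarrow> x \<in> carrier P \<Longrightarrow> \<pi> (h \<otimes>\<^bsub>H\<^esub> h') x = \<pi> h (\<pi> h' x)"
    and lie_structure: "jennings_structure p P br pm"
begin

abbreviation J :: "('k, ('a, 'k) jen) module" where "J \<equiv> Jen P"
abbreviation act where "act \<equiv> \<lambda>h. enveloping_map (jennings_map (\<pi> h))"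

lemma \<pi>_one: "x \<in> carrier P \<Longrightarrow> \<pi> \<one>\<^bsub>H\<^esub> x = x"
proof -
  interpret H: group H by (rule group_H)
  \<comment> \<open>As the identity is its own inverse, so is the map it induces; multiplicativity
    makes this map idempotent too, hence the identity on the carrier.\<close>
  interpret one: group_automorphism P "\<pi> \<one>\<^bsub>H\<^esub>" "\<pi> \<one>\<^bsub>H\<^esub>" using automorphism[of "\<one>\<^bsub>H\<^esub>"] by simp
  show "x \<in> carrier P \<Longrightarrow> \<pi> \<one>\<^bsub>H\<^esub> x = x"
    using \<pi>_mult[of "\<one>\<^bsub>H\<^esub>" "\<one>\<^bsub>H\<^esub>" x] one.inverse_left[of x] by simp
qed

sublocale restricted_lie_algebra p J br pm
  using lie_structure by (simp add: jennings_structure_def)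

lemma lie_automorphism:
  "h \<in> carrier H \<Longrightarrow> restricted_lie_automorphism p J br pm (jennings_map (\<pi> h)) (jennings_map (\<pi> (inv\<^bsub>H\<^esub> h)))"
  by (rule group_automorphism.jennings_map_automorphism[OF automorphism lie_structure p_pos])

lemma UJen_eq: "UJen p P br pm = U" by (simp add: UJen_def)

sublocale action: algebra_action U H act
proof -
  interpret H: group H by (rule group_H)
  interpret U: k_algebra U by (rule k_algebra_enveloping)
  note hom = restricted_lie_automorphism.enveloping_map_hom[OF lie_automorphism]
  have "act (h \<otimes>\<^bsub>H\<^esub> h') u = act h (act h' u)" if "h \<in> carrier H" "h' \<in> carrier H" "u \<in> carrier U" for h h' u
    using that
    by (intro enveloping_map_comp[symmetric, OF lie_automorphism lie_automorphism lie_automorphism]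
        jennings_map_comp[OF automorphism automorphism automorphism]) (auto simp: \<pi>_mult)
  moreover have "act \<one>\<^bsub>H\<^esub> u = u" if "u \<in> carrier U" for u
    using that by (intro enveloping_map_id[OF lie_automorphism] jennings_map_id[OF automorphism]) (auto simp: \<pi>_one)
  moreover have "act h u \<in> carrier U" "act h (u \<oplus>\<^bsub>U\<^esub> v) = act h u \<oplus>\<^bsub>U\<^esub> act h v"
      "act h (u \<otimes>\<^bsub>U\<^esub> v) = act h u \<otimes>\<^bsub>U\<^esub> act h v" "act h (c \<odot>\<^bsub>U\<^esub> u) = c \<odot>\<^bsub>U\<^esub> act h u"
    if "h \<in> carrier H" "u \<in> carrier U" "v \<in> carrier U" for h u v c
    by (rule hom[OF that])+
  moreover have "act h \<one>\<^bsub>U\<^esub> = \<one>\<^bsub>U\<^esub>" if "h \<in> carrier H" for h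
    using hom(5)[OF that U.one_closed U.one_closed] .
  ultimately show "algebra_action U H act"
    using finite_H
    by (intro algebra_action.intro algebra_action_axioms.intro U.k_algebra_axioms H.group_axioms)
qed

sublocale skew: group_in_algebra action.A H "action.mono \<one>\<^bsub>U\<^esub>"
  by (rule action.group_in_skew)

abbreviation W where "W v \<equiv> action.mono (incl v) \<one>\<^bsub>H\<^esub>"

lemma UJen_skew_eq: "UJen_skew p P br pm H \<pi> = action.A"
  by (simp add: UJen_skew_def UJen_eq)

lemma char_idempotent_eq: "char_idempotent p P br pm H \<pi> S \<phi> = skew.idem S \<phi>"
  by (simp add: char_idempotent_def skew.idem_def UJen_eq UJen_skew_eq Let_def)

lemma w_elt_eq: "w_elt p P br pm H \<pi> g v \<phi> = skew.M g (W v) \<phi>"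
  by (simp add: w_elt_def char_idempotent_eq UJen_eq UJen_skew_eq Let_def)

lemma twisted_algebra_eq:
  "twisted_algebra p P br pm H \<pi> Z \<chi> = corner_right action.A (skew.idem Z \<chi>)"
  by (simp add: twisted_algebra_def char_idempotent_eq UJen_skew_eq)

lemma W_eigen:
  assumes "v \<in> carrier J" "\<And>h. h \<in> carrier H \<Longrightarrow> jennings_map (\<pi> h) v = \<psi> h \<odot>\<^bsub>J\<^esub> v"
    "\<And>h. h \<in> carrier H \<Longrightarrow> \<psi> h \<noteq> 0"
  shows "skew.eigen (W v) \<psi>"
proof (rule action.mono_eigen)
  fix h assume h: "h \<in> carrier H"
  show "act h (incl v) = \<psi> h \<odot>\<^bsub>U\<^esub> incl v"
    using assms h enveloping_incl_relations(2)[of v v "\<psi> h"]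
    by (simp add: restricted_lie_automorphism.enveloping_map_incl[OF lie_automorphism])
qed (use assms in auto)

lemma W_lincomb:
  assumes "finite K" "\<And>k. k \<in> K \<Longrightarrow> v k \<in> carrier J"
  shows "W (\<Oplus>\<^bsub>J\<^esub>k\<in>K. c k \<odot>\<^bsub>J\<^esub> v k) = (\<Oplus>\<^bsub>action.A\<^esub>k\<in>K. c k \<odot>\<^bsub>action.A\<^esub> W (v k))"
  using assms
proof (induction K rule: finite_induct)
  case empty
  interpret J: k_space J by (rule k_space_Jen) (rule group_P)
  have "W \<zero>\<^bsub>J\<^esub> = W (0 \<odot>\<^bsub>J\<^esub> \<zero>\<^bsub>J\<^esub>)" by simp
  also have "\<dots> = 0 \<odot>\<^bsub>action.A\<^esub> W \<zero>\<^bsub>J\<^esub>"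
    using enveloping_incl_relations(2)[of "\<zero>\<^bsub>J\<^esub>" "\<zero>\<^bsub>J\<^esub>" 0] action.mono_linear(2)[of "incl \<zero>\<^bsub>J\<^esub>" "incl \<zero>\<^bsub>J\<^esub>" 0]
    by (simp only: M.zero_closed enveloping_incl_closed)
  finally show ?case using skew.smult_zero_left[of "W \<zero>\<^bsub>J\<^esub>"] by simp
next
  case (insert k K)
  interpret J: k_space J by (rule k_space_Jen) (rule group_P)
  let ?s = "\<Oplus>\<^bsub>J\<^esub>k\<in>K. c k \<odot>\<^bsub>J\<^esub> v k"
  have cl: "v k \<in> carrier J" "?s \<in> carrier J" using insert by (auto intro!: M.finsum_closed)
  have "W (\<Oplus>\<^bsub>J\<^esub>k\<in>insert k K. c k \<odot>\<^bsub>J\<^esub> v k) = W (c k \<odot>\<^bsub>J\<^esub> v k \<oplus>\<^bsub>J\<^esub> ?s)"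
    using insert by (subst M.finsum_insert) auto
  also have "\<dots> = c k \<odot>\<^bsub>action.A\<^esub> W (v k) \<oplus>\<^bsub>action.A\<^esub> W ?s"
    using cl enveloping_incl_relations(1)[of "c k \<odot>\<^bsub>J\<^esub> v k" ?s] enveloping_incl_relations(2)[of "v k" "v k" "c k"]
      action.mono_linear(1)[of "incl (c k \<odot>\<^bsub>J\<^esub> v k)" "incl ?s"] action.mono_linear(2)[of "incl (v k)" "incl (v k)" "c k"]
    by simp
  also have "\<dots> = (\<Oplus>\<^bsub>action.A\<^esub>k\<in>insert k K. c k \<odot>\<^bsub>action.A\<^esub> W (v k))"
    using insert by (subst skew.finsum_insert) auto
  finally show ?case .
qed

lemma W_relations:
  assumes "v \<in> carrier J" "u \<in> carrier J"
  shows "W v \<otimes>\<^bsub>action.A\<^esub> W u \<ominus>\<^bsub>action.A\<^esub> W u \<otimes>\<^bsub>action.A\<^esub> W v = W (br v u)"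
    and "W v [^]\<^bsub>action.A\<^esub> p = W (pm v)"
  using assms enveloping_incl_relations(3,4)[OF assms] action.mono_embed(2)[of "incl v" "incl v" p]
  by (simp_all add: action.mono_embed(1) flip: action.mono_embed(3))

end

section \<open>Symmetric choice of the group elements\<close>

text \<open>Subgroups of a free abelian group of finite rank are free, so a relation compatible with
  the group operations has a homomorphic selection on its domain. A basis is built implicitly by
  induction on \<open>S\<close>: an element \<open>x0\<close> of the domain with least positive
  coefficient at \<open>s\<close> gets an arbitrary value \<open>a0\<close>, and subtracting a
  multiple of \<open>x0\<close> leads back to elements supported in the smaller set.\<close>

lemma free_abelian_lift:
  fixes L :: "('l, 'm) monoid_scheme" and R :: "('s \<Rightarrow>\<^sub>0 int) \<Rightarrow> 'l \<Rightarrow> bool"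
  assumes "comm_group L" "finite S"
    and closed: "\<And>x a. R x a \<Longrightarrow> a \<in> carrier L"
    and zero: "R 0 \<one>\<^bsub>L\<^esub>"
    and add: "\<And>x y a b. R x a \<Longrightarrow> R y b \<Longrightarrow> R (x + y) (a \<otimes>\<^bsub>L\<^esub> b)"
    and neg: "\<And>x a. R x a \<Longrightarrow> R (- x) (inv\<^bsub>L\<^esub> a)"
  shows "\<exists>\<tau>. (\<forall>x\<in>{x. keys x \<subseteq> S \<and> Domainp R x}. R x (\<tau> x)) \<and>
    (\<forall>x\<in>{x. keys x \<subseteq> S \<and> Domainp R x}. \<forall>y\<in>{x. keys x \<subseteq> S \<and> Domainp R x}.
      \<tau> (x + y) = \<tau> x \<otimes>\<^bsub>L\<^esub> \<tau> y)"
proof -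
  interpret L: comm_group L by fact
  have cmul: "R (frag_cmul m x) (a [^]\<^bsub>L\<^esub> m)" if "R x a" for m :: int and x a
  proof -
    have nat: "R (frag_cmul (int n) x) (a [^]\<^bsub>L\<^esub> n)" for n
    proof (induction n)
      case (Suc n)
      have "R (frag_cmul (int n) x + x) (a [^]\<^bsub>L\<^esub> n \<otimes>\<^bsub>L\<^esub> a)" using Suc that by (rule add)
      moreover have "frag_cmul (int n) x + x = frag_cmul (int (Suc n)) x"
        using frag_cmul_distrib[of "int n" 1 x] by (simp add: add.commute)
      ultimately show ?case by simp
    qed (simp add: zero)
    show ?thesis
    proof (cases m rule: int_cases2)
      case (nonneg n)
      then show ?thesis using nat[of n] by (simp only: int_pow_int)
    next
      case (nonpos n)
      have "R (frag_cmul m x) (inv\<^bsub>L\<^esub> (a [^]\<^bsub>L\<^esub> n))" using neg[OF nat[of n]] by (simp only: nonpos minus_frag_cmul)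
      also have "inv\<^bsub>L\<^esub> (a [^]\<^bsub>L\<^esub> n) = a [^]\<^bsub>L\<^esub> m"
        using closed[OF that] by (simp only: nonpos L.int_pow_neg_int)
      finally show ?thesis .
    qed
  qed
  show ?thesis
    using \<open>finite S\<close>
  proof (induction S rule: finite_induct)
    case empty
    show ?case
      by (rule exI[of _ "\<lambda>_. \<one>\<^bsub>L\<^esub>"]) (auto simp: zero)
  next
    case (insert s S)
    let ?E = "{x. keys x \<subseteq> S \<and> Domainp R x}"
    let ?D = "{x. keys x \<subseteq> insert s S \<and> Domainp R x}"
    obtain \<tau> where IH: "(\<forall>x\<in>?E. R x (\<tau> x)) \<and>
        (\<forall>x\<in>?E. \<forall>y\<in>?E. \<tau> (x + y) = \<tau> x \<otimes>\<^bsub>L\<^esub> \<tau> y)"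
      using insert.IH by (rule exE)
    note \<tau> = conjunct1[OF IH] and \<tau>_add = conjunct2[OF IH]
    let ?c = "\<lambda>x. lookup x s"
    have D_add: "x + y \<in> ?D" if xy: "x \<in> ?D" "y \<in> ?D" for x y
    proof -
      obtain a b where "R x a" "R y b" using xy by (auto simp: Domainp_iff)
      then have "Domainp R (x + y)" unfolding Domainp_iff using add by blast
      then show ?thesis using xy by (simp add: keys_add_subset)
    qed
    have D_cmul: "frag_cmul m x \<in> ?D" if xy: "x \<in> ?D" for x and m :: int
    proof -
      obtain a where "R x a" using xy by (auto simp: Domainp_iff)
      then have "Domainp R (frag_cmul m x)" unfolding Domainp_iff using cmul by blast
      then show ?thesis using xy order_trans[OF keys_cmul[of m x]] by simp
    qed
    have D0: "x \<in> ?E" if "x \<in> ?D" "?c x = 0" for x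
      using that by (auto simp: in_keys_iff)
    show ?case
    proof (cases "\<forall>x\<in>?D. ?c x = 0")
      case True
      then have "?D \<subseteq> ?E" using D0 by (intro subsetI) simp
      then have "?D = ?E" by (rule equalityI) auto
      then show ?thesis using \<tau> \<tau>_add by (intro exI[of _ \<tau>]) simp
    next
      case False
      then obtain x where x: "x \<in> ?D" "?c x \<noteq> 0" by blast
      have "\<exists>y\<in>?D. ?c y > 0"
        using x D_cmul[OF x(1), of "sgn (?c x)"] by (intro bexI[of _ "frag_cmul (sgn (?c x)) x"]) (auto simp: sgn_if)
      then obtain y where y: "y \<in> ?D" "?c y > 0" by (rule bexE)
      \<comment> \<open>The coefficients at \<open>s\<close> of elements of the domain form a
        subgroup of the integers; \<open>n\<close> will be its positive generator.\<close>
      define pos where "pos = (\<lambda>n. n > 0 \<and> (\<exists>y\<in>?D. ?c y = int n))"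
      have "pos (nat (?c y))" unfolding pos_def using y by (intro conjI bexI[of _ y]) simp_all
      define n where "n = (LEAST n. pos n)"
      have "pos n" unfolding n_def by (rule LeastI) fact
      then have n: "n > 0" "\<exists>y\<in>?D. ?c y = int n" by (simp_all add: pos_def)
      from n(2) obtain x0 where x0: "x0 \<in> ?D" "?c x0 = int n" by (rule bexE)
      then obtain a0 where a0: "R x0 a0" by (auto simp: Domainp_iff)
      let ?m = "\<lambda>x. ?c x div int n"
      let ?r = "\<lambda>x. x + frag_cmul (- ?m x) x0"
      have r: "?r x \<in> ?D" if "x \<in> ?D" for x using D_add[OF that D_cmul[OF x0(1)]] .
      have cr: "?c (?r x) = ?c x mod int n" for x
        by (simp add: lookup_add x0(2) minus_div_mult_eq_mod[symmetric])
      \<comment> \<open>A nonzero remainder would be a positive coefficient smaller than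
        \<open>n\<close>, attained at \<open>?r x\<close>.\<close>
      have mod0: "?c x mod int n = 0" if "x \<in> ?D" for x
      proof (rule ccontr)
        assume neq: "?c x mod int n \<noteq> 0"
        have "0 \<le> ?c x mod int n" "?c x mod int n < int n" using n(1) by simp_all
        then have "nat (?c x mod int n) < n" "nat (?c x mod int n) > 0" using neq by linarith+
        moreover have "?c (?r x) = int (nat (?c x mod int n))"
          unfolding cr using n(1) by simp
        ultimately have "pos (nat (?c x mod int n))"
          unfolding pos_def using r[OF that] by (intro conjI bexI[of _ "?r x"]) simp_all
        then show False using not_less_Least[of "nat (?c x mod int n)" pos] \<open>nat (?c x mod int n) < n\<close>
          by (simp add: n_def)
      qed
      have r_D0: "?r x \<in> ?E" if "x \<in> ?D" for x
        using D0[OF r[OF that]] cr[of x] mod0[OF that] by simp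
      have m_add: "?m (x + y) = ?m x + ?m y" if "x \<in> ?D" "y \<in> ?D" for x y
        using mod0[OF that(1)] mod0[OF that(2)] by (simp add: lookup_add div_plus_div_distrib_dvd_left mod_0_imp_dvd)
      have r_add: "?r (x + y) = ?r x + ?r y" if "x \<in> ?D" "y \<in> ?D" for x y
        by (simp only: m_add[OF that] minus_add_distrib frag_cmul_distrib ac_simps)
      have a0': "a0 \<in> carrier L" using a0 by (rule closed)
      have \<tau>': "\<tau> (?r x) \<in> carrier L" if "x \<in> ?D" for x using closed[OF bspec[OF \<tau> r_D0[OF that]]] .
      \<comment> \<open>Every \<open>x\<close> is uniquely \<open>?r x\<close> plus
        \<open>?m x\<close> times \<open>x0\<close>, and both parts are additive in
        \<open>x\<close>. Hence the old selection and the powers of \<open>a0\<close> combine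
        without any further condition on \<open>a0\<close>.\<close>
      define \<sigma> where "\<sigma> = (\<lambda>x. \<tau> (?r x) \<otimes>\<^bsub>L\<^esub> a0 [^]\<^bsub>L\<^esub> ?m x)"
      have "R x (\<sigma> x)" if "x \<in> ?D" for x
      proof -
        have "frag_cmul (- ?m x) x0 + frag_cmul (?m x) x0 = 0"
          by (simp only: frag_cmul_distrib[symmetric]) simp
        then have "?r x + frag_cmul (?m x) x0 = x" by (simp only: add.assoc) simp
        moreover have "R (?r x + frag_cmul (?m x) x0) (\<sigma> x)"
          unfolding \<sigma>_def using bspec[OF \<tau> r_D0[OF that]] cmul[OF a0] by (rule add)
        ultimately show ?thesis by (simp only:)
      qed
      moreover have "\<sigma> (x + y) = \<sigma> x \<otimes>\<^bsub>L\<^esub> \<sigma> y" if "x \<in> ?D" "y \<in> ?D" for x y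
      proof -
        have "\<tau> (?r (x + y)) = \<tau> (?r x) \<otimes>\<^bsub>L\<^esub> \<tau> (?r y)"
          unfolding r_add[OF that] by (rule bspec[OF bspec[OF \<tau>_add r_D0[OF that(1)]] r_D0[OF that(2)]])
        then have "\<sigma> (x + y) = (\<tau> (?r x) \<otimes>\<^bsub>L\<^esub> \<tau> (?r y)) \<otimes>\<^bsub>L\<^esub> (a0 [^]\<^bsub>L\<^esub> ?m x \<otimes>\<^bsub>L\<^esub> a0 [^]\<^bsub>L\<^esub> ?m y)"
          by (simp only: \<sigma>_def m_add[OF that] L.int_pow_mult[OF a0'])
        then show ?thesis
          using \<tau>' that a0' by (simp add: \<sigma>_def L.m_ac)
      qed
      ultimately show ?thesis by (intro exI[of _ \<sigma>]) simp
    qed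
  qed
qed

text \<open>Values of a character are roots of the polynomial \<open>X ^ N - 1\<close> with
  \<open>N\<close> the order of \<open>H\<close>, hence come from a finite set. Finiteness is what
  allows \<open>free_abelian_lift\<close> to be applied to the group on characters.\<close>

lemma finite_characters:
  fixes H :: "'h monoid"
  assumes "group H" "finite (carrier H)"
  shows "finite (characters H :: ('h \<Rightarrow> 'k::field) set)"
proof -
  interpret group H by fact
  let ?N = "Coset.order H"
  let ?q = "Polynomial.monom (1 :: 'k) ?N - 1"
  have N: "?N > 0" using assms(2) by (simp add: order_gt_0_iff_finite)
  have "?q \<noteq> 0"
  proof
    assume "?q = 0"
    then have "Polynomial.coeff (Polynomial.monom (1 :: 'k) ?N) ?N = Polynomial.coeff 1 ?N" by simp
    then show False using N by simp
  qed
  then have fin: "finite {x :: 'k. x ^ ?N = 1}"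
    using poly_roots_finite[of ?q] by (simp add: poly_monom)
  have "\<psi> h ^ ?N = 1" if "\<psi> \<in> characters H" "h \<in> carrier H" for \<psi> :: "'h \<Rightarrow> 'k" and h
  proof -
    have "\<psi> (h [^]\<^bsub>H\<^esub> m) = \<psi> h ^ m" for m :: nat
      using that by (induction m) (simp_all add: characters_simps[OF assms(1) that(1)] characters_simps(3)[OF assms(1) that(1) one_closed one_closed])
    from this[of ?N] show ?thesis
      using that pow_order_eq_1[of h] characters_simps(3)[OF assms(1) that(1) one_closed one_closed] by simp
  qed
  then have "characters H \<subseteq> carrier H \<rightarrow>\<^sub>E {x :: 'k. x ^ ?N = 1}"
    by (auto simp: PiE_def characters_def)
  then show ?thesis using fin assms(2) by (meson finite_PiE finite_subset)
qed

section \<open>The pairing given by \<rho> and the central factors \<open>z\<close>,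
  \<open>z'\<close>, \<open>z''\<close>\<close>

locale central_character = group H for H :: "'h monoid" (structure) +
  fixes Z :: "'h set" and \<chi> :: "'h \<Rightarrow> 'k::field" and \<xi> :: "('h \<Rightarrow> 'k) \<Rightarrow> 'h \<Rightarrow> 'k"
  assumes finite_carrier: "finite (carrier H)" and Z_subgroup: "subgroup Z H"
    and Z_center: "Z \<subseteq> group_center H" and Z_derived: "Z = derived H (carrier H)"
    and \<chi>_hom: "\<chi> \<in> hom (H\<lparr>carrier := Z\<rparr>) field_units" and \<chi>_inj: "inj_on \<chi> Z"
    and \<xi>_inflated: "\<phi> \<in> Irr_above H Z \<chi> \<Longrightarrow> \<xi> \<phi> \<in> inflated_chars H Z"
begin

lemma \<chi>_mult: "a \<in> Z \<Longrightarrow> b \<in> Z \<Longrightarrow> \<chi> (a \<otimes> b) = \<chi> a * \<chi> b"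
  using hom_mult[OF \<chi>_hom] by (simp add: ring_of_type_algebra_def)

lemma \<chi>_nonzero: "a \<in> Z \<Longrightarrow> \<chi> a \<noteq> 0"
  using hom_in_carrier[OF \<chi>_hom] by (simp add: ring_of_type_algebra_def)

lemma \<chi>_one: "\<chi> \<one> = 1"
  using \<chi>_mult[of \<one> \<one>] \<chi>_nonzero[of \<one>] subgroup.one_closed[OF Z_subgroup] by simp

lemma Z_carrier: "Z \<subseteq> carrier H"
  using Z_center center_subset by blast

lemma commutator_in_Z: "g \<in> carrier H \<Longrightarrow> h \<in> carrier H \<Longrightarrow> h \<otimes> g \<otimes> inv h \<otimes> inv g \<in> Z"
  unfolding Z_derived derived_def by (rule generate.incl) blast

text \<open>The commutator of \<open>h\<close> and \<open>g'\<close> is central and moves freely,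
  which makes the group commutator itself multiplicative in its second argument.\<close>

lemma rho_mult:
  assumes "g \<in> carrier H" "g' \<in> carrier H" "h \<in> carrier H"
  shows "rho H \<chi> (g \<otimes> g') h = rho H \<chi> g h * rho H \<chi> g' h"
proof -
  let ?c = "h \<otimes> g' \<otimes> inv h \<otimes> inv g'"
  have c: "?c \<in> Z" "?c \<in> carrier H" using assms commutator_in_Z Z_carrier by auto
  have "(h \<otimes> g \<otimes> inv h \<otimes> inv g) \<otimes> ?c = h \<otimes> g \<otimes> inv h \<otimes> (inv g \<otimes> ?c)"
    using assms by (simp add: m_assoc)
  also have "inv g \<otimes> ?c = ?c \<otimes> inv g"
    using c Z_center assms center_comm[of ?c "inv g"] by auto
  also have "h \<otimes> g \<otimes> inv h \<otimes> (?c \<otimes> inv g) = h \<otimes> g \<otimes> (inv h \<otimes> h) \<otimes> g' \<otimes> inv h \<otimes> inv g' \<otimes> inv g"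
    using assms by (simp only: m_assoc m_closed inv_closed)
  also have "\<dots> = h \<otimes> (g \<otimes> g') \<otimes> inv h \<otimes> inv (g \<otimes> g')"
    using assms by (simp add: m_assoc inv_mult_group)
  finally show ?thesis
    using \<chi>_mult[OF commutator_in_Z[OF assms(1,3)] commutator_in_Z[OF assms(2,3)]] by (simp add: rho_def)
qed

lemma rho_center:
  assumes "z \<in> group_center H" "h \<in> carrier H" shows "rho H \<chi> z h = 1"
proof -
  have z: "z \<in> carrier H" using assms center_subset by auto
  have "h \<otimes> z = z \<otimes> h" using center_comm[OF assms] by simp
  then have "h \<otimes> z \<otimes> inv h \<otimes> inv z = \<one>" using z assms by (simp add: m_assoc)
  then show ?thesis by (simp add: rho_def \<chi>_one)
qed

lemma rho_nonzero: "g \<in> carrier H \<Longrightarrow> h \<in> carrier H \<Longrightarrow> rho H \<chi> g h \<noteq> 0"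
  unfolding rho_def by (intro \<chi>_nonzero commutator_in_Z)

lemma rho_inv: "g \<in> carrier H \<Longrightarrow> h \<in> carrier H \<Longrightarrow> rho H \<chi> (inv g) h = inverse (rho H \<chi> g h)"
  using rho_mult[of g "inv g" h] rho_center[of \<one> h] subgroup.one_closed[OF subgroup_center]
  by (simp add: inverse_unique)

text \<open>Faithfulness of \<chi> on \<open>Z\<close> turns the triviality of \<chi> on a
  commutator into triviality of the commutator.\<close>

lemma rho_kernel:
  assumes g: "g \<in> carrier H" and rho: "\<And>h. h \<in> carrier H \<Longrightarrow> rho H \<chi> g h = 1"
  shows "g \<in> group_center H"
proof (rule centerI[OF g])
  fix h assume h: "h \<in> carrier H"
  have "\<chi> (h \<otimes> g \<otimes> inv h \<otimes> inv g) = \<chi> \<one>" using rho[OF h] by (simp add: rho_def \<chi>_one)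
  then have "h \<otimes> g \<otimes> inv h \<otimes> inv g = \<one>"
    using inj_onD[OF \<chi>_inj] commutator_in_Z[OF g h] subgroup.one_closed[OF Z_subgroup] by blast
  then have "(h \<otimes> g) \<otimes> inv (g \<otimes> h) = \<one>" using g h by (simp add: inv_mult_group m_assoc)
  then show "g \<otimes> h = h \<otimes> g" using g h inv_solve_right[of \<one> "h \<otimes> g" "g \<otimes> h"] by simp
qed

text \<open>The source of all centrality claims below: two products of the chosen elements are
  compared through their images under \<rho>.\<close>

lemma rho_eq_center:
  assumes "g \<in> carrier H" "g' \<in> carrier H" "\<And>h. h \<in> carrier H \<Longrightarrow> rho H \<chi> g h = rho H \<chi> g' h"
  shows "inv g \<otimes> g' \<in> group_center H"
  using assms by (intro rho_kernel) (simp_all add: rho_mult rho_inv rho_nonzero)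

lemma inflated_character: "\<psi> \<in> inflated_chars H Z \<Longrightarrow> \<psi> \<in> characters H"
  by (simp add: inflated_chars_def)

lemmas inflated_simps = characters_simps[OF group_axioms inflated_character]

lemma Irr_character: "\<phi> \<in> Irr_above H Z \<chi> \<Longrightarrow> \<phi> \<in> characters (H\<lparr>carrier := group_center H\<rparr>)"
  by (simp add: Irr_above_def)

lemma twist_Irr:
  assumes "\<phi> \<in> Irr_above H Z \<chi>" "\<psi> \<in> inflated_chars H Z"
  shows "twist H \<phi> \<psi> \<in> Irr_above H Z \<chi>"
  using assms Z_center center_subset subgroup.m_closed[OF subgroup_center]
  by (auto simp: Irr_above_def inflated_chars_def characters_def twist_def hom_def Pi_iff ring_of_type_algebra_def subset_eq)

lemma twist_twist: "twist H (twist H \<phi> \<psi>) \<psi>' = twist H \<phi> (\<lambda>h. \<psi> h * \<psi>' h)"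
  by (auto simp: twist_def mult.assoc intro!: restrict_ext)

lemma twist_commute: "twist H (twist H \<phi> \<psi>) \<psi>' = twist H (twist H \<phi> \<psi>') \<psi>"
  by (simp add: twist_twist mult.commute)

lemma twist_cong: "(\<And>h. h \<in> carrier H \<Longrightarrow> \<psi> h = \<psi>' h) \<Longrightarrow> twist H \<phi> \<psi> = twist H \<phi> \<psi>'"
  using center_subset by (auto simp: twist_def intro!: restrict_ext)

lemma twist_pow_zero: "\<phi> \<in> Irr_above H Z \<chi> \<Longrightarrow> twist_pow H \<phi> \<psi> 0 = \<phi>"
  by (auto simp: twist_pow_def twist_def Irr_above_def characters_def extensional_def fun_eq_iff)

lemma twist_pow_Suc: "twist_pow H \<phi> \<psi> (Suc m) = twist H (twist_pow H \<phi> \<psi> m) \<psi>"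
  by (simp add: twist_pow_def twist_twist mult.commute)

lemma twist_pow_Irr:
  "\<phi> \<in> Irr_above H Z \<chi> \<Longrightarrow> \<psi> \<in> inflated_chars H Z \<Longrightarrow> twist_pow H \<phi> \<psi> m \<in> Irr_above H Z \<chi>"
  by (induction m) (simp_all add: twist_pow_zero twist_pow_Suc twist_Irr)

context
  fixes g assumes g: "g_choice H Z \<chi> \<xi> g"
begin

lemma g_closed: "\<psi> \<in> inflated_chars H Z \<Longrightarrow> \<phi> \<in> Irr_above H Z \<chi> \<Longrightarrow> g \<psi> \<phi> \<in> carrier H"
  using g by (simp add: g_choice_def)

lemma rho_g:
  assumes "\<psi> \<in> inflated_chars H Z" "\<phi> \<in> Irr_above H Z \<chi>" "h \<in> carrier H"
  shows "rho H \<chi> (g \<psi> \<phi>) h = \<xi> (twist H \<phi> \<psi>) h * inverse (\<xi> \<phi> h) * inverse (\<psi> h)"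
  using g assms by (simp add: g_choice_def)

lemma \<xi>_nonzero: "\<phi> \<in> Irr_above H Z \<chi> \<Longrightarrow> h \<in> carrier H \<Longrightarrow> \<xi> \<phi> h \<noteq> 0"
  using inflated_simps(2)[OF \<xi>_inflated] by blast

text \<open>The value of \<open>\<xi>\<close> at the intermediate twist cancels. The result is
  symmetric in the two characters, which is why exchanging them changes the product only by a
  central element.\<close>

lemma rho_g_g:
  assumes "\<psi> \<in> inflated_chars H Z" "\<psi>' \<in> inflated_chars H Z" "\<phi> \<in> Irr_above H Z \<chi>" "h \<in> carrier H"
  shows "rho H \<chi> (g \<psi>' (twist H \<phi> \<psi>) \<otimes> g \<psi> \<phi>) h =
    \<xi> (twist H \<phi> (\<lambda>h. \<psi> h * \<psi>' h)) h * inverse (\<xi> \<phi> h) * inverse (\<psi> h * \<psi>' h)"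
  using assms by (simp add: rho_mult g_closed twist_Irr rho_g twist_twist \<xi>_nonzero field_simps)

text \<open>The values of \<open>\<xi>\<close> telescope along the successive twists, leaving only
  those at the two ends.\<close>

lemma rho_desc_prod:
  assumes "\<psi> \<in> inflated_chars H Z" "\<phi> \<in> Irr_above H Z \<chi>"
  shows "desc_prod H (\<lambda>m. g \<psi> (twist_pow H \<phi> \<psi> m)) m \<in> carrier H"
    and "h \<in> carrier H \<Longrightarrow> rho H \<chi> (desc_prod H (\<lambda>m. g \<psi> (twist_pow H \<phi> \<psi> m)) m) h =
      \<xi> (twist_pow H \<phi> \<psi> m) h * inverse (\<xi> \<phi> h) * inverse (\<psi> h ^ m)"
proof -
  show cl: "desc_prod H (\<lambda>m. g \<psi> (twist_pow H \<phi> \<psi> m)) m \<in> carrier H" for m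
    using assms by (induction m) (simp_all add: g_closed twist_pow_Irr)
  show "rho H \<chi> (desc_prod H (\<lambda>m. g \<psi> (twist_pow H \<phi> \<psi> m)) m) h =
      \<xi> (twist_pow H \<phi> \<psi> m) h * inverse (\<xi> \<phi> h) * inverse (\<psi> h ^ m)" if h: "h \<in> carrier H"
  proof (induction m)
    case 0
    then show ?case
      using assms h rho_center[of \<one> h] subgroup.one_closed[OF subgroup_center]
      by (simp add: twist_pow_zero \<xi>_nonzero)
  next
    case (Suc m)
    have "\<xi> (twist_pow H \<phi> \<psi> m) h \<noteq> 0" "\<psi> h \<noteq> 0"
      using assms h \<xi>_nonzero twist_pow_Irr inflated_simps(2) by blast+
    moreover have "rho H \<chi> (desc_prod H (\<lambda>m. g \<psi> (twist_pow H \<phi> \<psi> m)) (Suc m)) h =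
        (\<xi> (twist_pow H \<phi> \<psi> (Suc m)) h * inverse (\<xi> (twist_pow H \<phi> \<psi> m) h) * inverse (\<psi> h)) *
        (\<xi> (twist_pow H \<phi> \<psi> m) h * inverse (\<xi> \<phi> h) * inverse (\<psi> h ^ m))"
      using Suc assms h cl[of m] rho_g[OF assms(1) twist_pow_Irr[OF assms(2,1)] h, of m]
      by (simp add: rho_mult g_closed twist_pow_Irr twist_pow_Suc)
    ultimately show ?case by simp
  qed
qed

lemma z_elt_center:
  assumes "\<psi> i \<in> inflated_chars H Z" "\<psi> j \<in> inflated_chars H Z" "\<phi> \<in> Irr_above H Z \<chi>"
  shows "z_elt H \<psi> g i j \<phi> \<in> group_center H"
  unfolding z_elt_def using assms
  by (intro rho_eq_center) (simp_all add: g_closed twist_Irr rho_g_g mult.commute)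

text \<open>The hypothesis \<open>ijk\<close> is the eigenvalue identity forced by a nonzero
  structure constant; it makes the twist by \<open>\<psi> k\<close> equal to the double twist in
  \<open>rho_g_g\<close>.\<close>

lemma z'_elt_center:
  assumes "\<psi> i \<in> inflated_chars H Z" "\<psi> j \<in> inflated_chars H Z" "\<psi> k \<in> inflated_chars H Z"
    "\<phi> \<in> Irr_above H Z \<chi>" and ijk: "\<And>h. h \<in> carrier H \<Longrightarrow> \<psi> k h = \<psi> i h * \<psi> j h"
  shows "z'_elt H \<psi> g i j k \<phi> \<in> group_center H"
proof -
  have "twist H \<phi> (\<lambda>h. \<psi> i h * \<psi> j h) = twist H \<phi> (\<psi> k)" using ijk by (intro twist_cong) simp
  then show ?thesis
    unfolding z'_elt_def using assms
    by (intro rho_eq_center) (simp_all add: g_closed twist_Irr rho_g_g rho_g)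
qed

lemma z''_elt_center:
  assumes "\<psi> i \<in> inflated_chars H Z" "\<psi> k \<in> inflated_chars H Z"
    "\<phi> \<in> Irr_above H Z \<chi>" and ik: "\<And>h. h \<in> carrier H \<Longrightarrow> \<psi> k h = \<psi> i h ^ p"
  shows "z''_elt p H \<psi> g i k \<phi> \<in> group_center H"
proof -
  have "twist_pow H \<phi> (\<psi> i) p = twist H \<phi> (\<psi> k)"
    unfolding twist_pow_def using ik by (intro twist_cong) simp
  then show ?thesis
    unfolding z''_elt_def using assms
    by (intro rho_eq_center) (simp_all add: g_closed rho_desc_prod rho_g)
qed

lemma q_par_central:
  assumes "\<psi> i \<in> inflated_chars H Z" "\<psi> j \<in> inflated_chars H Z" "\<phi> \<in> Irr_above H Z \<chi>"
    and z: "z_elt H \<psi> g i j \<phi> \<in> Z"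
  shows "q_par H \<psi> g i j \<phi> = \<psi> i (g (\<psi> j) \<phi>) * \<psi> j (inv (g (\<psi> i) \<phi>)) * \<chi> (z_elt H \<psi> g i j \<phi>)"
proof -
  have "\<psi> i (z_elt H \<psi> g i j \<phi>) = 1" "\<psi> j (z_elt H \<psi> g i j \<phi>) = 1" "\<phi> (z_elt H \<psi> g i j \<phi>) = \<chi> (z_elt H \<psi> g i j \<phi>)"
    using assms by (simp_all add: inflated_chars_def Irr_above_def)
  moreover have "z_elt H \<psi> g i j \<phi> \<in> carrier H" using z Z_carrier by auto
  ultimately show ?thesis
    using assms g_closed by (simp add: q_par_def Let_def inflated_simps)
qed

end

text \<open>
  The elements \<open>g\<^bsub>\<psi>,\<phi>\<^esub>\<close> are the images of \<open>[\<xi>\<^bsub>\<phi>\<psi>\<^esub>] - [\<xi>\<^bsub>\<phi>\<^esub>] - [\<psi>]\<close> under a homomorphism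
  \<open>\<tau>\<close> to \<open>H/Z\<close>, defined on a subgroup of the free abelian group on the characters and lifting
  \<open>\<rho>\<close>. Then \<open>g\<^bsub>j,\<phi>\<psi>\<^sub>i\<^esub> g\<^bsub>i,\<phi>\<^esub>\<close> is, modulo \<open>Z\<close>, the image of
  \<open>[\<xi>\<^bsub>\<phi>\<psi>\<^sub>i\<psi>\<^sub>j\<^esub>] - [\<xi>\<^bsub>\<phi>\<^esub>] - [\<psi>\<^sub>i] - [\<psi>\<^sub>j]\<close>, which is symmetric in \<open>i\<close> and \<open>j\<close>.
\<close>

lemma symmetric_g_choice:
  assumes g: "g_choice H Z \<chi> \<xi> g"
  obtains g' where "g_choice H Z \<chi> \<xi> g'"
    and "\<And>\<psi> i j \<phi>. \<psi> i \<in> inflated_chars H Z \<Longrightarrow> \<psi> j \<in> inflated_chars H Z \<Longrightarrow> \<phi> \<in> Irr_above H Z \<chi> \<Longrightarrow>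
      z_elt H \<psi> g' i j \<phi> \<in> Z"
proof -
  let ?S = "inflated_chars H Z :: ('h \<Rightarrow> 'k) set"
  let ?L = "H Mod Z"
  interpret normal Z H unfolding Z_derived by (intro derived_is_normal normal_invI) (auto intro: subgroup_self)
  have L: "comm_group ?L" using derived_quot_is_comm_group by (simp add: Z_derived)
  have S: "finite ?S"
    using finite_characters[OF group_axioms finite_carrier] by (rule finite_subset[rotated]) (auto simp: inflated_chars_def)
  \<comment> \<open>\<open>ev x\<close> is the character denoted by the formal integer combination
    \<open>x\<close> of characters, with addition read as multiplication and negative coefficients
    as inverses.\<close>
  define ev where "ev = (\<lambda>x h. \<Prod>s\<in>?S. s h powi lookup x s)"
  have ev_add: "ev (x + y) h = ev x h * ev y h" and ev_neg: "ev (- x) h = inverse (ev x h)" if h: "h \<in> carrier H" for x y h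
  proof -
    have nz: "s h \<noteq> 0" if "s \<in> ?S" for s using inflated_simps(2)[OF that h h] .
    show "ev (x + y) h = ev x h * ev y h"
      unfolding ev_def prod.distrib[symmetric] by (intro prod.cong) (simp_all add: lookup_add power_int_add nz)
    show "ev (- x) h = inverse (ev x h)"
      unfolding ev_def prod_inversef[symmetric] by (intro prod.cong) (simp_all add: power_int_minus)
  qed
  have ev_diff: "ev (x - y) h = ev x h * inverse (ev y h)" if "h \<in> carrier H" for x y h
    using ev_add[OF that, of x "- y"] ev_neg[OF that, of y] by simp
  have ev_of: "ev (frag_of s) h = s h" if "s \<in> ?S" "h \<in> carrier H" for s h
  proof -
    have "ev (frag_of s) h = (\<Prod>t\<in>?S. if t = s then s h else 1)"
      unfolding ev_def by (intro prod.cong) (auto simp: lookup_single when_def)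
    then show ?thesis using S that by simp
  qed
  \<comment> \<open>\<open>R x C\<close> says that the coset \<open>C\<close> has a representative
    whose image under \<rho> is the character \<open>ev x\<close>; the domain of \<open>R\<close>
    thus consists of the combinations that \<rho> can reach.\<close>
  define R where "R = (\<lambda>x C. C \<in> carrier ?L \<and> (\<exists>a\<in>carrier H. C = Z #> a \<and> (\<forall>h\<in>carrier H. rho H \<chi> a h = ev x h)))"
  let ?D = "{x. keys x \<subseteq> ?S \<and> Domainp R x}"
  obtain \<tau> where \<tau>: "\<forall>x\<in>?D. R x (\<tau> x)"
    and \<tau>_add: "\<forall>x\<in>?D. \<forall>y\<in>?D. \<tau> (x + y) = \<tau> x \<otimes>\<^bsub>?L\<^esub> \<tau> y"
  proof -
    have "\<exists>\<tau>. (\<forall>x\<in>?D. R x (\<tau> x)) \<and> (\<forall>x\<in>?D. \<forall>y\<in>?D. \<tau> (x + y) = \<tau> x \<otimes>\<^bsub>?L\<^esub> \<tau> y)"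
    proof (rule free_abelian_lift[OF L S])
      have "ev 0 h = 1" for h by (simp add: ev_def)
      then show "R 0 \<one>\<^bsub>?L\<^esub>"
        unfolding R_def using rho_center[OF subgroup.one_closed[OF subgroup_center]] group.is_monoid[OF comm_group.axioms(2)[OF L], THEN monoid.one_closed]
        by (auto simp: FactGroup_def coset_mult_one subset intro!: bexI[of _ \<one>])
    next
      fix x y C D assume "R x C" "R y D"
      then obtain a b where ab: "a \<in> carrier H" "b \<in> carrier H" "C = Z #> a" "D = Z #> b"
        "\<And>h. h \<in> carrier H \<Longrightarrow> rho H \<chi> a h = ev x h" "\<And>h. h \<in> carrier H \<Longrightarrow> rho H \<chi> b h = ev y h"
        by (auto simp: R_def)
      have "C \<otimes>\<^bsub>?L\<^esub> D = Z #> (a \<otimes> b)" using ab by (simp add: FactGroup_def rcos_sum)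
      then show "R (x + y) (C \<otimes>\<^bsub>?L\<^esub> D)"
        unfolding R_def using ab by (auto simp: rho_mult ev_add FactGroup_def RCOSETS_def intro!: bexI[of _ "a \<otimes> b"])
    next
      fix x C assume "R x C"
      then obtain a where a: "a \<in> carrier H" "C = Z #> a" "C \<in> carrier ?L" "\<And>h. h \<in> carrier H \<Longrightarrow> rho H \<chi> a h = ev x h"
        by (auto simp: R_def)
      have "inv\<^bsub>?L\<^esub> C = Z #> inv a" using a inv_FactGroup[of C] by (simp add: rcos_inv)
      then show "R (- x) (inv\<^bsub>?L\<^esub> C)"
        unfolding R_def using a by (auto simp: rho_inv ev_neg FactGroup_def RCOSETS_def intro!: bexI[of _ "inv a"])
    qed (simp add: R_def)
    then show thesis using that by blast
  qed
  define x where "x = (\<lambda>\<psi> \<phi>. frag_of (\<xi> (twist H \<phi> \<psi>)) - frag_of (\<xi> \<phi>) - frag_of \<psi>)"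
  have keys: "keys (x \<psi> \<phi>) \<subseteq> ?S" if "\<psi> \<in> ?S" "\<phi> \<in> Irr_above H Z \<chi>" for \<psi> \<phi>
    unfolding x_def using that \<xi>_inflated twist_Irr
    by (intro order_trans[OF keys_diff] Un_least) (auto simp: keys_frag_of)
  have ev_x: "ev (x \<psi> \<phi>) h = \<xi> (twist H \<phi> \<psi>) h * inverse (\<xi> \<phi> h) * inverse (\<psi> h)"
    if "\<psi> \<in> ?S" "\<phi> \<in> Irr_above H Z \<chi>" "h \<in> carrier H" for \<psi> \<phi> h
    unfolding x_def using that by (simp add: ev_diff ev_of \<xi>_inflated twist_Irr)
  \<comment> \<open>The given family \<open>g\<close> provides the witnesses that these combinations
    lie in the domain of the lift.\<close>
  have x_D: "x \<psi> \<phi> \<in> ?D" if "\<psi> \<in> ?S" "\<phi> \<in> Irr_above H Z \<chi>" for \<psi> \<phi>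
  proof -
    have "R (x \<psi> \<phi>) (Z #> g \<psi> \<phi>)"
      unfolding R_def using g_closed[OF g that] rho_g[OF g that] ev_x[OF that]
      by (auto simp: FactGroup_def RCOSETS_def)
    then show ?thesis using keys[OF that] by (auto simp: Domainp_iff)
  qed
  \<comment> \<open>One representative has to lie in the coset selected by \<open>\<tau>\<close> and
    have the prescribed image under \<rho> at the same time; the definition of \<open>R\<close>
    supplies both at once.\<close>
  define g' where "g' = (\<lambda>\<psi> \<phi>. SOME a. a \<in> carrier H \<and> \<tau> (x \<psi> \<phi>) = Z #> a \<and> (\<forall>h\<in>carrier H. rho H \<chi> a h = ev (x \<psi> \<phi>) h))"
  have g': "g' \<psi> \<phi> \<in> carrier H \<and> \<tau> (x \<psi> \<phi>) = Z #> g' \<psi> \<phi> \<and> (\<forall>h\<in>carrier H. rho H \<chi> (g' \<psi> \<phi>) h = ev (x \<psi> \<phi>) h)"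
    if "\<psi> \<in> ?S" "\<phi> \<in> Irr_above H Z \<chi>" for \<psi> \<phi>
  proof -
    have "\<exists>a. a \<in> carrier H \<and> \<tau> (x \<psi> \<phi>) = Z #> a \<and> (\<forall>h\<in>carrier H. rho H \<chi> a h = ev (x \<psi> \<phi>) h)"
      using bspec[OF \<tau> x_D[OF that]] unfolding R_def by blast
    then show ?thesis unfolding g'_def by (rule someI_ex)
  qed
  have choice: "g_choice H Z \<chi> \<xi> g'"
    using g' ev_x by (simp add: g_choice_def)
  moreover have "z_elt H \<psi> g' i j \<phi> \<in> Z" if ij: "\<psi> i \<in> ?S" "\<psi> j \<in> ?S" and \<phi>: "\<phi> \<in> Irr_above H Z \<chi>" for \<psi> i j \<phi>
  proof -
    have prod: "Z #> (g' \<psi>' (twist H \<phi> \<psi>) \<otimes> g' \<psi> \<phi>) = \<tau> (x \<psi>' (twist H \<phi> \<psi>) + x \<psi> \<phi>)"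
      if "\<psi> \<in> ?S" "\<psi>' \<in> ?S" for \<psi> \<psi>'
    proof -
      have tw: "twist H \<phi> \<psi> \<in> Irr_above H Z \<chi>" using \<phi> that(1) by (rule twist_Irr)
      have "\<tau> (x \<psi>' (twist H \<phi> \<psi>) + x \<psi> \<phi>) = \<tau> (x \<psi>' (twist H \<phi> \<psi>)) \<otimes>\<^bsub>?L\<^esub> \<tau> (x \<psi> \<phi>)"
        using bspec[OF bspec[OF \<tau>_add x_D[OF that(2) tw]] x_D[OF that(1) \<phi>]] .
      then show ?thesis
        using g'[OF that(2) tw] g'[OF that(1) \<phi>] by (simp add: FactGroup_def rcos_sum)
    qed
    let ?a = "g' (\<psi> i) (twist H \<phi> (\<psi> j)) \<otimes> g' (\<psi> j) \<phi>" and ?b = "g' (\<psi> j) (twist H \<phi> (\<psi> i)) \<otimes> g' (\<psi> i) \<phi>"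
    have ab: "?a \<in> carrier H" "?b \<in> carrier H" using g' twist_Irr ij \<phi> by auto
    have "x (\<psi> i) (twist H \<phi> (\<psi> j)) + x (\<psi> j) \<phi> = x (\<psi> j) (twist H \<phi> (\<psi> i)) + x (\<psi> i) \<phi>"
      by (simp add: x_def twist_commute[of \<phi> "\<psi> i" "\<psi> j"])
    then have "Z #> ?b = Z #> ?a" using prod[OF ij(1,2)] prod[OF ij(2,1)] by simp
    then have "?b \<in> Z #> ?a" using rcos_self[OF ab(2) is_subgroup] by simp
    then obtain z where z: "z \<in> Z" "?b = z \<otimes> ?a" by (auto simp: r_coset_def)
    \<comment> \<open>The right coset gives \<open>z\<close> as a left factor, whereas
      \<open>z_elt\<close> is the factor on the right; centrality of \<open>Z\<close> exchanges the
      two.\<close>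
    have "z \<otimes> ?a = ?a \<otimes> z" using z Z_center ab(1) by (intro center_comm) auto
    then have "inv ?a \<otimes> ?b = z" using z ab Z_carrier by (simp add: subset_eq flip: m_assoc)
    then show ?thesis using z by (simp add: z_elt_def)
  qed
  ultimately show thesis using that by blast
qed

end

section \<open>The relations\<close>

lemma AutoGroup_action:
  fixes P :: "'a monoid" and H :: "'h monoid"
  assumes "group P" "group H" "subgroup L (AutoGroup P)"
    and \<pi>: "\<pi> \<in> hom H ((AutoGroup P)\<lparr>carrier := L\<rparr>)"
  shows "h \<in> carrier H \<Longrightarrow> h' \<in> carrier H \<Longrightarrow> x \<in> carrier P \<Longrightarrow> \<pi> (h \<otimes>\<^bsub>H\<^esub> h') x = \<pi> h (\<pi> h' x)"
    and "h \<in> carrier H \<Longrightarrow> group_automorphism P (\<pi> h) (\<pi> (inv\<^bsub>H\<^esub> h))"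
proof -
  interpret P: group P by fact
  interpret H: group H by fact
  have L: "L \<subseteq> auto P"
    using subgroup.subset[OF assms(3)] by (simp add: AutoGroup_def)
  have auto: "\<pi> h \<in> hom P P" "\<pi> h \<in> Bij (carrier P)" if "h \<in> carrier H" for h
    using hom_in_carrier[OF \<pi> that] L by (auto simp: auto_def)
  show mult: "\<pi> (h \<otimes>\<^bsub>H\<^esub> h') x = \<pi> h (\<pi> h' x)"
    if "h \<in> carrier H" "h' \<in> carrier H" "x \<in> carrier P" for h h' x
    using hom_mult[OF \<pi> that(1,2)] that auto by (simp add: AutoGroup_def BijGroup_def compose_eq)
  have one: "\<pi> \<one>\<^bsub>H\<^esub> x = x" if x: "x \<in> carrier P" for x
  proof -
    have "inj_on (\<pi> \<one>\<^bsub>H\<^esub>) (carrier P)" using auto(2)[OF H.one_closed] by (simp add: Bij_def bij_betw_def)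
    moreover have "\<pi> \<one>\<^bsub>H\<^esub> x \<in> carrier P" using auto(1)[OF H.one_closed] x by (rule hom_in_carrier)
    ultimately show ?thesis using mult[OF H.one_closed H.one_closed x] x by (simp add: inj_on_eq_iff)
  qed
  show "group_automorphism P (\<pi> h) (\<pi> (inv\<^bsub>H\<^esub> h))" if h: "h \<in> carrier H"
  proof unfold_locales
    show "\<pi> h \<in> hom P P" "\<pi> (inv\<^bsub>H\<^esub> h) \<in> hom P P" using auto(1) h by auto
    show "\<pi> (inv\<^bsub>H\<^esub> h) (\<pi> h x) = x" "\<pi> h (\<pi> (inv\<^bsub>H\<^esub> h) x) = x" if "x \<in> carrier P" for x
      using mult[OF H.inv_closed[OF h] h that] mult[OF h H.inv_closed[OF h] that] one[OF that] h by simp_all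
  qed
qed

text \<open>By Lagrange the order of \<open>S\<close> divides that of the group, which is prime to
  the characteristic. This is what makes the averaging idempotents meaningful.\<close>

lemma (in group) card_subgroup_nonzero:
  assumes "subgroup S G" "finite (carrier G)" "coprime (Coset.order G) p" "CHAR('k::field) = p" "prime p"
  shows "of_nat (card S) \<noteq> (0 :: 'k)"
proof
  assume "of_nat (card S) = (0 :: 'k)"
  then have "p dvd card S" using assms(4) by (simp add: of_nat_eq_0_iff_char_dvd)
  moreover have "card S dvd Coset.order G" using lagrange[OF assms(1)] by (metis dvd_triv_right)
  ultimately show False using assms(3,5) by (metis coprime_common_divisor dvd_refl dvd_trans not_prime_unit)
qed

theorem theorem3p8:
  fixes p n :: nat
    and P :: "'a monoid" and L :: "('a \<Rightarrow> 'a) set"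
    and \<alpha>_class :: "(('a \<Rightarrow> 'a) \<times> ('a \<Rightarrow> 'a) \<Rightarrow> 'k::alg_closed_field) set"
    and \<alpha> :: "('a \<Rightarrow> 'a) \<times> ('a \<Rightarrow> 'a) \<Rightarrow> 'k"
    and H :: "'h monoid" and Z :: "'h set" and \<pi> :: "'h \<Rightarrow> 'a \<Rightarrow> 'a" and \<chi> :: "'h \<Rightarrow> 'k"
    and \<phi>0 :: "'h \<Rightarrow> 'k" and \<xi> :: "('h \<Rightarrow> 'k) \<Rightarrow> 'h \<Rightarrow> 'k"
    and g :: "('h \<Rightarrow> 'k) \<Rightarrow> ('h \<Rightarrow> 'k) \<Rightarrow> 'h"
    and br :: "('a, 'k) jen \<Rightarrow> ('a, 'k) jen \<Rightarrow> ('a, 'k) jen" and pm :: "('a, 'k) jen \<Rightarrow> ('a, 'k) jen"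
    and w :: "nat \<Rightarrow> ('a, 'k) jen" and dg :: "nat \<Rightarrow> nat" and \<psi> :: "nat \<Rightarrow> 'h \<Rightarrow> 'k"
    and c :: "nat \<Rightarrow> nat \<Rightarrow> nat \<Rightarrow> 'k" and d :: "nat \<Rightarrow> nat \<Rightarrow> 'k"
  defines "Lgrp \<equiv> (AutoGroup P)\<lparr>carrier := L\<rparr>"
    and "A \<equiv> twisted_algebra p P br pm H \<pi> Z \<chi>"
    and "\<w> \<equiv> \<lambda>i \<phi>. w_elt p P br pm H \<pi> (g (\<psi> i) \<phi>) (w i) \<phi>"
  assumes p: "prime p" "CHAR('k) = p"
    and P: "group P" "Coset.order P = p ^ n"
    and L: "subgroup L (AutoGroup P)" "comm_group Lgrp" "coprime (card L) p"
    and alpha: "\<alpha>_class \<in> carrier (cohomology2 Lgrp)" "\<alpha> \<in> \<alpha>_class"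
      "group.ord (cocycles2 Lgrp) \<alpha> = group.ord (cohomology2 Lgrp) \<alpha>_class"
    and H: "group H" "finite (carrier H)" "coprime (Coset.order H) p"
    and Z: "subgroup Z H" "Z \<subseteq> group_center H" "Z = derived H (carrier H)"
    and extension: "\<pi> \<in> hom H Lgrp" "\<pi> ` carrier H = L" "kernel H Lgrp \<pi> = Z"
    and chi: "\<chi> \<in> hom (H\<lparr>carrier := Z\<rparr>) field_units" "inj_on \<chi> Z"
    and alpha_chi: "\<exists>s. (\<forall>x\<in>L. s x \<in> carrier H \<and> \<pi> (s x) = x) \<and>
      (\<forall>x\<in>L. \<forall>y\<in>L. \<alpha> (x, y) = \<chi> (s x \<otimes>\<^bsub>H\<^esub> s y \<otimes>\<^bsub>H\<^esub> inv\<^bsub>H\<^esub> s (x \<otimes>\<^bsub>Lgrp\<^esub> y)))"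
    and phi0: "\<phi>0 \<in> Irr_above H Z \<chi>"
    and xi: "\<And>\<phi>. \<phi> \<in> Irr_above H Z \<chi> \<Longrightarrow> \<xi> \<phi> \<in> inflated_chars H Z"
      "\<And>\<phi> h. \<lbrakk>\<phi> \<in> Irr_above H Z \<chi>; h \<in> group_center H\<rbrakk> \<Longrightarrow> \<xi> \<phi> h = \<phi> h * inverse (\<phi>0 h)"
      "\<xi> \<phi>0 = (\<lambda>h\<in>carrier H. 1)"
    and g: "g_choice H Z \<chi> \<xi> g"
    and Jen_structure: "jennings_structure p P br pm"
    and basis: "\<And>i. i \<in> {1..n} \<Longrightarrow> w i \<in> carrier (Jen P)"
      "\<And>v. v \<in> carrier (Jen P :: ('k, ('a, 'k) jen) module) \<Longrightarrow>
        \<exists>!a. a \<in> {1..n} \<rightarrow>\<^sub>E UNIV \<and> v = (\<Oplus>\<^bsub>Jen P\<^esub>i\<in>{1..n}. a i \<odot>\<^bsub>Jen P\<^esub> w i)"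
    and homogeneous: "\<And>i. i \<in> {1..n} \<Longrightarrow> w i \<in> jennings_homogeneous P (dg i)"
      "\<And>i j. \<lbrakk>i \<in> {1..n}; j \<in> {1..n}; i \<le> j\<rbrakk> \<Longrightarrow> dg i \<le> dg j"
    and eigenvector: "\<And>i. i \<in> {1..n} \<Longrightarrow> \<psi> i \<in> inflated_chars H Z"
      "\<And>i h. \<lbrakk>i \<in> {1..n}; h \<in> carrier H\<rbrakk> \<Longrightarrow> jennings_map (\<pi> h) (w i) = \<psi> i h \<odot>\<^bsub>Jen P\<^esub> w i"
    and bracket_coeffs: "\<And>i j. \<lbrakk>i \<in> {1..n}; j \<in> {1..n}\<rbrakk> \<Longrightarrow>
      br (w i) (w j) = (\<Oplus>\<^bsub>Jen P\<^esub>k\<in>{1..n}. c i j k \<odot>\<^bsub>Jen P\<^esub> w k)"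
    and p_map_coeffs: "\<And>i. i \<in> {1..n} \<Longrightarrow>
      pm (w i) = (\<Oplus>\<^bsub>Jen P\<^esub>k\<in>{1..n}. d i k \<odot>\<^bsub>Jen P\<^esub> w k)"
  shows "(\<forall>i\<in>{1..n}. \<forall>j\<in>{1..n}. \<forall>\<phi>\<in>Irr_above H Z \<chi>.
      \<w> j (twist H \<phi> (\<psi> i)) \<otimes>\<^bsub>A\<^esub> \<w> i \<phi>
        \<ominus>\<^bsub>A\<^esub> q_par H \<psi> g i j \<phi> \<odot>\<^bsub>A\<^esub> (\<w> i (twist H \<phi> (\<psi> j)) \<otimes>\<^bsub>A\<^esub> \<w> j \<phi>)
      = \<ominus>\<^bsub>A\<^esub> (\<Oplus>\<^bsub>A\<^esub>k\<in>{k \<in> {1..n}. c i j k \<noteq> 0}.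
          (c i j k * q'_par H \<psi> g i j k \<phi>) \<odot>\<^bsub>A\<^esub> \<w> k \<phi>))
    \<and> (\<forall>i\<in>{1..n}. \<forall>\<phi>\<in>Irr_above H Z \<chi>.
      desc_prod A (\<lambda>m. \<w> i (twist_pow H \<phi> (\<psi> i) m)) p
      = (\<Oplus>\<^bsub>A\<^esub>k\<in>{k \<in> {1..n}. d i k \<noteq> 0}.
          (d i k * q''_par p H \<psi> g i k \<phi>) \<odot>\<^bsub>A\<^esub> \<w> k \<phi>))
    \<and> (\<forall>i\<in>{1..n}. \<forall>j\<in>{1..n}. \<forall>\<phi>\<in>Irr_above H Z \<chi>.
      z_elt H \<psi> g i j \<phi> \<in> Z \<longrightarrow>
      q_par H \<psi> g i j \<phi>
        = \<psi> i (g (\<psi> j) \<phi>) * \<psi> j (inv\<^bsub>H\<^esub> (g (\<psi> i) \<phi>)) * \<chi> (z_elt H \<psi> g i j \<phi>))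
    \<and> (\<exists>g'. g_choice H Z \<chi> \<xi> g' \<and>
      (\<forall>\<psi>'\<in>inflated_chars H Z. \<forall>\<phi>\<in>Irr_above H Z \<chi>.
        \<exists>t\<in>group_center H. g' \<psi>' \<phi> = g \<psi>' \<phi> \<otimes>\<^bsub>H\<^esub> t) \<and>
      (\<forall>i\<in>{1..n}. \<forall>j\<in>{1..n}. \<forall>\<phi>\<in>Irr_above H Z \<chi>.
        z_elt H \<psi> g' i j \<phi> \<in> Z \<and>
        q_par H \<psi> g' i j \<phi>
          = \<psi> i (g' (\<psi> j) \<phi>) * \<psi> j (inv\<^bsub>H\<^esub> (g' (\<psi> i) \<phi>)) * \<chi> (z_elt H \<psi> g' i j \<phi>)))"
proof -
  interpret H: group H by (rule H(1))
  have p0: "p > 0" using p(1) by (rule prime_gt_0_nat)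
  note act = AutoGroup_action[OF P(1) H(1) L(1) extension(1)[unfolded Lgrp_def]]
  interpret jennings_action p P H \<pi> br pm
    using P(1) H p0 act Jen_structure by (intro jennings_action.intro) auto
  interpret C: central_character H Z \<chi> \<xi>
    by (intro central_character.intro central_character_axioms.intro H Z chi xi(1))
  note nonzero = H.card_subgroup_nonzero[OF _ H(2,3) p(2,1)]
  interpret rel: twisted_relations action.A H "action.mono \<one>\<^bsub>U\<^esub>"
    by unfold_locales (rule nonzero[OF H.subgroup_center])
  let ?A = action.A and ?I = "{1..n}"
  let ?e = "skew.idem Z \<chi>"
  \<comment> \<open>The relations are computed in the whole skew group algebra and carried over to
    the corner afterwards, which is possible because these elements are fixed by \<open>?e\<close>
    on the right.\<close>
  define N where "N = (\<lambda>i \<phi>. skew.M (g (\<psi> i) \<phi>) (W (w i)) \<phi>)"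
  have w_N: "\<w> = N" by (simp add: fun_eq_iff \<w>_def N_def w_elt_eq)
  have A: "A = corner_right ?A ?e" by (simp add: A_def twisted_algebra_eq)
  have e: "?e \<in> carrier ?A" using C.Z_carrier by (rule skew.idem_closed)
  note \<psi> = eigenvector(1) and chars = C.inflated_character[OF eigenvector(1)]
  note Irr = C.Irr_character
  note g_closed = C.g_closed[OF g]

  have eigen: "skew.eigen (W (w i)) (\<psi> i)" if "i \<in> ?I" for i
    using that basis(1) eigenvector(2) C.inflated_simps(2)[OF \<psi>[OF that]] by (intro W_eigen) auto
  have W: "W (w i) \<in> carrier ?A" if "i \<in> ?I" for i
    using eigen[OF that] by (simp add: skew.eigen_def)
  have N: "N i \<phi> \<in> carrier ?A" "N i \<phi> \<otimes>\<^bsub>?A\<^esub> ?e = N i \<phi>"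
    if "i \<in> ?I" "\<phi> \<in> Irr_above H Z \<chi>" for i \<phi>
  proof -
    show "N i \<phi> \<in> carrier ?A"
      unfolding N_def using g_closed[OF \<psi>[OF that(1)] that(2)] W[OF that(1)] by (rule rel.M_closed)
    have "\<chi> (inv\<^bsub>H\<^esub> z) * \<phi> z = 1" if "z \<in> Z" for z
    proof -
      have "\<chi> (inv\<^bsub>H\<^esub> z \<otimes>\<^bsub>H\<^esub> z) = \<chi> (inv\<^bsub>H\<^esub> z) * \<chi> z"
        using that subgroup.m_inv_closed[OF Z(1)] by (intro C.\<chi>_mult) auto
      then show ?thesis
        using that C.Z_carrier C.\<chi>_one \<open>\<phi> \<in> Irr_above H Z \<chi>\<close> by (auto simp: Irr_above_def subset_eq)
    qed
    then show "N i \<phi> \<otimes>\<^bsub>?A\<^esub> ?e = N i \<phi>"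
      unfolding N_def using that
      by (intro rel.M_idem Z(2) nonzero[OF Z(1)] Irr g_closed \<psi> W)
  qed
  have smult_corner: "c \<odot>\<^bsub>?A\<^esub> x \<in> carrier (corner_right ?A ?e)"
    if "x \<in> carrier ?A" "x \<otimes>\<^bsub>?A\<^esub> ?e = x" for c x
    using that e by (intro skew.corner_rightI) (simp_all add: skew.smult_mult_left)
  have corner_sum: "(\<Oplus>\<^bsub>A\<^esub>k\<in>K. a k \<odot>\<^bsub>A\<^esub> N k \<phi>) = (\<Oplus>\<^bsub>?A\<^esub>k\<in>K. a k \<odot>\<^bsub>?A\<^esub> N k \<phi>)"
      "(\<Oplus>\<^bsub>?A\<^esub>k\<in>K. a k \<odot>\<^bsub>?A\<^esub> N k \<phi>) \<in> carrier (corner_right ?A ?e)"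
    if "K \<subseteq> ?I" "\<phi> \<in> Irr_above H Z \<chi>" for K a \<phi>
  proof -
    have "finite K" using that(1) by (rule finite_subset) simp
    moreover have "a k \<odot>\<^bsub>?A\<^esub> N k \<phi> \<in> carrier (corner_right ?A ?e)" if "k \<in> K" for k
      using N[of k \<phi>] \<open>K \<subseteq> ?I\<close> that \<open>\<phi> \<in> Irr_above H Z \<chi>\<close> by (intro smult_corner) blast+
    ultimately have sum: "finite K" "\<And>k. k \<in> K \<Longrightarrow> a k \<odot>\<^bsub>?A\<^esub> N k \<phi> \<in> carrier (corner_right ?A ?e)"
      by blast+
    show "(\<Oplus>\<^bsub>A\<^esub>k\<in>K. a k \<odot>\<^bsub>A\<^esub> N k \<phi>) = (\<Oplus>\<^bsub>?A\<^esub>k\<in>K. a k \<odot>\<^bsub>?A\<^esub> N k \<phi>)"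
      unfolding A corner_right_simps(6) by (rule skew.corner_right_finsum(1)[OF e sum])
    show "(\<Oplus>\<^bsub>?A\<^esub>k\<in>K. a k \<odot>\<^bsub>?A\<^esub> N k \<phi>) \<in> carrier (corner_right ?A ?e)"
      by (rule skew.corner_right_finsum(2)[OF e sum])
  qed

  \<comment> \<open>Acting with \<open>h\<close> and scaling by \<open>\<theta>\<close> give two
    coordinate families for the same vector. Uniqueness yields
    \<open>a k * \<psi> k h = \<theta> * a k\<close>, and a nonzero \<open>a k\<close>
    cancels.\<close>
  have coeff: "\<psi> k h = \<theta>"
    if v: "v = (\<Oplus>\<^bsub>J\<^esub>k\<in>?I. a k \<odot>\<^bsub>J\<^esub> w k)" and h: "h \<in> carrier H"
      and \<theta>: "jennings_map (\<pi> h) v = \<theta> \<odot>\<^bsub>J\<^esub> v" and k: "k \<in> ?I" "a k \<noteq> 0" for v a h \<theta> k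
  proof -
    interpret hom: restricted_lie_automorphism p J br pm "jennings_map (\<pi> h)" "jennings_map (\<pi> (inv\<^bsub>H\<^esub> h))"
      by (rule lie_automorphism[OF h])
    interpret J: k_space J by (rule k_space_Jen) (rule P(1))
    have "\<theta> \<odot>\<^bsub>J\<^esub> v = (\<Oplus>\<^bsub>J\<^esub>k\<in>?I. \<theta> \<odot>\<^bsub>J\<^esub> (a k \<odot>\<^bsub>J\<^esub> w k))"
      unfolding v using basis(1) by (intro J.smult_finsum) auto
    \<comment> \<open>The coordinates are restricted to \<open>?I\<close> because the basis
      hypothesis asserts uniqueness among extensional families.\<close>
    also have "\<dots> = (\<Oplus>\<^bsub>J\<^esub>k\<in>?I. (\<lambda>k\<in>?I. \<theta> * a k) k \<odot>\<^bsub>J\<^esub> w k)"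
      using basis(1) by (intro M.finsum_cong') (auto simp: J.smult_assoc)
    finally have 1: "\<theta> \<odot>\<^bsub>J\<^esub> v = (\<Oplus>\<^bsub>J\<^esub>k\<in>?I. (\<lambda>k\<in>?I. \<theta> * a k) k \<odot>\<^bsub>J\<^esub> w k)" .
    have "jennings_map (\<pi> h) v = (\<Oplus>\<^bsub>J\<^esub>k\<in>?I. jennings_map (\<pi> h) (a k \<odot>\<^bsub>J\<^esub> w k))"
      unfolding v using basis(1) by (intro hom.hom_finsum) auto
    also have "\<dots> = (\<Oplus>\<^bsub>J\<^esub>k\<in>?I. (\<lambda>k\<in>?I. a k * \<psi> k h) k \<odot>\<^bsub>J\<^esub> w k)"
      using basis(1) eigenvector(2)[OF _ h] by (intro M.finsum_cong') (auto simp: hom.hom_smult J.smult_assoc)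
    finally have 2: "jennings_map (\<pi> h) v = (\<Oplus>\<^bsub>J\<^esub>k\<in>?I. (\<lambda>k\<in>?I. a k * \<psi> k h) k \<odot>\<^bsub>J\<^esub> w k)" .
    have "\<theta> \<odot>\<^bsub>J\<^esub> v \<in> carrier J"
      unfolding v using basis(1) by (intro J.smult_closed M.finsum_closed) auto
    from basis(2)[OF this] obtain b where
      unique: "\<forall>a. a \<in> ?I \<rightarrow>\<^sub>E UNIV \<and> \<theta> \<odot>\<^bsub>J\<^esub> v = (\<Oplus>\<^bsub>J\<^esub>i\<in>?I. a i \<odot>\<^bsub>J\<^esub> w i) \<longrightarrow> a = b"
      by (rule ex1E)
    have "(\<lambda>k\<in>?I. a k * \<psi> k h) = b" "(\<lambda>k\<in>?I. \<theta> * a k) = b"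
      by (rule unique[rule_format], rule conjI[OF _ trans[OF \<theta>[symmetric] 2]], simp)
         (rule unique[rule_format], rule conjI[OF _ 1], simp)
    then have "(\<lambda>k\<in>?I. a k * \<psi> k h) = (\<lambda>k\<in>?I. \<theta> * a k)" by simp
    from fun_cong[OF this, of k] show ?thesis using k by simp
  qed
  have c_char: "\<psi> k h = \<psi> i h * \<psi> j h"
    if "i \<in> ?I" "j \<in> ?I" "k \<in> ?I" "c i j k \<noteq> 0" "h \<in> carrier H" for i j k h
  proof (rule coeff[OF bracket_coeffs[OF that(1,2)] that(5) _ that(3,4)])
    interpret hom: restricted_lie_automorphism p J br pm "jennings_map (\<pi> h)" "jennings_map (\<pi> (inv\<^bsub>H\<^esub> h))"
      by (rule lie_automorphism[OF that(5)])
    interpret J: k_space J by (rule k_space_Jen) (rule P(1))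
    show "jennings_map (\<pi> h) (br (w i) (w j)) = (\<psi> i h * \<psi> j h) \<odot>\<^bsub>J\<^esub> br (w i) (w j)"
      using that basis(1)
      by (simp add: hom.hom_br eigenvector(2) br_smult_left br_smult_right br_closed mult.commute flip: J.smult_assoc)
  qed
  have d_char: "\<psi> k h = \<psi> i h ^ p"
    if "i \<in> ?I" "k \<in> ?I" "d i k \<noteq> 0" "h \<in> carrier H" for i k h
  proof (rule coeff[OF p_map_coeffs[OF that(1)] that(4) _ that(2,3)])
    interpret hom: restricted_lie_automorphism p J br pm "jennings_map (\<pi> h)" "jennings_map (\<pi> (inv\<^bsub>H\<^esub> h))"
      by (rule lie_automorphism[OF that(4)])
    show "jennings_map (\<pi> h) (pm (w i)) = \<psi> i h ^ p \<odot>\<^bsub>J\<^esub> pm (w i)"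
      using that basis(1) by (simp add: hom.hom_pm eigenvector(2) pm_smult)
  qed

  have relation1: "\<w> j (twist H \<phi> (\<psi> i)) \<otimes>\<^bsub>A\<^esub> \<w> i \<phi>
        \<ominus>\<^bsub>A\<^esub> q_par H \<psi> g i j \<phi> \<odot>\<^bsub>A\<^esub> (\<w> i (twist H \<phi> (\<psi> j)) \<otimes>\<^bsub>A\<^esub> \<w> j \<phi>)
      = \<ominus>\<^bsub>A\<^esub> (\<Oplus>\<^bsub>A\<^esub>k\<in>{k \<in> ?I. c i j k \<noteq> 0}. (c i j k * q'_par H \<psi> g i j k \<phi>) \<odot>\<^bsub>A\<^esub> \<w> k \<phi>)"
    if i: "i \<in> ?I" and j: "j \<in> ?I" and \<phi>: "\<phi> \<in> Irr_above H Z \<chi>" for i j \<phi>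
  proof -
    note tw = C.twist_Irr[OF \<phi> \<psi>]
    let ?x = "N j (twist H \<phi> (\<psi> i)) \<otimes>\<^bsub>?A\<^esub> N i \<phi>"
    let ?y = "N i (twist H \<phi> (\<psi> j)) \<otimes>\<^bsub>?A\<^esub> N j \<phi>"
    let ?s = "\<Oplus>\<^bsub>?A\<^esub>k\<in>{k \<in> ?I. c i j k \<noteq> 0}. (c i j k * q'_par H \<psi> g i j k \<phi>) \<odot>\<^bsub>?A\<^esub> N k \<phi>"
    have gs: "g (\<psi> i) \<phi> \<in> carrier H" "g (\<psi> j) \<phi> \<in> carrier H"
      "g (\<psi> i) (twist H \<phi> (\<psi> j)) \<in> carrier H" "g (\<psi> j) (twist H \<phi> (\<psi> i)) \<in> carrier H"
      using g_closed \<psi> tw i j \<phi> by blast+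
    have z: "z_elt H \<psi> g i j \<phi> \<in> group_center H" by (rule C.z_elt_center[OF g \<psi>[OF i] \<psi>[OF j] \<phi>])
    have z_eq: "g (\<psi> j) (twist H \<phi> (\<psi> i)) \<otimes>\<^bsub>H\<^esub> g (\<psi> i) \<phi>
        = g (\<psi> i) (twist H \<phi> (\<psi> j)) \<otimes>\<^bsub>H\<^esub> g (\<psi> j) \<phi> \<otimes>\<^bsub>H\<^esub> z_elt H \<psi> g i j \<phi>"
      using gs unfolding z_elt_def by (simp flip: H.m_assoc)
    have z': "g (\<psi> k) \<phi> \<in> carrier H \<and> z'_elt H \<psi> g i j k \<phi> \<in> group_center H \<and>
        g (\<psi> j) (twist H \<phi> (\<psi> i)) \<otimes>\<^bsub>H\<^esub> g (\<psi> i) \<phi> = g (\<psi> k) \<phi> \<otimes>\<^bsub>H\<^esub> z'_elt H \<psi> g i j k \<phi>"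
      if k: "k \<in> ?I" "c i j k \<noteq> 0" for k
    proof (intro conjI)
      show gk: "g (\<psi> k) \<phi> \<in> carrier H" using g_closed[OF \<psi>[OF k(1)] \<phi>] .
      show "z'_elt H \<psi> g i j k \<phi> \<in> group_center H"
        by (rule C.z'_elt_center[OF g \<psi>[OF i] \<psi>[OF j] \<psi>[OF k(1)] \<phi> c_char[OF i j k]])
      show "g (\<psi> j) (twist H \<phi> (\<psi> i)) \<otimes>\<^bsub>H\<^esub> g (\<psi> i) \<phi> = g (\<psi> k) \<phi> \<otimes>\<^bsub>H\<^esub> z'_elt H \<psi> g i j k \<phi>"
        using gk gs unfolding z'_elt_def by (simp flip: H.m_assoc)
    qed
    have bracket: "W (w i) \<otimes>\<^bsub>?A\<^esub> W (w j) \<ominus>\<^bsub>?A\<^esub> W (w j) \<otimes>\<^bsub>?A\<^esub> W (w i) = (\<Oplus>\<^bsub>?A\<^esub>k\<in>?I. c i j k \<odot>\<^bsub>?A\<^esub> W (w k))"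
      using W_relations(1)[OF basis(1)[OF i] basis(1)[OF j]] bracket_coeffs[OF i j] W_lincomb[of ?I w] basis(1) by simp
    have "?x \<ominus>\<^bsub>?A\<^esub> q_par H \<psi> g i j \<phi> \<odot>\<^bsub>?A\<^esub> ?y = \<ominus>\<^bsub>?A\<^esub> ?s"
      unfolding N_def q_par_def q'_par_def Let_def
      by (rule rel.commutation_relation[OF finite_atLeastAtMost i j eigen chars Irr[OF \<phi>] gs z z_eq bracket z'])
    \<comment> \<open>Each negated term must be placed in the corner before the negation of
      \<open>A\<close> may be replaced by that of \<open>?A\<close>.\<close>
    moreover have "q_par H \<psi> g i j \<phi> \<odot>\<^bsub>?A\<^esub> ?y \<in> carrier (corner_right ?A ?e)"
      using N[OF i tw[OF j]] N[OF j \<phi>] e by (intro smult_corner) (simp_all add: skew.m_assoc)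
    moreover have "?s \<in> carrier (corner_right ?A ?e)" using \<phi> by (intro corner_sum) auto
    ultimately show ?thesis
      unfolding w_N using \<phi> by (subst corner_sum) (auto simp: A skew.corner_right_minus[OF e])
  qed
  have relation2: "desc_prod A (\<lambda>m. \<w> i (twist_pow H \<phi> (\<psi> i) m)) p
      = (\<Oplus>\<^bsub>A\<^esub>k\<in>{k \<in> ?I. d i k \<noteq> 0}. (d i k * q''_par p H \<psi> g i k \<phi>) \<odot>\<^bsub>A\<^esub> \<w> k \<phi>)"
    if i: "i \<in> ?I" and \<phi>: "\<phi> \<in> Irr_above H Z \<chi>" for i \<phi>
  proof -
    note tw = C.twist_pow_Irr[OF \<phi> \<psi>[OF i]]
    let ?\<gamma> = "\<lambda>m. g (\<psi> i) (twist_pow H \<phi> (\<psi> i) m)"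
    have \<gamma>: "?\<gamma> m \<in> carrier H" for m by (rule g_closed[OF \<psi>[OF i] tw])
    have dp: "desc_prod H ?\<gamma> p \<in> carrier H" by (rule C.rho_desc_prod(1)[OF g \<psi>[OF i] \<phi>])
    have z'': "g (\<psi> k) \<phi> \<in> carrier H \<and> z''_elt p H \<psi> g i k \<phi> \<in> group_center H \<and>
        desc_prod H ?\<gamma> p = g (\<psi> k) \<phi> \<otimes>\<^bsub>H\<^esub> z''_elt p H \<psi> g i k \<phi>"
      if k: "k \<in> ?I" "d i k \<noteq> 0" for k
    proof (intro conjI)
      show gk: "g (\<psi> k) \<phi> \<in> carrier H" using g_closed[OF \<psi>[OF k(1)] \<phi>] .
      show "z''_elt p H \<psi> g i k \<phi> \<in> group_center H"
        by (rule C.z''_elt_center[OF g \<psi>[OF i] \<psi>[OF k(1)] \<phi> d_char[OF i k]])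
      show "desc_prod H ?\<gamma> p = g (\<psi> k) \<phi> \<otimes>\<^bsub>H\<^esub> z''_elt p H \<psi> g i k \<phi>"
        using gk dp unfolding z''_elt_def by (simp flip: H.m_assoc)
    qed
    have pow: "W (w i) [^]\<^bsub>?A\<^esub> p = (\<Oplus>\<^bsub>?A\<^esub>k\<in>?I. d i k \<odot>\<^bsub>?A\<^esub> W (w k))"
      using W_relations(2)[OF basis(1)[OF i] basis(1)[OF i]] p_map_coeffs[OF i] W_lincomb[of ?I w] basis(1) by simp
    have "desc_prod ?A (\<lambda>m. N i (twist_pow H \<phi> (\<psi> i) m)) p
        = (\<Oplus>\<^bsub>?A\<^esub>k\<in>{k \<in> ?I. d i k \<noteq> 0}. (d i k * q''_par p H \<psi> g i k \<phi>) \<odot>\<^bsub>?A\<^esub> N k \<phi>)"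
      unfolding N_def q''_par_def Let_def
      by (rule rel.power_relation[OF finite_atLeastAtMost i eigen chars Irr[OF \<phi>] \<gamma> p0 pow z''])
    moreover have "desc_prod A (\<lambda>m. N i (twist_pow H \<phi> (\<psi> i) m)) p = desc_prod ?A (\<lambda>m. N i (twist_pow H \<phi> (\<psi> i) m)) p"
      unfolding A using N[OF i tw] p0 by (intro skew.corner_right_desc_prod)
    ultimately show ?thesis
      unfolding w_N using \<phi> by (subst corner_sum) auto
  qed
  obtain g' where g': "g_choice H Z \<chi> \<xi> g'"
    and z_Z: "\<And>\<psi> i j \<phi>. \<psi> i \<in> inflated_chars H Z \<Longrightarrow> \<psi> j \<in> inflated_chars H Z \<Longrightarrow> \<phi> \<in> Irr_above H Z \<chi> \<Longrightarrow>
      z_elt H \<psi> g' i j \<phi> \<in> Z"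
    using C.symmetric_g_choice[OF g] by blast
  \<comment> \<open>Both families satisfy \<open>g_choice\<close>, so corresponding members have the
    same image under \<rho> and differ by a central factor.\<close>
  have "\<exists>t\<in>group_center H. g' \<psi>' \<phi> = g \<psi>' \<phi> \<otimes>\<^bsub>H\<^esub> t"
    if "\<psi>' \<in> inflated_chars H Z" "\<phi> \<in> Irr_above H Z \<chi>" for \<psi>' \<phi>
  proof (rule bexI)
    have cl: "g \<psi>' \<phi> \<in> carrier H" "g' \<psi>' \<phi> \<in> carrier H"
      using g_closed[OF that] C.g_closed[OF g' that] .
    show "inv\<^bsub>H\<^esub> (g \<psi>' \<phi>) \<otimes>\<^bsub>H\<^esub> g' \<psi>' \<phi> \<in> group_center H"
      using cl C.rho_g[OF g that] C.rho_g[OF g' that] by (intro C.rho_eq_center) simp_all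
    show "g' \<psi>' \<phi> = g \<psi>' \<phi> \<otimes>\<^bsub>H\<^esub> (inv\<^bsub>H\<^esub> (g \<psi>' \<phi>) \<otimes>\<^bsub>H\<^esub> g' \<psi>' \<phi>)"
      using cl by (simp flip: H.m_assoc)
  qed
  moreover have "z_elt H \<psi> g i j \<phi> \<in> Z \<Longrightarrow>
      q_par H \<psi> g i j \<phi> = \<psi> i (g (\<psi> j) \<phi>) * \<psi> j (inv\<^bsub>H\<^esub> (g (\<psi> i) \<phi>)) * \<chi> (z_elt H \<psi> g i j \<phi>)"
    and "z_elt H \<psi> g' i j \<phi> \<in> Z \<and>
      q_par H \<psi> g' i j \<phi> = \<psi> i (g' (\<psi> j) \<phi>) * \<psi> j (inv\<^bsub>H\<^esub> (g' (\<psi> i) \<phi>)) * \<chi> (z_elt H \<psi> g' i j \<phi>)"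
    if "i \<in> ?I" "j \<in> ?I" "\<phi> \<in> Irr_above H Z \<chi>" for i j \<phi>
    using C.q_par_central[OF g, of \<psi> i j \<phi>] C.q_par_central[OF g', of \<psi> i j \<phi>] z_Z[of \<psi> i j \<phi>] \<psi> that
    by auto
  ultimately show ?thesis
    using relation1 relation2 g' by (intro conjI ballI impI exI[of _ g']) blast+
qed

end
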